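(* Let $l_0,l_1,l_2,l_3\in\mathbb{Z}_{\ge 0}$, $l=l_0+l_1+l_2+l_3$, and $$\tilde\Lambda(x)=\frac{\prod_{j=1}^{l}\sigma(x+t_j)}{\sigma(x)^{l_0}\sigma_1(x)^{l_1}\sigma_2(x)^{l_2}\sigma_3(x)^{l_3}}\exp(cx),$$ where $c,t_1,\dots,t_l\in\mathbb{C}$ satisfy $t_j\neq t_{j'}$ $(j\ne j')$ and $t_j\neq\omega_i$ $(j=1,\dots,l,\ i=0,1,2,3)$ modulo $2\omega_1\mathbb{Z}+2\omega_3\mathbb{Z}$. (1) The function $\tilde\Lambda(x)$ satisfies $(H-E)\tilde\Lambda(x)=0$ for some $E\in\mathbb{C}$ if and only if $t_1,\dots,t_l$ and $c$ satisfy all of the relations $$\sum_{k\ne j}\zeta(-t_j+t_k)-l_0\zeta(-t_j)-\sum_{i=1}^{3}l_i\bigl(\zeta(-t_j+\omega_i)-\zeta(\omega_i)\bigr)=-c\qquad(j=1,\dots,l),$$ $$(1-\delta_{l_0,0})\Bigl(c+\sum_{j=1}^{l}\zeta(t_j)\Bigr)=0,$$ $$(1-\delta_{l_i,0})\Bigl(c+l\,\zeta(\omega_i)+\sum_{j=1}^{l}\zeta(-\omega_i+t_j)\Bigr)=0\qquad(i=1,2,3),$$ and in this case the eigenvalue is $$E=-c^2+(l_0l_1+l_2l_3)e_1+(l_0l_2+l_1l_3)e_2+(l_0l_3+l_1l_2)e_3-\sum_{i=1}^{3}l_i\eta_i(2c+l\eta_i)$$ $$\qquad-\sum_{j=1}^{l}\sum_{i=0}^{3}l_i\bigl(\wp(t_j-\omega_i)-\zeta(t_j-\omega_i)^2\bigr)+\sum_{j<k}\bigl(\wp(t_j-t_k)-\zeta(t_j-t_k)^2\bigr).$$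 (2) If $Q(E)\neq 0$, then a basis of the solutions $f$ to $(H-E)f=0$ is given by $\tilde\Lambda(x)$ and $\tilde\Lambda(-x)$, where $\tilde\Lambda$ is of the form $$\tilde\Lambda(x)=\frac{\prod_{j=1}^{l}\sigma(x+t_j)}{\sigma(x)^{l_0}\sigma_1(x)^{l_1}\sigma_2(x)^{l_2}\sigma_3(x)^{l_3}}\exp(cx)$$ for some $c$ and some $t_1,\dots,t_l$ with $t_j\ne t_{j'}$ $(j\neq j')$ and $t_j\ne\omega_i$ $(j=1,\dots,l,\ i=0,1,2,3)$ modulo $2\omega_1\mathbb{Z}+2\omega_3\mathbb{Z}$.
   Context: Let $\omega_1,\omega_3\in\mathbb{C}$ with $\omega_3/\omega_1$ in the upper half plane; $\omega_0=0$, $\omega_2=-(\omega_1+\omega_3)$. $\wp,\zeta,\sigma$ are the Weierstrass functions with periods $(2\omega_1,2\omega_3)$; $e_i=\wp(\omega_i)$, $\eta_i=\zeta(\omega_i)$ for $i=1,2,3$; the co-sigma functions are $\sigma_i(x)=e^{-\eta_i x}\sigma(x+\omega_i)/\sigma(\omega_i)$ $(i=1,2,3)$. $\delta$ is the Kronecker delta. The Hamiltonian is $H=-\frac{d^2}{dx^2}+\sum_{i=0}^3 l_i(l_i+1)\wp(x+\omega_i)$. Definition of $Q(E)$: there is a unique function of the form $\Xi(x,E)=c_0(E)+\sum_{i=0}^3\sum_{j=0}^{l_i-1}b_j^{(i)}(E)\wp(x+\omega_i)^{l_i-j}$, with $c_0(E),b^{(i)}_j(E)$ polynomials in $E$ without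 common divisor and $c_0(E)$ monic, satisfying for all $E$ $$\Bigl(\tfrac{d^3}{dx^3}-4\bigl(\textstyle\sum_{i=0}^3 l_i(l_i+1)\wp(x+\omega_i)-E\bigr)\tfrac{d}{dx}-2\textstyle\sum_{i=0}^3 l_i(l_i+1)\wp'(x+\omega_i)\Bigr)\Xi(x,E)=0.$$ Then $$Q(E)=\Xi(x,E)^2\Bigl(E-\sum_{i=0}^3 l_i(l_i+1)\wp(x+\omega_i)\Bigr)+\frac12\,\Xi(x,E)\frac{d^2\Xi(x,E)}{dx^2}-\frac14\Bigl(\frac{d\Xi(x,E)}{dx}\Bigr)^2,$$ which is independent of $x$ and is a monic polynomial in $E$. *)

theory Defs
  imports "HOL-Complex_Analysis.Complex_Analysis"
begin

section \<open>Weierstrass functions\<close>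

text \<open>
  Throughout, \<^term>\<open>w1\<close> and \<^term>\<open>w3\<close> are the half-periods, so the period lattice is spanned
  by \<open>2 * w1\<close> and \<open>2 * w3\<close>.
\<close>

definition period_lattice :: "complex \<Rightarrow> complex \<Rightarrow> complex set" where
  "period_lattice w1 w3 = {of_int m * (2 * w1) + of_int n * (2 * w3) | m n :: int. True}"

text \<open>\<open>\<omega>\<^sub>0 = 0\<close> and \<open>\<omega>\<^sub>2 = -(\<omega>\<^sub>1 + \<omega>\<^sub>3)\<close>; only the indices \<open>0, \<dots>, 3\<close> are ever used.\<close>

definition half_period :: "complex \<Rightarrow> complex \<Rightarrow> nat \<Rightarrow> complex" where
  "half_period w1 w3 i =
     (if i = 0 then 0 else if i = 1 then w1 else if i = 2 then - (w1 + w3) else w3)"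

text \<open>
  The sums converge absolutely off the lattice. On the lattice itself the values of
  \<open>weierstrass_p\<close> and \<open>weierstrass_zeta\<close> (which have poles there) carry no meaning.
\<close>

definition weierstrass_p :: "complex \<Rightarrow> complex \<Rightarrow> complex \<Rightarrow> complex" where
  "weierstrass_p w1 w3 z =
     1 / z ^ 2 + (\<Sum>\<^sub>\<infinity>w\<in>period_lattice w1 w3 - {0}. 1 / (z - w) ^ 2 - 1 / w ^ 2)"

definition weierstrass_zeta :: "complex \<Rightarrow> complex \<Rightarrow> complex \<Rightarrow> complex" where
  "weierstrass_zeta w1 w3 z =
     1 / z + (\<Sum>\<^sub>\<infinity>w\<in>period_lattice w1 w3 - {0}. 1 / (z - w) + 1 / w + z / w ^ 2)"

text \<open>
  The unordered (absolutely convergent) product over the nonzero lattice points; the elementary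
  factor is \<open>weierstrass_factor 2 u = (1 - u) * exp (u + u\<^sup>2 / 2)\<close>.
\<close>

definition weierstrass_sigma :: "complex \<Rightarrow> complex \<Rightarrow> complex \<Rightarrow> complex" where
  "weierstrass_sigma w1 w3 z =
     z * Lim (finite_subsets_at_top (period_lattice w1 w3 - {0}))
           (\<lambda>F. \<Prod>w\<in>F. weierstrass_factor 2 (z / w))"

definition half_period_e :: "complex \<Rightarrow> complex \<Rightarrow> nat \<Rightarrow> complex" where
  "half_period_e w1 w3 i = weierstrass_p w1 w3 (half_period w1 w3 i)"

definition half_period_eta :: "complex \<Rightarrow> complex \<Rightarrow> nat \<Rightarrow> complex" where
  "half_period_eta w1 w3 i = weierstrass_zeta w1 w3 (half_period w1 w3 i)"

definition cosigma :: "complex \<Rightarrow> complex \<Rightarrow> nat \<Rightarrow> complex \<Rightarrow> complex" where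
  "cosigma w1 w3 i x =
     exp (- half_period_eta w1 w3 i * x) *
     weierstrass_sigma w1 w3 (x + half_period w1 w3 i) /
     weierstrass_sigma w1 w3 (half_period w1 w3 i)"


section \<open>The Hamiltonian\<close>

text \<open>
  The parameters \<open>l\<^sub>0, \<dots>, l\<^sub>3\<close> are given by a function \<^term>\<open>l :: nat \<Rightarrow> nat\<close>, of which only the
  values at \<open>0, \<dots>, 3\<close> matter. If \<open>l i = 0\<close>, the \<open>i\<close>-th term of the potential is the zero function,
  so the points congruent to \<open>\<omega>\<^sub>i\<close> are regular points of the equation.
\<close>

definition heun_potential :: "complex \<Rightarrow> complex \<Rightarrow> (nat \<Rightarrow> nat) \<Rightarrow> complex \<Rightarrow> complex" where
  "heun_potential w1 w3 l x =
     (\<Sum>i=0..3. of_nat (l i * (l i + 1)) * weierstrass_p w1 w3 (x + half_period w1 w3 i))"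

definition heun_domain :: "complex \<Rightarrow> complex \<Rightarrow> (nat \<Rightarrow> nat) \<Rightarrow> complex set" where
  "heun_domain w1 w3 l =
     {x. \<forall>i\<le>3. l i > 0 \<longrightarrow> x + half_period w1 w3 i \<notin> period_lattice w1 w3}"

definition heun_H ::
    "complex \<Rightarrow> complex \<Rightarrow> (nat \<Rightarrow> nat) \<Rightarrow> (complex \<Rightarrow> complex) \<Rightarrow> complex \<Rightarrow> complex" where
  "heun_H w1 w3 l f x = - (deriv ^^ 2) f x + heun_potential w1 w3 l x * f x"

definition heun_solutions ::
    "complex \<Rightarrow> complex \<Rightarrow> (nat \<Rightarrow> nat) \<Rightarrow> complex \<Rightarrow> complex set \<Rightarrow> (complex \<Rightarrow> complex) set" where
  "heun_solutions w1 w3 l E U =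
     {f. f holomorphic_on U \<and> (\<forall>x\<in>U. heun_H w1 w3 l f x - E * f x = 0)}"

text \<open>
  Functions are identified when they agree on \<^term>\<open>U\<close>; their values elsewhere are irrelevant.
\<close>

definition is_heun_solution_basis ::
    "complex \<Rightarrow> complex \<Rightarrow> (nat \<Rightarrow> nat) \<Rightarrow> complex \<Rightarrow> complex set \<Rightarrow>
     (complex \<Rightarrow> complex) \<Rightarrow> (complex \<Rightarrow> complex) \<Rightarrow> bool" where
  "is_heun_solution_basis w1 w3 l E U f g \<longleftrightarrow>
     f \<in> heun_solutions w1 w3 l E U \<and> g \<in> heun_solutions w1 w3 l E U \<and>
     (\<forall>a b. (\<forall>x\<in>U. a * f x + b * g x = 0) \<longrightarrow> a = 0 \<and> b = 0) \<and>
     (\<forall>h\<in>heun_solutions w1 w3 l E U. \<exists>a b. \<forall>x\<in>U. h x = a * f x + b * g x)"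


section \<open>The polynomial \<open>Q(E)\<close>\<close>

definition heun_Xi_of ::
    "complex \<Rightarrow> complex \<Rightarrow> (nat \<Rightarrow> nat) \<Rightarrow> complex poly \<Rightarrow> (nat \<Rightarrow> nat \<Rightarrow> complex poly) \<Rightarrow>
     complex \<Rightarrow> complex \<Rightarrow> complex" where
  "heun_Xi_of w1 w3 l c0 b x E =
     poly c0 E +
     (\<Sum>i=0..3. \<Sum>j<l i. poly (b i j) E *
        weierstrass_p w1 w3 (x + half_period w1 w3 i) ^ (l i - j))"

definition is_heun_Xi ::
    "complex \<Rightarrow> complex \<Rightarrow> (nat \<Rightarrow> nat) \<Rightarrow> (complex \<Rightarrow> complex \<Rightarrow> complex) \<Rightarrow> bool" where
  "is_heun_Xi w1 w3 l X \<longleftrightarrow>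
     (\<exists>c0 b. X = heun_Xi_of w1 w3 l c0 b \<and>
        lead_coeff c0 = 1 \<and>
        (\<forall>d. d dvd c0 \<and> (\<forall>i\<le>3. \<forall>j<l i. d dvd b i j) \<longrightarrow> is_unit d)) \<and>
     (\<forall>E. \<forall>x\<in>heun_domain w1 w3 l.
        (deriv ^^ 3) (\<lambda>y. X y E) x
        - 4 * (heun_potential w1 w3 l x - E) * deriv (\<lambda>y. X y E) x
        - 2 * (\<Sum>i=0..3. of_nat (l i * (l i + 1)) *
                 deriv (weierstrass_p w1 w3) (x + half_period w1 w3 i)) * X x E = 0)"

definition heun_Xi :: "complex \<Rightarrow> complex \<Rightarrow> (nat \<Rightarrow> nat) \<Rightarrow> complex \<Rightarrow> complex \<Rightarrow> complex" where
  "heun_Xi w1 w3 l = (THE X. is_heun_Xi w1 w3 l X)"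

text \<open>The defining expression of \<open>Q(E)\<close> does not depend on the point \<^term>\<open>x\<close>.\<close>

definition heun_Q :: "complex \<Rightarrow> complex \<Rightarrow> (nat \<Rightarrow> nat) \<Rightarrow> complex \<Rightarrow> complex" where
  "heun_Q w1 w3 l E =
     (THE q. \<forall>x\<in>heun_domain w1 w3 l.
        q = heun_Xi w1 w3 l x E ^ 2 * (E - heun_potential w1 w3 l x)
            + 1 / 2 * heun_Xi w1 w3 l x E * (deriv ^^ 2) (\<lambda>y. heun_Xi w1 w3 l y E) x
            - 1 / 4 * (deriv (\<lambda>y. heun_Xi w1 w3 l y E) x) ^ 2)"


section \<open>The Bethe ansatz function\<close>

definition heun_size :: "(nat \<Rightarrow> nat) \<Rightarrow> nat" where
  "heun_size l = (\<Sum>i=0..3. l i)"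

definition heun_Lambda ::
    "complex \<Rightarrow> complex \<Rightarrow> (nat \<Rightarrow> nat) \<Rightarrow> complex \<Rightarrow> (nat \<Rightarrow> complex) \<Rightarrow> complex \<Rightarrow> complex" where
  "heun_Lambda w1 w3 l c t x =
     (\<Prod>j=1..heun_size l. weierstrass_sigma w1 w3 (x + t j)) /
     (weierstrass_sigma w1 w3 x ^ l 0 * (\<Prod>i=1..3. cosigma w1 w3 i x ^ l i)) * exp (c * x)"

definition heun_admissible :: "complex \<Rightarrow> complex \<Rightarrow> (nat \<Rightarrow> nat) \<Rightarrow> (nat \<Rightarrow> complex) \<Rightarrow> bool" where
  "heun_admissible w1 w3 l t \<longleftrightarrow>
     (\<forall>j\<in>{1..heun_size l}. \<forall>k\<in>{1..heun_size l}. j \<noteq> k \<longrightarrow> t j - t k \<notin> period_lattice w1 w3) \<and>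
     (\<forall>j\<in>{1..heun_size l}. \<forall>i\<le>3. t j - half_period w1 w3 i \<notin> period_lattice w1 w3)"

end

theory Submission
  imports Defs
begin

text \<open>
  The logarithmic derivative of \<open>\<Lambda>\<close> is a constant plus \<open>\<Sum> r\<^sub>a \<zeta>(x - p\<^sub>a)\<close> with \<open>\<Sum> r\<^sub>a = 0\<close>. The addition
  formula \<open>(\<zeta>(u) + \<zeta>(v) - \<zeta>(u + v))\<^sup>2 = \<wp>(u) + \<wp>(v) + \<wp>(u + v)\<close> turns its square into a combination of
  \<open>\<wp>(x - p\<^sub>a)\<close>, \<open>\<zeta>(x - p\<^sub>a)\<close> and \<open>1\<close>; the first group is the potential, the second vanishes exactly under the
  Bethe equations, and the third is the eigenvalue.

  For the second part, \<open>\<Xi>\<close> is obtained by truncating a formal solution in powers of \<open>1/E\<close> whose coefficients lie in a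
  finite-dimensional space of elliptic functions. If \<open>Q(E) \<noteq> 0\<close>, then \<open>(\<Xi>' + w) / (2 \<Xi>)\<close> with \<open>w\<^sup>2 = -4 Q(E)\<close> has
  simple poles only, with residue \<open>1\<close> at half of the zeros of \<open>\<Xi>\<close> and \<open>-l\<^sub>i\<close> at \<open>-\<omega>\<^sub>i\<close>; subtracting the matching
  \<open>\<zeta>\<close>-functions leaves a constant, which exhibits it as a logarithmic derivative of the required shape.
\<close>


section \<open>Sums over the period lattice\<close>


text \<open>Two obstacles shape the second half. The linear recursion for the formal solution gives
  only the derivative of the next coefficient, and integration could create logarithms or ever
  larger poles. Hence the coefficients are defined by the quadratic relation that expresses
  constancy of Q, normalised to Q = E; it is algebraic and keeps them meromorphic. The linear
  recursion, for which -2 l_i is an indicial root at -\<omega>_i, then bounds all poles uniformly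
  with the help of parity. Uniqueness of \<Xi> is Euclidean division: the solutions polynomial in E
  are the multiples of a single one. At a regular zero of \<Xi> the expression for Q reduces to
  -\<Xi>'^2 / 4. So Q(E) \<noteq> 0 makes these zeros simple with slope w or -w, and evenness of
  \<Xi> pairs the two signs. That exactly l classes of zeros have slope w is obtained without
  counting by contour integrals: a wrong number would make (\<eta>_1, \<eta>_3) proportional to
  (\<omega>_1, \<omega>_3), and this is excluded by a direct argument with \<sigma>.\<close>

lemma summable_on_int_powr:
  "(\<lambda>m::int. (1 + \<bar>of_int m\<bar> :: real) powr (- 3 / 2)) summable_on UNIV"
proof -
  define g where "g = (\<lambda>m::int. (1 + \<bar>of_int m\<bar> :: real) powr (- 3 / 2))"
  have "summable (\<lambda>n. of_nat (Suc n) powr (- 3 / 2) :: real)"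
    by (subst summable_Suc_iff) (simp add: summable_real_powr_iff)
  hence s: "(\<lambda>n. of_nat (Suc n) powr (- 3 / 2) :: real) summable_on UNIV"
    by (intro norm_summable_imp_summable_on) simp
  have "(\<lambda>n. g (int n)) summable_on UNIV"
    by (rule summable_on_cong[THEN iffD1, OF _ s]) (simp add: g_def)
  hence 1: "g summable_on range int"
    by (subst summable_on_reindex) (auto simp: o_def)
  have "(\<lambda>n. g (- 1 - int n)) summable_on UNIV"
    by (rule summable_on_comparison_test[OF s])
       (auto simp: g_def intro!: powr_mono2')
  hence 2: "g summable_on range (\<lambda>n. - 1 - int n)"
    by (subst summable_on_reindex) (auto simp: o_def inj_on_def)
  have "g summable_on (range int \<union> range (\<lambda>n. - 1 - int n))"
    by (rule summable_on_Un_disjoint[OF 1 2]) auto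
  moreover have "range int \<union> range (\<lambda>n. - 1 - int n) = UNIV"
  proof -
    have "m \<in> range int \<union> range (\<lambda>n. - 1 - int n)" for m
    proof (cases "m \<ge> 0")
      case True
      then show ?thesis by (auto intro!: image_eqI[of _ _ "nat m"])
    next
      case False
      then show ?thesis by (auto intro!: image_eqI[of _ _ "nat (- 1 - m)"])
    qed
    thus ?thesis by blast
  qed
  ultimately show ?thesis by (simp add: g_def)
qed

text \<open>A majorant that factors into two single series. With s = |m| + |n| \<ge> 1 one has (1 +
  |m|) (1 + |n|) \<le> (2 s)^2, so this summand dominates a multiple of s^(-3), the size of the
  cubic lattice sum.\<close>

lemma summable_on_int_prod_powr:
  "(\<lambda>(m::int, n::int). ((1 + \<bar>of_int m\<bar>) * (1 + \<bar>of_int n\<bar>) :: real) powr (- 3 / 2))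
     summable_on UNIV"
proof -
  define g where "g = (\<lambda>m::int. (1 + \<bar>of_int m\<bar> :: real) powr (- 3 / 2))"
  have g: "g summable_on UNIV"
    unfolding g_def by (rule summable_on_int_powr)
  have "(\<lambda>(m, n). g m * g n) summable_on Sigma UNIV (\<lambda>_. UNIV)"
  proof (rule summable_on_SigmaI)
    show "((\<lambda>y. case (x, y) of (m, n) \<Rightarrow> g m * g n) has_sum (g x * infsum g UNIV)) UNIV" for x
      using has_sum_cmult_right[OF has_sum_infsum[OF g]] by simp
    show "(\<lambda>x. g x * infsum g UNIV) summable_on UNIV"
      by (intro summable_on_cmult_left g)
  qed (auto simp: g_def)
  thus ?thesis
    by (simp add: g_def powr_mult case_prod_unfold)
qed

locale half_period_basis =
  fixes w1 w3 :: complex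
  assumes upper: "Im (w3 / w1) > 0"
begin

abbreviation Lat where "Lat \<equiv> period_lattice w1 w3"
abbreviation hp where "hp \<equiv> half_period w1 w3"
abbreviation wp where "wp \<equiv> weierstrass_p w1 w3"
abbreviation wz where "wz \<equiv> weierstrass_zeta w1 w3"
abbreviation ws where "ws \<equiv> weierstrass_sigma w1 w3"

lemma w1_nonzero [simp]: "w1 \<noteq> 0" and w3_nonzero [simp]: "w3 \<noteq> 0"
  using upper by auto

section \<open>The period lattice: group structure, discreteness and convergence\<close>

lemma LatI: "of_int m * (2 * w1) + of_int n * (2 * w3) \<in> Lat"
  by (auto simp: period_lattice_def)

lemma Lat_0 [simp]: "0 \<in> Lat"
  using LatI[of 0 0] by simp

lemma Lat_add: "x \<in> Lat \<Longrightarrow> y \<in> Lat \<Longrightarrow> x + y \<in> Lat"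
proof -
  assume "x \<in> Lat" "y \<in> Lat"
  then obtain m n m' n' :: int where
    "x = of_int m * (2 * w1) + of_int n * (2 * w3)"
    "y = of_int m' * (2 * w1) + of_int n' * (2 * w3)"
    by (auto simp: period_lattice_def)
  hence "x + y = of_int (m + m') * (2 * w1) + of_int (n + n') * (2 * w3)"
    by (simp add: algebra_simps)
  thus ?thesis by (metis LatI)
qed

lemma Lat_minus: "x \<in> Lat \<Longrightarrow> - x \<in> Lat"
proof -
  assume "x \<in> Lat"
  then obtain m n :: int where "x = of_int m * (2 * w1) + of_int n * (2 * w3)"
    by (auto simp: period_lattice_def)
  hence "- x = of_int (- m) * (2 * w1) + of_int (- n) * (2 * w3)"
    by (simp add: algebra_simps)
  thus ?thesis by (metis LatI)
qed

lemma Lat_minus_iff [simp]: "- x \<in> Lat \<longleftrightarrow> x \<in> Lat"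
  using Lat_minus[of x] Lat_minus[of "-x"] by auto

lemma Lat_diff: "x \<in> Lat \<Longrightarrow> y \<in> Lat \<Longrightarrow> x - y \<in> Lat"
  using Lat_add[of x "-y"] by simp

lemma Lat_diff_commute: "x - y \<in> Lat \<longleftrightarrow> y - x \<in> Lat"
  using Lat_minus_iff[of "x - y"] by simp

lemma Lat_add_cancel: "y \<in> Lat \<Longrightarrow> x + y \<in> Lat \<longleftrightarrow> x \<in> Lat"
  using Lat_add[of x y] Lat_diff[of "x + y" y] by auto

lemma Lat_diff_cancel: "y \<in> Lat \<Longrightarrow> x - y \<in> Lat \<longleftrightarrow> x \<in> Lat"
  using Lat_add_cancel[of "- y" x] by simp

lemma Lat_2w1 [simp]: "2 * w1 \<in> Lat" and Lat_2w3 [simp]: "2 * w3 \<in> Lat"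
  using LatI[of 1 0] LatI[of 0 1] by auto

text \<open>Reduces translation by a period to generator steps. Membership of \<open>x\<close> is
  carried along so that a step can use that translating by \<open>x\<close> keeps points off the
  lattice.\<close>

lemma Lat_induct [consumes 1, case_names zero w1 w3 minus_w1 minus_w3]:
  assumes "x \<in> Lat" "P 0" "\<And>x. x \<in> Lat \<Longrightarrow> P x \<Longrightarrow> P (x + 2 * w1)" "\<And>x. x \<in> Lat \<Longrightarrow> P x \<Longrightarrow> P (x + 2 * w3)"
    "\<And>x. x \<in> Lat \<Longrightarrow> P x \<Longrightarrow> P (x - 2 * w1)" "\<And>x. x \<in> Lat \<Longrightarrow> P x \<Longrightarrow> P (x - 2 * w3)"
  shows "P x"
proof -
  have *: "P (of_int n * (2 * w3))" for n
  proof (induction n rule: int_induct[of _ 0])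
    case (step1 i)
    then show ?case using assms(4)[OF _ step1(2)] LatI[of 0 i] by (simp add: algebra_simps)
  next
    case (step2 i)
    then show ?case using assms(6)[OF _ step2(2)] LatI[of 0 i] by (simp add: algebra_simps)
  qed (use assms in auto)
  have "P (of_int m * (2 * w1) + of_int n * (2 * w3))" for m n
  proof (induction m rule: int_induct[of _ 0])
    case (step1 i)
    then show ?case using assms(3)[OF _ step1(2)] LatI[of i n] by (simp add: algebra_simps)
  next
    case (step2 i)
    then show ?case using assms(5)[OF _ step2(2)] LatI[of i n] by (simp add: algebra_simps)
  qed (use * in auto)
  thus ?thesis using assms(1) by (auto simp: period_lattice_def)
qed

text \<open>After division by \<open>2 * w1\<close> the vector is m + n \<tau>. Its imaginary part
  controls n, and the triangle inequality then controls m. Real coordinates are allowed so that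
  linear independence over the reals follows as well.\<close>

lemma lattice_coordinate_bound:
  obtains c where "c > 0"
    "\<And>m n :: real. c * (\<bar>m\<bar> + \<bar>n\<bar>) \<le> norm (of_real m * (2 * w1) + of_real n * (2 * w3))"
proof -
  define \<tau> where "\<tau> = w3 / w1"
  define d where "d = 1 + (1 + norm \<tau>) / Im \<tau>"
  have im: "Im \<tau> > 0" using upper by (simp add: \<tau>_def)
  have d: "d > 0" unfolding d_def using im by (intro add_pos_nonneg divide_nonneg_pos) auto
  have 1: "\<bar>m\<bar> + \<bar>n\<bar> \<le> d * norm (of_real m + of_real n * \<tau>)" for m n :: real
  proof -
    define u where "u = of_real m + of_real n * \<tau>"
    have "Im u = n * Im \<tau>" by (simp add: u_def)
    hence "\<bar>n\<bar> * Im \<tau> \<le> norm u" using abs_Im_le_cmod[of u] im by (simp add: abs_mult)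
    hence n: "\<bar>n\<bar> \<le> norm u / Im \<tau>" using im by (simp add: field_simps)
    have "\<bar>m\<bar> = norm (u - of_real n * \<tau>)" by (simp add: u_def)
    also have "\<dots> \<le> norm u + \<bar>n\<bar> * norm \<tau>"
      by (rule norm_triangle_le_diff) (simp add: norm_mult)
    finally have "\<bar>m\<bar> + \<bar>n\<bar> \<le> norm u + \<bar>n\<bar> * (1 + norm \<tau>)"
      by (simp add: algebra_simps)
    also have "\<dots> \<le> norm u + norm u / Im \<tau> * (1 + norm \<tau>)"
      by (intro add_left_mono mult_right_mono n) auto
    also have "\<dots> = d * norm u" by (simp add: d_def field_simps)
    finally show ?thesis by (simp add: u_def)
  qed
  show ?thesis
  proof (rule that[of "2 * norm w1 / d"])
    show "2 * norm w1 / d > 0" using d by simp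
    fix m n :: real
    have "of_real m * (2 * w1) + of_real n * (2 * w3) = 2 * w1 * (of_real m + of_real n * \<tau>)"
      by (simp add: \<tau>_def field_simps)
    hence "norm (of_real m * (2 * w1) + of_real n * (2 * w3))
             = 2 * norm w1 * norm (of_real m + of_real n * \<tau>)"
      by (simp add: norm_mult)
    moreover have "\<dots> \<ge> 2 * norm w1 / d * (\<bar>m\<bar> + \<bar>n\<bar>)"
      using mult_left_mono[OF 1[of m n], of "2 * norm w1 / d"] d by simp
    ultimately show "2 * norm w1 / d * (\<bar>m\<bar> + \<bar>n\<bar>)
        \<le> norm (of_real m * (2 * w1) + of_real n * (2 * w3))" by simp
  qed
qed

lemma finite_Lat_ball: "finite (Lat \<inter> cball z R)"
proof -
  obtain c where c: "c > 0"
    "\<And>m n :: real. c * (\<bar>m\<bar> + \<bar>n\<bar>) \<le> norm (of_real m * (2 * w1) + of_real n * (2 * w3))"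
    by (rule lattice_coordinate_bound) blast
  define N where "N = \<lceil>(norm z + R) / c\<rceil>"
  have "Lat \<inter> cball z R \<subseteq> (\<lambda>(m,n). of_int m * (2 * w1) + of_int n * (2 * w3)) ` ({-N..N} \<times> {-N..N})"
  proof
    fix x assume x: "x \<in> Lat \<inter> cball z R"
    then obtain m n :: int where mn: "x = of_int m * (2 * w1) + of_int n * (2 * w3)"
      by (auto simp: period_lattice_def)
    have "norm x \<le> norm z + R"
      using x norm_triangle_ineq2[of x z] by (auto simp: dist_norm norm_minus_commute)
    hence "c * (\<bar>of_int m\<bar> + \<bar>of_int n\<bar>) \<le> norm z + R"
      using c(2)[of "of_int m" "of_int n"] mn by simp
    hence "(\<bar>of_int m\<bar> + \<bar>of_int n\<bar> :: real) \<le> (norm z + R) / c"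
      using c(1) by (simp add: field_simps)
    also have "\<dots> \<le> of_int N" by (simp add: N_def)
    finally have "\<bar>m\<bar> + \<bar>n\<bar> \<le> N" by linarith
    thus "x \<in> (\<lambda>(m,n). of_int m * (2 * w1) + of_int n * (2 * w3)) ` ({-N..N} \<times> {-N..N})"
      using mn by (intro image_eqI[of _ _ "(m,n)"]) auto
  qed
  thus ?thesis by (rule finite_subset) auto
qed

lemma summable_on_Lat: "(\<lambda>w. 1 / norm w ^ 3) summable_on (Lat - {0})"
proof -
  obtain c where c: "c > 0"
    "\<And>m n :: real. c * (\<bar>m\<bar> + \<bar>n\<bar>) \<le> norm (of_real m * (2 * w1) + of_real n * (2 * w3))"
    by (rule lattice_coordinate_bound) blast
  define f where "f = (\<lambda>(m::int,n::int). of_int m * (2 * w1) + of_int n * (2 * w3))"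
  have f_eq: "f (m,n) = of_real (of_int m) * (2 * w1) + of_real (of_int n) * (2 * w3)" for m n
    by (simp add: f_def)
  have inj: "inj f"
  proof (rule injI)
    fix x y assume xy: "f x = f y"
    obtain m n m' n' where [simp]: "x = (m,n)" "y = (m',n')" by (cases x; cases y)
    have "f (m - m', n - n') = 0" using xy by (simp add: f_def algebra_simps)
    hence "c * (\<bar>of_int (m - m')\<bar> + \<bar>of_int (n - n')\<bar>) \<le> 0"
      using c(2)[of "of_int (m - m')" "of_int (n - n')"] f_eq[of "m - m'" "n - n'"] by simp
    hence "\<bar>of_int (m - m')\<bar> + \<bar>of_int (n - n')\<bar> \<le> (0::real)"
      using c(1) by (simp add: mult_le_0_iff)
    hence "real_of_int (m - m') = 0 \<and> real_of_int (n - n') = 0" by linarith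
    thus "x = y" by simp
  qed
  have Lat: "Lat - {0} = f ` (UNIV - {(0,0)})"
  proof -
    have "Lat = range f" by (auto simp: period_lattice_def f_def)
    moreover have "f (0,0) = 0" by (simp add: f_def)
    ultimately show ?thesis using inj by (metis image_empty image_insert image_set_diff)
  qed
  define g where "g = (\<lambda>(m::int, n::int). ((1 + \<bar>of_int m\<bar>) * (1 + \<bar>of_int n\<bar>) :: real) powr (- 3 / 2))"
  have "(\<lambda>x. 8 / c ^ 3 * g x) summable_on UNIV"
    unfolding g_def by (intro summable_on_cmult_right summable_on_int_prod_powr)
  hence g: "(\<lambda>x. 8 / c ^ 3 * g x) summable_on (UNIV - {(0,0)})"
    by (rule summable_on_subset_banach) auto
  have "(\<lambda>x. 1 / norm (f x) ^ 3) summable_on (UNIV - {(0,0)})"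
  proof (rule summable_on_comparison_test[OF g])
    fix x assume x: "x \<in> UNIV - {(0::int,0::int)}"
    obtain m n where [simp]: "x = (m,n)" by (cases x)
    define s :: real where "s = \<bar>of_int m\<bar> + \<bar>of_int n\<bar>"
    have "\<bar>m\<bar> + \<bar>n\<bar> \<ge> 1" using x by auto
    hence s: "s \<ge> 1" unfolding s_def by linarith
    define p :: real where "p = (1 + \<bar>of_int m\<bar>) * (1 + \<bar>of_int n\<bar>)"
    have p0: "p > 0" unfolding p_def by (intro mult_pos_pos) auto
    have "p \<le> (2 * s) * (2 * s)" unfolding p_def using s by (intro mult_mono) (auto simp: s_def)
    hence "p powr (3/2) \<le> ((2 * s) powr 2) powr (3/2)"
      using p0 s by (intro powr_mono2) (auto simp: power2_eq_square powr_numeral)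
    also have "\<dots> = (2 * s) ^ 3" unfolding powr_powr using s by (simp add: powr_numeral)
    finally have ps: "p powr (3/2) \<le> 8 * s ^ 3" by (simp add: power_mult_distrib)
    have "c * s \<le> norm (f x)" using c(2)[of "of_int m" "of_int n"] f_eq[of m n] by (simp add: s_def)
    have cs0: "0 < c * s" using c(1) s by simp
    have cs: "(c * s) ^ 3 \<le> norm (f x) ^ 3" using \<open>c * s \<le> norm (f x)\<close> cs0 by (intro power_mono) auto
    have "1 / norm (f x) ^ 3 \<le> 1 / (c * s) ^ 3"
      using cs cs0 by (intro divide_left_mono mult_pos_pos zero_less_power)
         (use less_le_trans[OF cs0 \<open>c * s \<le> norm (f x)\<close>] c(1) s in auto)
    also have "\<dots> \<le> 8 / c ^ 3 * p powr (- 3 / 2)"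
    proof -
      have "p powr (- 3 / 2) = 1 / p powr (3/2)" using powr_minus_divide[of p "3/2"] by simp
      moreover have "1 / p powr (3/2) \<ge> 1 / (8 * s ^ 3)"
        using p0 s by (intro divide_left_mono mult_pos_pos ps) auto
      ultimately have "8 / c ^ 3 * p powr (- 3 / 2) \<ge> 8 / c ^ 3 * (1 / (8 * s ^ 3))"
        using c(1) by (intro mult_left_mono) auto
      also have "8 / c ^ 3 * (1 / (8 * s ^ 3)) = 1 / (c * s) ^ 3"
        by (simp add: power_mult_distrib)
      finally show ?thesis .
    qed
    finally show "1 / norm (f x) ^ 3 \<le> 8 / c ^ 3 * g x" by (simp add: g_def p_def)
  qed auto
  moreover have "inj_on f (UNIV - {(0,0)})" using inj by (rule inj_on_subset) auto
  ultimately show ?thesis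
    unfolding Lat by (subst summable_on_reindex) (auto simp: o_def)
qed

end


section \<open>The Weierstrass functions\<close>


lemma DERIV_inverse_shift:
  fixes z w :: complex
  assumes "z \<noteq> w"
  shows "((\<lambda>z. 1 / (z - w)) has_field_derivative - (1 / (z - w) ^ 2)) (at z)"
    and "((\<lambda>z. 1 / (z - w) ^ 2) has_field_derivative - (2 / (z - w) ^ 3)) (at z)"
proof -
  have nz: "z - w \<noteq> 0" using assms by simp
  have "((\<lambda>z. inverse (z - w)) has_field_derivative - (inverse ((z - w) ^ 2) * 1)) (at z)"
    using nz by (auto intro!: derivative_eq_intros simp: power2_eq_square)
  thus 1: "((\<lambda>z. 1 / (z - w)) has_field_derivative - (1 / (z - w) ^ 2)) (at z)"
    by (simp add: inverse_eq_divide)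
  have "((\<lambda>z. (1 / (z - w)) ^ 2) has_field_derivative 2 * (1 / (z - w)) * - (1 / (z - w) ^ 2)) (at z)"
    by (rule derivative_eq_intros 1 | simp)+
  thus "((\<lambda>z. 1 / (z - w) ^ 2) has_field_derivative - (2 / (z - w) ^ 3)) (at z)"
    by (simp add: power_divide power2_eq_square power3_eq_cube mult.assoc)
qed

lemma DERIV_zeta_term:
  "z \<noteq> w \<Longrightarrow> ((\<lambda>z. 1 / (z - w) + 1 / w + z / w ^ 2) has_field_derivative
     - (1 / (z - w) ^ 2) + 1 / w ^ 2) (at (z :: complex))"
  using DERIV_add[OF DERIV_add[OF DERIV_inverse_shift(1) DERIV_const] DERIV_cdivide[OF DERIV_ident]]
  by simp

lemma DERIV_p_term:
  "z \<noteq> w \<Longrightarrow> ((\<lambda>z. 1 / (z - w) ^ 2 - 1 / w ^ 2) has_field_derivative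
     - (2 / (z - w) ^ 3)) (at (z :: complex))"
  using DERIV_diff[OF DERIV_inverse_shift(2) DERIV_const] by simp

section \<open>The logarithm of the sigma product over distant lattice points\<close>

context half_period_basis
begin

text \<open>A logarithm of \<open>weierstrass_factor 2 (z / w)\<close>. The principal branch is safe
  because it is applied to points with |z / w| < 1/2; the factor 2 in \<open>Lat_near\<close> and
  \<open>Lat_far\<close> ensures this on \<open>ball 0 R\<close>.\<close>

definition log_factor :: "complex \<Rightarrow> complex \<Rightarrow> complex" where
  "log_factor w z = Ln (1 - z / w) + z / w + (z / w) ^ 2 / 2"

definition Lat_near :: "real \<Rightarrow> complex set" where
  "Lat_near R = {w \<in> Lat - {0}. norm w \<le> 2 * R}"

definition Lat_far :: "real \<Rightarrow> complex set" where
  "Lat_far R = {w \<in> Lat - {0}. norm w > 2 * R}"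

text \<open>One holomorphic function serves all of sigma, zeta, \<open>wp\<close> and
  \<open>wp'\<close>: on \<open>ball 0 R\<close> they differ from finite expressions by its
  exponential and, up to sign, by its first three derivatives.\<close>

definition log_tail :: "real \<Rightarrow> complex \<Rightarrow> complex" where
  "log_tail R z = (\<Sum>\<^sub>\<infinity>w\<in>Lat_far R. log_factor w z)"

lemma finite_Lat_near: "finite (Lat_near R)"
  by (rule finite_subset[OF _ finite_Lat_ball[of 0 "2 * R"]]) (auto simp: Lat_near_def)

lemma Lat_near_far: "Lat - {0} = Lat_near R \<union> Lat_far R" "Lat_near R \<inter> Lat_far R = {}"
  by (auto simp: Lat_near_def Lat_far_def)

lemma Lat_far_ball:
  assumes "w \<in> Lat_far R" "z \<in> ball 0 R"
  shows "norm (z / w) < 1 / 2" "w \<noteq> 0" "z \<noteq> w" "norm (z - w) > norm w / 2"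
    "norm w > 2 * R" "norm z < R" "R > 0"
proof -
  have w: "norm w > 2 * R" "w \<noteq> 0" and z: "norm z < R" using assms by (auto simp: Lat_far_def)
  show "R > 0" using z norm_ge_zero[of z] by linarith
  show "norm (z / w) < 1 / 2" using w z by (simp add: norm_divide field_simps)
  have "norm w \<le> norm (z - w) + norm z" by (metis add.commute norm_minus_commute norm_triangle_sub)
  thus n: "norm (z - w) > norm w / 2" using w z by linarith
  show "z \<noteq> w" using w(2) n by auto
qed (use assms in \<open>auto simp: Lat_far_def\<close>)

lemma log_factor_deriv:
  assumes "w \<in> Lat_far R" "z \<in> ball 0 R"
  shows "(log_factor w has_field_derivative (1 / (z - w) + 1 / w + z / w ^ 2)) (at z)"
proof -
  note * = Lat_far_ball[OF assms]
  have "Re (z / w) < 1" using *(1) complex_Re_le_cmod[of "z / w"] by linarith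
  hence "1 - z / w \<notin> \<real>\<^sub>\<le>\<^sub>0" by (auto simp: complex_nonpos_Reals_iff)
  hence "(log_factor w has_field_derivative (- (1 / w) / (1 - z / w) + 1 / w + z / w / w)) (at z)"
    unfolding log_factor_def using *(2)
    by (auto intro!: derivative_eq_intros simp: power2_eq_square) (simp add: inverse_eq_divide mult.commute)
  moreover have "- (1 / w) / (1 - z / w) = 1 / (z - w)"
    using *(2,3) by (simp add: field_simps)
  ultimately show ?thesis by (simp only: power2_eq_square divide_divide_eq_left)
qed

text \<open>The factor vanishes at 0 and its derivative collapses to z^2 / (w^2 (z - w)), which is
  of size |w|^(-3). Integrating along the ball gives the summable bound.\<close>

lemma log_factor_bound:
  assumes "w \<in> Lat_far R" "z \<in> ball 0 R"
  shows "norm (log_factor w z) \<le> 2 * R ^ 3 * (1 / norm w ^ 3)"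
proof -
  have "norm (log_factor w z - log_factor w 0) \<le> (2 * R ^ 2 / norm w ^ 3) * norm (z - 0)"
  proof (rule field_differentiable_bound[of "ball 0 R"])
    fix x :: complex assume x: "x \<in> ball 0 R"
    show "(log_factor w has_field_derivative (1 / (x - w) + 1 / w + x / w ^ 2)) (at x within ball 0 R)"
      using log_factor_deriv[OF assms(1) x] by (rule has_field_derivative_at_within)
    note * = Lat_far_ball[OF assms(1) x]
    have "1 / (x - w) + 1 / w + x / w ^ 2 = x ^ 2 / (w ^ 2 * (x - w))"
      using *(2,3) by (simp add: divide_simps) (simp add: algebra_simps power2_eq_square)
    hence "norm (1 / (x - w) + 1 / w + x / w ^ 2) = norm x ^ 2 / (norm w ^ 2 * norm (x - w))"
      by (simp add: norm_divide norm_mult norm_power)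
    also have "\<dots> \<le> R ^ 2 / (norm w ^ 2 * (norm w / 2))"
      using * by (intro frac_le mult_left_mono power_mono) (auto intro!: mult_pos_pos)
    also have "\<dots> = 2 * R ^ 2 / norm w ^ 3" by (simp add: field_simps power2_eq_square power3_eq_cube)
    finally show "norm (1 / (x - w) + 1 / w + x / w ^ 2) \<le> 2 * R ^ 2 / norm w ^ 3" .
  qed (use assms Lat_far_ball[OF assms] in auto)
  also have "\<dots> \<le> (2 * R ^ 2 / norm w ^ 3) * R"
    using Lat_far_ball[OF assms] by (intro mult_left_mono) auto
  finally show ?thesis by (simp add: log_factor_def power2_eq_square power3_eq_cube)
qed

lemma log_tail_uniform_limit:
  "uniform_limit (ball 0 R) (\<lambda>F z. \<Sum>w\<in>F. log_factor w z) (log_tail R)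
     (finite_subsets_at_top (Lat_far R))"
proof -
  have *: "(\<lambda>w. 2 * R ^ 3 * (1 / norm w ^ 3)) summable_on Lat_far R"
    by (rule summable_on_subset_banach[OF summable_on_cmult_right[OF summable_on_Lat]])
       (auto simp: Lat_far_def)
  show ?thesis
    unfolding log_tail_def by (rule Weierstrass_m_test_general[OF log_factor_bound *])
qed

lemma log_factor_sum_holomorphic:
  "F \<subseteq> Lat_far R \<Longrightarrow> (\<lambda>z. \<Sum>w\<in>F. log_factor w z) holomorphic_on ball 0 R"
  by (intro holomorphic_on_sum) (auto simp: holomorphic_on_open intro!: log_factor_deriv)

lemma log_factor_sum_eventually_holomorphic:
  "\<forall>\<^sub>F F in finite_subsets_at_top (Lat_far R). (\<lambda>z. \<Sum>w\<in>F. log_factor w z) holomorphic_on ball 0 R"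
  by (rule eventually_mono[OF eventually_finite_subsets_at_top_weakI]) (auto intro: log_factor_sum_holomorphic)

lemma log_tail_holomorphic: "log_tail R holomorphic_on ball 0 R"
proof -
  have "\<exists>f'. (log_tail R has_field_derivative f') (at z)" if z: "z \<in> ball 0 R" for z
  proof -
    obtain r where r: "r > 0" "cball z r \<subseteq> ball 0 R"
      using z by (meson open_ball open_contains_cball)
    have "continuous_on (cball z r) (log_tail R) \<and> log_tail R holomorphic_on ball z r"
    proof (rule holomorphic_uniform_limit)
      show "uniform_limit (cball z r) (\<lambda>F z. \<Sum>w\<in>F. log_factor w z) (log_tail R)
          (finite_subsets_at_top (Lat_far R))"
        by (rule uniform_limit_on_subset[OF log_tail_uniform_limit r(2)])
      show "\<forall>\<^sub>F F in finite_subsets_at_top (Lat_far R).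
          continuous_on (cball z r) (\<lambda>z. \<Sum>w\<in>F. log_factor w z) \<and>
          (\<lambda>z. \<Sum>w\<in>F. log_factor w z) holomorphic_on ball z r"
        by (rule eventually_mono[OF log_factor_sum_eventually_holomorphic])
           (meson r(2) ball_subset_cball holomorphic_on_imp_continuous_on holomorphic_on_subset order_trans)
    qed auto
    thus ?thesis using r(1) by (auto simp: holomorphic_on_open)
  qed
  thus ?thesis by (auto simp: holomorphic_on_open)
qed

lemma deriv2_eqI:
  assumes "open A" "z \<in> A" "\<And>x. x \<in> A \<Longrightarrow> (f has_field_derivative f' x) (at x)"
    "(f' has_field_derivative D) (at z)"
  shows "(deriv ^^ 2) f z = (D :: complex)"
proof -
  have "deriv (deriv f) z = deriv f' z"
    by (rule deriv_cong_ev[OF eventually_mono[OF eventually_nhds_in_open[OF assms(1,2)]]])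
       (auto intro!: DERIV_imp_deriv assms)
  thus ?thesis using DERIV_imp_deriv[OF assms(4)] by (simp add: numeral_2_eq_2)
qed

lemma deriv3_eqI:
  assumes "open A" "z \<in> A" "\<And>x. x \<in> A \<Longrightarrow> (f has_field_derivative f' x) (at x)"
    "\<And>x. x \<in> A \<Longrightarrow> (f' has_field_derivative f'' x) (at x)"
    "(f'' has_field_derivative D) (at z)"
  shows "(deriv ^^ 3) f z = (D :: complex)"
proof -
  have "deriv ((deriv ^^ 2) f) z = deriv f'' z"
    by (rule deriv_cong_ev[OF eventually_mono[OF eventually_nhds_in_open[OF assms(1,2)]]])
       (auto intro!: deriv2_eqI[OF assms(1)] assms)
  thus ?thesis using DERIV_imp_deriv[OF assms(5)] by (simp add: numeral_3_eq_3 numeral_2_eq_2)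
qed

lemma log_factor_sum_deriv:
  assumes "F \<subseteq> Lat_far R" "z \<in> ball 0 R"
  shows "((\<lambda>z. \<Sum>w\<in>F. log_factor w z) has_field_derivative (\<Sum>w\<in>F. 1 / (z - w) + 1 / w + z / w ^ 2)) (at z)"
    and "((\<lambda>z. \<Sum>w\<in>F. 1 / (z - w) + 1 / w + z / w ^ 2) has_field_derivative
            (\<Sum>w\<in>F. - (1 / (z - w) ^ 2 - 1 / w ^ 2))) (at z)"
    and "((\<lambda>z. \<Sum>w\<in>F. - (1 / (z - w) ^ 2 - 1 / w ^ 2)) has_field_derivative
            (\<Sum>w\<in>F. 2 / (z - w) ^ 3)) (at z)"
proof -
  have *: "w \<noteq> 0" "z \<noteq> w" if "w \<in> F" for w using Lat_far_ball[of w R z] that assms by auto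
  show "((\<lambda>z. \<Sum>w\<in>F. log_factor w z) has_field_derivative (\<Sum>w\<in>F. 1 / (z - w) + 1 / w + z / w ^ 2)) (at z)"
    using assms by (intro DERIV_sum log_factor_deriv[of _ R]) auto
  show "((\<lambda>z. \<Sum>w\<in>F. 1 / (z - w) + 1 / w + z / w ^ 2) has_field_derivative
            (\<Sum>w\<in>F. - (1 / (z - w) ^ 2 - 1 / w ^ 2))) (at z)"
    using * DERIV_zeta_term[of z] by (intro DERIV_sum) simp
  show "((\<lambda>z. \<Sum>w\<in>F. - (1 / (z - w) ^ 2 - 1 / w ^ 2)) has_field_derivative
            (\<Sum>w\<in>F. 2 / (z - w) ^ 3)) (at z)"
    using * DERIV_minus[OF DERIV_p_term[of z]] by (intro DERIV_sum) simp
qed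

text \<open>Uniform limits of holomorphic functions may be differentiated termwise, so the three
  tails are the derivatives of \<open>log_tail\<close>; their convergence is obtained at the same
  time.\<close>

lemma log_tail_has_sum:
  assumes "z \<in> ball 0 R"
  shows "((\<lambda>w. 1 / (z - w) + 1 / w + z / w ^ 2) has_sum deriv (log_tail R) z) (Lat_far R)"
    and "((\<lambda>w. 1 / (z - w) ^ 2 - 1 / w ^ 2) has_sum - (deriv ^^ 2) (log_tail R) z) (Lat_far R)"
    and "((\<lambda>w. 2 / (z - w) ^ 3) has_sum (deriv ^^ 3) (log_tail R) z) (Lat_far R)"
proof -
  define h where "h = (\<lambda>F z. \<Sum>w\<in>F. log_factor w z)"
  have lim: "((\<lambda>F. (deriv ^^ m) (h F) z) \<longlongrightarrow> (deriv ^^ m) (log_tail R) z) (finite_subsets_at_top (Lat_far R))" for m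
    unfolding h_def
    by (rule higher_deriv_complex_uniform_limit[OF log_tail_uniform_limit log_factor_sum_eventually_holomorphic])
       (use assms in auto)
  have ev: "\<forall>\<^sub>F F in finite_subsets_at_top (Lat_far R). F \<subseteq> Lat_far R"
    by (rule eventually_finite_subsets_at_top_weakI)
  show "((\<lambda>w. 1 / (z - w) + 1 / w + z / w ^ 2) has_sum deriv (log_tail R) z) (Lat_far R)"
    unfolding has_sum_def
    by (rule Lim_transform_eventually[OF lim[of 1, simplified] eventually_mono[OF ev]])
       (auto simp: h_def intro!: DERIV_imp_deriv log_factor_sum_deriv assms)
  have "((\<lambda>w. - (1 / (z - w) ^ 2 - 1 / w ^ 2)) has_sum (deriv ^^ 2) (log_tail R) z) (Lat_far R)"
    unfolding has_sum_def
    by (rule Lim_transform_eventually[OF lim[of 2] eventually_mono[OF ev]])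
       (use assms in \<open>auto simp only: h_def intro!: deriv2_eqI[of "ball 0 R"] log_factor_sum_deriv open_ball\<close>)
  thus "((\<lambda>w. 1 / (z - w) ^ 2 - 1 / w ^ 2) has_sum - (deriv ^^ 2) (log_tail R) z) (Lat_far R)"
    by (subst (asm) has_sum_uminus)
  show "((\<lambda>w. 2 / (z - w) ^ 3) has_sum (deriv ^^ 3) (log_tail R) z) (Lat_far R)"
    unfolding has_sum_def
    by (rule Lim_transform_eventually[OF lim[of 3] eventually_mono[OF ev]])
       (use assms in \<open>auto simp only: h_def intro!: deriv3_eqI[of "ball 0 R"] log_factor_sum_deriv open_ball\<close>)
qed

lemma infsum_near_far:
  assumes "(f has_sum (S::complex)) (Lat_far R)"
  shows "(f has_sum (sum f (Lat_near R) + S)) (Lat - {0})"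
  unfolding Lat_near_far(1)[of R]
  by (rule has_sum_Un_disjoint[OF has_sum_finite[OF finite_Lat_near] assms Lat_near_far(2)])

text \<open>The derivative of \<open>wp\<close>, written over the whole lattice with 0 included. No
  correction terms are present, so its periodicity is a mere reindexing, which is not the case for
  \<open>wp\<close>.\<close>

definition wp' :: "complex \<Rightarrow> complex" where
  "wp' z = - 2 * (\<Sum>\<^sub>\<infinity>w\<in>Lat. 1 / (z - w) ^ 3)"

section \<open>Local formulas, derivatives and zeros\<close>

lemma wz_local:
  assumes "z \<in> ball 0 R"
  shows "wz z = 1 / z + (\<Sum>w\<in>Lat_near R. 1 / (z - w) + 1 / w + z / w ^ 2) + deriv (log_tail R) z"
  unfolding weierstrass_zeta_def
  using infsumI[OF infsum_near_far[OF log_tail_has_sum(1)[OF assms]]] by simp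

lemma wp_local:
  assumes "z \<in> ball 0 R"
  shows "wp z = 1 / z ^ 2 + (\<Sum>w\<in>Lat_near R. 1 / (z - w) ^ 2 - 1 / w ^ 2) - (deriv ^^ 2) (log_tail R) z"
  unfolding weierstrass_p_def
  using infsumI[OF infsum_near_far[OF log_tail_has_sum(2)[OF assms]]] by simp

lemma wp'_local:
  assumes "z \<in> ball 0 R"
  shows "wp' z = - (2 / z ^ 3) - (\<Sum>w\<in>Lat_near R. 2 / (z - w) ^ 3) - (deriv ^^ 3) (log_tail R) z"
proof -
  have "((\<lambda>w. 2 / (z - w) ^ 3) has_sum ((\<Sum>w\<in>Lat_near R. 2 / (z - w) ^ 3) + (deriv ^^ 3) (log_tail R) z)) (Lat - {0})"
    by (rule infsum_near_far[OF log_tail_has_sum(3)[OF assms]])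
  from has_sum_Un_disjoint[OF has_sum_finite[of "{0}"] this]
  have "((\<lambda>w. 2 / (z - w) ^ 3) has_sum (2 / z ^ 3 + ((\<Sum>w\<in>Lat_near R. 2 / (z - w) ^ 3) + (deriv ^^ 3) (log_tail R) z))) Lat"
    by (simp add: insert_absorb)
  from has_sum_cmult_right[OF this, of "1/2"]
  show ?thesis unfolding wp'_def by (subst infsumI) (auto simp: algebra_simps)
qed

lemma ws_local:
  assumes "z \<in> ball 0 R"
  shows "ws z = z * (\<Prod>w\<in>Lat_near R. weierstrass_factor 2 (z / w)) * exp (log_tail R z)"
proof -
  define f where "f = (\<lambda>w. weierstrass_factor 2 (z / w))"
  have lim: "((\<lambda>F. \<Sum>w\<in>F. log_factor w z) \<longlongrightarrow> log_tail R z) (finite_subsets_at_top (Lat_far R))"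
    using tendsto_uniform_limitI[OF log_tail_uniform_limit assms] .
  \<comment> \<open>The limit runs over finite subsets of the full lattice. Removing the near points
    carries this net to the one along which the logarithms converge.\<close>
  have fl: "filterlim (\<lambda>F. F - Lat_near R) (finite_subsets_at_top (Lat_far R)) (finite_subsets_at_top (Lat - {0}))"
    unfolding filterlim_finite_subsets_at_top
  proof (intro allI impI)
    fix X assume X: "finite X \<and> X \<subseteq> Lat_far R"
    show "\<forall>\<^sub>F F in finite_subsets_at_top (Lat - {0}).
        finite (F - Lat_near R) \<and> X \<subseteq> F - Lat_near R \<and> F - Lat_near R \<subseteq> Lat_far R"
      unfolding eventually_finite_subsets_at_top
      using X Lat_near_far[of R] by (intro exI[of _ X]) auto
  qed
  have "((\<lambda>F. prod f (Lat_near R) * exp (\<Sum>w\<in>F - Lat_near R. log_factor w z)) \<longlongrightarrow>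
          prod f (Lat_near R) * exp (log_tail R z)) (finite_subsets_at_top (Lat - {0}))"
    by (intro tendsto_intros filterlim_compose[OF lim fl])
  moreover have "\<forall>\<^sub>F F in finite_subsets_at_top (Lat - {0}).
      prod f (Lat_near R) * exp (\<Sum>w\<in>F - Lat_near R. log_factor w z) = prod f F"
    unfolding eventually_finite_subsets_at_top
  proof (intro exI[of _ "Lat_near R"] conjI allI impI)
    fix F assume F: "finite F \<and> Lat_near R \<subseteq> F \<and> F \<subseteq> Lat - {0}"
    have "prod f F = prod f (Lat_near R) * prod f (F - Lat_near R)"
      using F by (metis prod.subset_diff mult.commute)
    also have "prod f (F - Lat_near R) = exp (\<Sum>w\<in>F - Lat_near R. log_factor w z)"
    proof (subst exp_sum, goal_cases)
      case 2
      show ?case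
      proof (rule prod.cong[OF refl])
        fix w assume "w \<in> F - Lat_near R"
        hence "w \<in> Lat_far R" using F Lat_near_far(1)[of R] by auto
        note * = Lat_far_ball[OF this assms]
        have "1 - z / w \<noteq> 0" using * by auto
        thus "f w = exp (log_factor w z)"
          by (simp add: f_def log_factor_def weierstrass_factor_def exp_add exp_Ln numeral_2_eq_2)
      qed
    qed (use F in auto)
    finally show "prod f (Lat_near R) * exp (\<Sum>w\<in>F - Lat_near R. log_factor w z) = prod f F" by simp
  qed (use finite_Lat_near in \<open>auto simp: Lat_near_def\<close>)
  ultimately have "(prod f \<longlongrightarrow> prod f (Lat_near R) * exp (log_tail R z)) (finite_subsets_at_top (Lat - {0}))"
    by (rule Lim_transform_eventually)
  hence "Lim (finite_subsets_at_top (Lat - {0})) (prod f) = prod f (Lat_near R) * exp (log_tail R z)"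
    by (intro tendsto_Lim) auto
  thus ?thesis by (simp add: weierstrass_sigma_def f_def)
qed

lemma log_tail_deriv:
  assumes "z \<in> ball 0 R"
  shows "((deriv ^^ m) (log_tail R) has_field_derivative (deriv ^^ (Suc m)) (log_tail R) z) (at z)"
  using holomorphic_higher_deriv[OF log_tail_holomorphic, of R m] assms
  by (auto intro!: holomorphic_derivI[of _ "ball 0 R"])

lemma wz_deriv:
  assumes "z \<notin> Lat"
  shows "(wz has_field_derivative - wp z) (at z)"
proof -
  define R where "R = norm z + 1"
  have z: "z \<in> ball 0 R" by (simp add: R_def)
  have nz: "z \<noteq> 0" "\<And>w. w \<in> Lat_near R \<Longrightarrow> z \<noteq> w" "\<And>w. w \<in> Lat_near R \<Longrightarrow> w \<noteq> 0"
    using assms by (auto simp: Lat_near_def)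
  have "((\<lambda>z. 1 / z + (\<Sum>w\<in>Lat_near R. 1 / (z - w) + 1 / w + z / w ^ 2) + deriv (log_tail R) z)
      has_field_derivative (- (1 / z ^ 2) + (\<Sum>w\<in>Lat_near R. - (1 / (z - w) ^ 2) + 1 / w ^ 2)
         + (deriv ^^ 2) (log_tail R) z)) (at z)"
    using log_tail_deriv[OF z, of 1] DERIV_inverse_shift(1)[OF nz(1)]
    by (intro DERIV_add DERIV_sum DERIV_zeta_term nz(2)) (simp_all add: numeral_2_eq_2)
  also have "- (1 / z ^ 2) + (\<Sum>w\<in>Lat_near R. - (1 / (z - w) ^ 2) + 1 / w ^ 2)
         + (deriv ^^ 2) (log_tail R) z = - wp z"
    by (simp add: wp_local[OF z] sum_subtractf sum.distrib sum_negf)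
  finally show ?thesis
    by (rule has_field_derivative_transform_within_open[of _ _ _ "ball 0 R"])
       (use z in \<open>auto intro!: wz_local[symmetric]\<close>)
qed

lemma wp_deriv:
  assumes "z \<notin> Lat"
  shows "(wp has_field_derivative wp' z) (at z)"
proof -
  define R where "R = norm z + 1"
  have z: "z \<in> ball 0 R" by (simp add: R_def)
  have nz: "z \<noteq> 0" "\<And>w. w \<in> Lat_near R \<Longrightarrow> z \<noteq> w" "\<And>w. w \<in> Lat_near R \<Longrightarrow> w \<noteq> 0"
    using assms by (auto simp: Lat_near_def)
  have "((\<lambda>z. 1 / z ^ 2 + (\<Sum>w\<in>Lat_near R. 1 / (z - w) ^ 2 - 1 / w ^ 2) - (deriv ^^ 2) (log_tail R) z)
      has_field_derivative (- (2 / z ^ 3) + (\<Sum>w\<in>Lat_near R. - (2 / (z - w) ^ 3))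
         - (deriv ^^ 3) (log_tail R) z)) (at z)"
    using log_tail_deriv[OF z, of 2] DERIV_inverse_shift(2)[OF nz(1)]
    by (intro DERIV_add DERIV_diff DERIV_sum DERIV_p_term nz(2)) (simp_all add: numeral_2_eq_2 numeral_3_eq_3)
  also have "- (2 / z ^ 3) + (\<Sum>w\<in>Lat_near R. - (2 / (z - w) ^ 3)) - (deriv ^^ 3) (log_tail R) z = wp' z"
    by (simp add: wp'_local[OF z] sum_negf)
  finally show ?thesis
    by (rule has_field_derivative_transform_within_open[of _ _ _ "ball 0 R"])
       (use z in \<open>auto intro!: wp_local[symmetric]\<close>)
qed

lemma ws_holomorphic: "ws holomorphic_on A"
proof -
  have "ws field_differentiable (at z)" for z
  proof -
    define R where "R = norm z + 1"
    have z: "z \<in> ball 0 R" by (simp add: R_def)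
    have "(\<lambda>z. z * (\<Prod>w\<in>Lat_near R. weierstrass_factor 2 (z / w)) * exp (log_tail R z)) holomorphic_on ball 0 R"
      by (intro holomorphic_intros log_tail_holomorphic) (auto simp: Lat_near_def)
    hence "ws holomorphic_on ball 0 R"
      by (rule holomorphic_transform) (auto intro!: ws_local[symmetric])
    thus ?thesis using z holomorphic_on_imp_differentiable_at by blast
  qed
  thus ?thesis by (simp add: field_differentiable_at_within holomorphic_on_def)
qed

lemma ws_eq_0_iff: "ws z = 0 \<longleftrightarrow> z \<in> Lat"
proof -
  define R where "R = norm z + 1"
  have z: "z \<in> ball 0 R" by (simp add: R_def)
  have "ws z = 0 \<longleftrightarrow> z = 0 \<or> (\<exists>w\<in>Lat_near R. z / w = 1)"
    unfolding ws_local[OF z] using finite_Lat_near by (auto simp: prod_zero_iff)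
  also have "\<dots> \<longleftrightarrow> z = 0 \<or> z \<in> Lat_near R"
    by (auto simp: Lat_near_def)
  also have "\<dots> \<longleftrightarrow> z \<in> Lat"
    by (auto simp: Lat_near_def R_def)
  finally show ?thesis .
qed

lemma weierstrass_factor_2_deriv:
  assumes "w \<noteq> 0" "z \<noteq> w"
  shows "((\<lambda>z. weierstrass_factor 2 (z / w)) has_field_derivative
           weierstrass_factor 2 (z / w) * (1 / (z - w) + 1 / w + z / w ^ 2)) (at z)"
proof -
  have f: "weierstrass_factor 2 = (\<lambda>u. (1 - u) * exp (u + u ^ 2 / 2))"
    by (simp add: weierstrass_factor_def fun_eq_iff numeral_2_eq_2)
  have "(weierstrass_factor 2 has_field_derivative
      - 1 * exp (u + u ^ 2 / 2) + (1 - u) * (exp (u + u ^ 2 / 2) * (1 + u))) (at u)" for u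
    unfolding f by (auto intro!: derivative_eq_intros simp: algebra_simps)
  from DERIV_chain2[OF this[of "z / w"] DERIV_cdivide[OF DERIV_ident]]
  have "((\<lambda>z. weierstrass_factor 2 (z / w)) has_field_derivative
      (- 1 * exp (z / w + (z / w) ^ 2 / 2) + (1 - z / w) * (exp (z / w + (z / w) ^ 2 / 2) * (1 + z / w)))
        * (1 / w)) (at z)" .
  also have "(- 1 * e + (1 - z / w) * (e * (1 + z / w))) * (1 / w)
      = (1 - z / w) * e * (1 / (z - w) + 1 / w + z / w ^ 2)" for e
    using assms by (simp add: divide_simps power2_eq_square) (simp add: algebra_simps)
  finally show ?thesis by (simp add: f)
qed

text \<open>Logarithmic differentiation of \<open>ws_local\<close>: the factor z, the near factors
  and the exponential contribute precisely the three groups of terms in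
  \<open>wz_local\<close>.\<close>

lemma ws_deriv:
  assumes "z \<notin> Lat"
  shows "(ws has_field_derivative ws z * wz z) (at z)"
proof -
  define R where "R = norm z + 1"
  have z: "z \<in> ball 0 R" by (simp add: R_def)
  have nz: "z \<noteq> 0" "\<And>w. w \<in> Lat_near R \<Longrightarrow> z \<noteq> w" "\<And>w. w \<in> Lat_near R \<Longrightarrow> w \<noteq> 0"
    using assms by (auto simp: Lat_near_def)
  define P where "P = (\<lambda>z. \<Prod>w\<in>Lat_near R. weierstrass_factor 2 (z / w))"
  define S where "S = (\<Sum>w\<in>Lat_near R. 1 / (z - w) + 1 / w + z / w ^ 2)"
  have aux: "z \<noteq> 0 \<Longrightarrow> (p + z * (p * s)) * e + z * p * (e * t) = z * p * e * (1 / z + s + t)"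
    for z p s e t :: complex by (simp add: field_simps)
  have nz': "weierstrass_factor 2 (z / w) \<noteq> 0" if "w \<in> Lat_near R" for w
    using nz that by (auto simp: field_simps)
  have "(P has_field_derivative P z * (\<Sum>w\<in>Lat_near R. weierstrass_factor 2 (z / w) * (1 / (z - w) + 1 / w + z / w ^ 2)
      / weierstrass_factor 2 (z / w))) (at z)"
    unfolding P_def by (rule has_field_derivative_prod') (use nz nz' in \<open>auto intro!: weierstrass_factor_2_deriv\<close>)
  also have "(\<Sum>w\<in>Lat_near R. weierstrass_factor 2 (z / w) * (1 / (z - w) + 1 / w + z / w ^ 2)
      / weierstrass_factor 2 (z / w)) = S"
    unfolding S_def by (intro sum.cong refl) (use nz' in auto)
  finally have P: "(P has_field_derivative P z * S) (at z)" .
  have "((\<lambda>z. z * P z * exp (log_tail R z)) has_field_derivative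
       (P z + z * (P z * S)) * exp (log_tail R z) + z * P z * (exp (log_tail R z) * deriv (log_tail R) z)) (at z)"
    using log_tail_deriv[OF z, of 0] P by (auto intro!: derivative_eq_intros)
  also have "(P z + z * (P z * S)) * exp (log_tail R z) + z * P z * (exp (log_tail R z) * deriv (log_tail R) z)
     = ws z * wz z"
    unfolding ws_local[OF z] wz_local[OF z] S_def[symmetric] P_def
    by (rule aux[OF nz(1)])
  finally show ?thesis
    by (rule has_field_derivative_transform_within_open[of _ _ _ "ball 0 R"])
       (use z in \<open>auto intro!: ws_local[symmetric] simp: P_def\<close>)
qed

section \<open>Parity, and periodicity of the derivative\<close>

lemma bij_betw_uminus_Lat: "bij_betw uminus (Lat - {0}) (Lat - {0})"
  by (rule bij_betwI[of _ _ _ uminus]) auto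

lemma wp_minus [simp]: "wp (- z) = wp z"
proof -
  have "(\<Sum>\<^sub>\<infinity>w\<in>Lat - {0}. 1 / (- z - w)\<^sup>2 - 1 / w\<^sup>2) = (\<Sum>\<^sub>\<infinity>w\<in>Lat - {0}. 1 / (- z - - w)\<^sup>2 - 1 / (- w)\<^sup>2)"
    by (rule infsum_reindex_bij_betw[OF bij_betw_uminus_Lat, symmetric])
  also have "\<dots> = (\<Sum>\<^sub>\<infinity>w\<in>Lat - {0}. 1 / (z - w)\<^sup>2 - 1 / w\<^sup>2)"
    by (intro infsum_cong) (simp add: power2_commute)
  finally show ?thesis by (simp add: weierstrass_p_def)
qed

lemma wz_minus [simp]: "wz (- z) = - wz z"
proof -
  have "(\<Sum>\<^sub>\<infinity>w\<in>Lat - {0}. 1 / (- z - w) + 1 / w + (- z) / w\<^sup>2)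
      = (\<Sum>\<^sub>\<infinity>w\<in>Lat - {0}. 1 / (- z - - w) + 1 / (- w) + (- z) / (- w)\<^sup>2)"
    by (rule infsum_reindex_bij_betw[OF bij_betw_uminus_Lat, symmetric])
  also have "\<dots> = (\<Sum>\<^sub>\<infinity>w\<in>Lat - {0}. - (1 / (z - w) + 1 / w + z / w\<^sup>2))"
  proof (intro infsum_cong)
    fix w
    have "- z - - w = - (z - w)" by simp
    hence "1 / (- z - - w) = - (1 / (z - w))" by (simp only: minus_divide_right)
    thus "1 / (- z - - w) + 1 / (- w) + (- z) / (- w)\<^sup>2 = - (1 / (z - w) + 1 / w + z / w\<^sup>2)" by simp
  qed
  also have "\<dots> = - (\<Sum>\<^sub>\<infinity>w\<in>Lat - {0}. 1 / (z - w) + 1 / w + z / w\<^sup>2)"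
    by (rule infsum_uminus)
  finally show ?thesis unfolding weierstrass_zeta_def by simp
qed

lemma ws_minus [simp]: "ws (- z) = - ws z"
proof -
  define R where "R = norm z + 1"
  have z: "z \<in> ball 0 R" "- z \<in> ball 0 R" by (auto simp: R_def)
  have "bij_betw uminus (Lat_near R) (Lat_near R)" "bij_betw uminus (Lat_far R) (Lat_far R)"
    by (rule bij_betwI[of _ _ _ uminus]; auto simp: Lat_near_def Lat_far_def)+
  note b = this
  have "(\<Prod>w\<in>Lat_near R. weierstrass_factor 2 (- z / w)) = (\<Prod>w\<in>Lat_near R. weierstrass_factor 2 (- z / - w))"
    by (rule prod.reindex_bij_betw[OF b(1), symmetric])
  moreover have "log_tail R (- z) = (\<Sum>\<^sub>\<infinity>w\<in>Lat_far R. log_factor (- w) (- z))"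
    unfolding log_tail_def by (rule infsum_reindex_bij_betw[OF b(2), symmetric])
  ultimately show ?thesis
    unfolding ws_local[OF z(1)] ws_local[OF z(2)] by (simp add: log_tail_def log_factor_def)
qed

lemma wp'_periodic:
  assumes "p \<in> Lat" shows "wp' (z + p) = wp' z"
proof -
  have "bij_betw (\<lambda>w. w + p) Lat Lat"
    by (rule bij_betwI[of _ _ _ "\<lambda>w. w - p"]) (use assms in \<open>auto simp: Lat_add Lat_diff\<close>)
  from infsum_reindex_bij_betw[OF this, of "\<lambda>w. 1 / (z + p - w) ^ 3"]
  show ?thesis by (simp add: wp'_def)
qed

end


section \<open>Orders at isolated singularities\<close>


text \<open>\<open>F z\<close> may be 0, so \<open>N\<close> is only a lower bound for the order;
  \<open>F\<close> is kept explicit because \<open>F z\<close> is the leading coefficient. Only a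
  punctured neighbourhood matters, since values at poles are mere conventions.\<close>

definition local_form :: "(complex \<Rightarrow> complex) \<Rightarrow> complex \<Rightarrow> int \<Rightarrow> (complex \<Rightarrow> complex) \<Rightarrow> bool" where
  "local_form f z N F \<longleftrightarrow>
     F analytic_on {z} \<and> (\<forall>\<^sub>F s in at z. f s = (s - z) powi N * F s)"

definition ord_ge :: "(complex \<Rightarrow> complex) \<Rightarrow> complex \<Rightarrow> int \<Rightarrow> bool" where
  "ord_ge f z N \<longleftrightarrow> (\<exists>F. local_form f z N F)"

section \<open>Punctured neighbourhoods and the calculus of orders\<close>

lemma eventually_at_neq: "\<forall>\<^sub>F s in at z. s \<noteq> (z :: complex)"
  by (simp add: eventually_at_filter)

text \<open>Needed to differentiate an identity that holds near z only: at each nearby point other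
  than z it holds on a full neighbourhood, so derivatives agree there.\<close>

lemma eventually_at_imp_nhds:
  assumes "\<forall>\<^sub>F s in at z. P s"
  shows "\<forall>\<^sub>F s in at z. \<forall>\<^sub>F u in nhds s. P (u :: complex)"
proof -
  obtain S where S: "open S" "z \<in> S" "\<And>x. x \<in> S \<Longrightarrow> x \<noteq> z \<Longrightarrow> P x"
    using assms unfolding eventually_at_topological by blast
  show ?thesis
    unfolding eventually_at_topological
  proof (intro exI[of _ S] conjI ballI impI)
    fix x assume x: "x \<in> S" "x \<noteq> z"
    show "\<forall>\<^sub>F u in nhds x. P u"
      by (rule eventually_mono[OF eventually_nhds_in_open[of "S - {z}"]]) (use S x in auto)
  qed (use S in auto)
qed

lemma eventually_at_shift:
  "(\<forall>\<^sub>F s in at (z + p). P s) \<longleftrightarrow> (\<forall>\<^sub>F s in at z. P (s + p :: complex))"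
proof -
  have "filtermap (\<lambda>s. s - (- p)) (at z) = at (z - - p)" by (rule filtermap_at_shift)
  hence f: "at (z + p) = filtermap (\<lambda>s. s + p) (at z)" by simp
  show ?thesis unfolding f eventually_filtermap ..
qed

lemma eventually_at_minus:
  "(\<forall>\<^sub>F s in at (- z). P s) \<longleftrightarrow> (\<forall>\<^sub>F s in at z. P (- s :: complex))"
  unfolding filtermap_at_minus[symmetric] eventually_filtermap ..

lemma analytic_at_shift: "f analytic_on {z + p} \<Longrightarrow> (\<lambda>s. f (s + p)) analytic_on {z}"
  using analytic_on_compose[of "\<lambda>s. s + p" "{z}" f] by (simp add: o_def analytic_on_add)

lemma analytic_at_reflect: "f analytic_on {- z} \<Longrightarrow> (\<lambda>s. f (- s)) analytic_on {z}"
  using analytic_on_compose[of "\<lambda>s. - s" "{z}" f] by (simp add: o_def analytic_on_neg)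

lemma local_formD:
  assumes "local_form f z N F"
  shows "F analytic_on {z}" "\<forall>\<^sub>F s in at z. f s = (s - z) powi N * F s"
  using assms by (auto simp: local_form_def)

lemma local_form_cong:
  assumes "local_form f z N F" "\<forall>\<^sub>F s in at z. g s = f s"
  shows "local_form g z N F"
proof -
  have "\<forall>\<^sub>F s in at z. g s = (s - z) powi N * F s"
    using local_formD(2)[OF assms(1)] assms(2) by eventually_elim simp
  thus ?thesis using local_formD(1)[OF assms(1)] by (simp add: local_form_def)
qed

lemma ord_ge_cong: "ord_ge f z N \<Longrightarrow> \<forall>\<^sub>F s in at z. g s = f s \<Longrightarrow> ord_ge g z N"
  unfolding ord_ge_def using local_form_cong by blast

lemma local_form_analytic: "f analytic_on {z} \<Longrightarrow> local_form f z 0 f"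
  by (simp add: local_form_def)

lemma ord_ge_analytic: "f analytic_on {z} \<Longrightarrow> ord_ge f z 0"
  unfolding ord_ge_def using local_form_analytic by blast

lemma ord_ge_0_iff: "ord_ge f z 0 \<longleftrightarrow> (\<exists>F. F analytic_on {z} \<and> (\<forall>\<^sub>F s in at z. f s = F s))"
  by (simp add: ord_ge_def local_form_def)

lemma ord_ge_mono:
  assumes "ord_ge f z N" "M \<le> N" shows "ord_ge f z M"
proof -
  obtain F where F: "F analytic_on {z}" "\<forall>\<^sub>F s in at z. f s = (s - z) powi N * F s"
    using assms(1) by (auto simp: ord_ge_def local_form_def)
  have "\<forall>\<^sub>F s in at z. f s = (s - z) powi M * ((s - z) ^ nat (N - M) * F s)"
    using F(2) eventually_at_neq
  proof eventually_elim
    case (elim s)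
    have "(s - z) powi N = (s - z) powi M * (s - z) powi (N - M)"
      using elim by (subst power_int_add[symmetric]) auto
    thus ?case using elim assms(2) by (simp add: power_int_def)
  qed
  moreover have "(\<lambda>s. (s - z) ^ nat (N - M) * F s) analytic_on {z}"
    by (intro analytic_intros F)
  ultimately show ?thesis unfolding ord_ge_def local_form_def by blast
qed

lemma local_form_add:
  assumes "local_form f z N F" "local_form g z N G"
  shows "local_form (\<lambda>s. f s + g s) z N (\<lambda>s. F s + G s)"
proof -
  have "\<forall>\<^sub>F s in at z. f s + g s = (s - z) powi N * (F s + G s)"
    using local_formD(2)[OF assms(1)] local_formD(2)[OF assms(2)]
    by eventually_elim (simp add: distrib_left)
  thus ?thesis unfolding local_form_def using local_formD[OF assms(1)] local_formD[OF assms(2)]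
    by (auto intro!: analytic_intros)
qed

lemma local_form_mult:
  assumes "local_form f z N F" "local_form g z M G"
  shows "local_form (\<lambda>s. f s * g s) z (N + M) (\<lambda>s. F s * G s)"
proof -
  have "\<forall>\<^sub>F s in at z. f s * g s = (s - z) powi (N + M) * (F s * G s)"
    using local_formD(2)[OF assms(1)] local_formD(2)[OF assms(2)] eventually_at_neq
    by eventually_elim (simp add: power_int_add)
  thus ?thesis unfolding local_form_def using local_formD[OF assms(1)] local_formD[OF assms(2)]
    by (auto intro!: analytic_intros)
qed

text \<open>The new leading coefficient is \<open>of_int N * F z\<close>. Iterating this turns the
  computation of indicial polynomials into arithmetic at the point z.\<close>

lemma local_form_deriv:
  assumes "local_form f z N F"
  shows "local_form (deriv f) z (N - 1) (\<lambda>s. of_int N * F s + (s - z) * deriv F s)"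
proof -
  note F = local_formD[OF assms]
  obtain S where S: "open S" "z \<in> S" "F holomorphic_on S"
    using F(1) by (auto simp: analytic_at)
  have "\<forall>\<^sub>F s in at z. s \<in> S" using S by (simp add: eventually_at_in_open')
  hence "\<forall>\<^sub>F s in at z. deriv f s = (s - z) powi (N - 1) * (of_int N * F s + (s - z) * deriv F s)"
    using eventually_at_imp_nhds[OF F(2)] eventually_at_neq
  proof eventually_elim
    case (elim s)
    have "deriv f s = deriv (\<lambda>s. (s - z) powi N * F s) s"
      by (rule deriv_cong_ev[OF elim(2) refl])
    also have "((\<lambda>s. (s - z) powi N * F s) has_field_derivative
       of_int N * (s - z) powi (N - 1) * F s + (s - z) powi N * deriv F s) (at s)"
      using elim S(1) by (auto intro!: derivative_eq_intros holomorphic_derivI[OF S(3)])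
    hence "deriv (\<lambda>s. (s - z) powi N * F s) s =
       of_int N * (s - z) powi (N - 1) * F s + (s - z) powi N * deriv F s"
      by (rule DERIV_imp_deriv)
    also have "(s - z) powi N = (s - z) powi (N - 1) * (s - z)"
      using elim power_int_add[of "s - z" "N - 1" 1] by simp
    finally show ?case by (simp add: algebra_simps)
  qed
  thus ?thesis unfolding local_form_def using F by (auto intro!: analytic_intros)
qed

lemma ord_ge_add: "ord_ge f z N \<Longrightarrow> ord_ge g z N \<Longrightarrow> ord_ge (\<lambda>s. f s + g s) z N"
  unfolding ord_ge_def using local_form_add by blast

lemma ord_ge_mult: "ord_ge f z N \<Longrightarrow> ord_ge g z M \<Longrightarrow> ord_ge (\<lambda>s. f s * g s) z (N + M)"
  unfolding ord_ge_def using local_form_mult by blast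

lemma ord_ge_deriv: "ord_ge f z N \<Longrightarrow> ord_ge (deriv f) z (N - 1)"
  unfolding ord_ge_def using local_form_deriv by blast

lemma ord_ge_const: "N \<le> 0 \<Longrightarrow> ord_ge (\<lambda>_. c) z N"
  using ord_ge_mono[OF ord_ge_analytic[of "\<lambda>_. c" z]] by auto

lemma ord_ge_0: "ord_ge (\<lambda>_. 0) z N"
  unfolding ord_ge_def local_form_def by (intro exI[of _ "\<lambda>_. 0"]) auto

lemma ord_ge_cmult: "ord_ge f z N \<Longrightarrow> ord_ge (\<lambda>s. c * f s) z N"
  using ord_ge_mult[OF ord_ge_const[of 0 c z]] by simp

lemma ord_ge_uminus: "ord_ge f z N \<Longrightarrow> ord_ge (\<lambda>s. - f s) z N"
  using ord_ge_cmult[of f z N "-1"] by simp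

lemma ord_ge_diff: "ord_ge f z N \<Longrightarrow> ord_ge g z N \<Longrightarrow> ord_ge (\<lambda>s. f s - g s) z N"
  using ord_ge_add[OF _ ord_ge_uminus] by fastforce

lemma ord_ge_sum: "(\<And>i. i \<in> I \<Longrightarrow> ord_ge (f i) z N) \<Longrightarrow> ord_ge (\<lambda>s. \<Sum>i\<in>I. f i s) z N"
  by (induction I rule: infinite_finite_induct) (auto intro: ord_ge_add ord_ge_0)

lemma analytic_zero_factor:
  assumes "F analytic_on {z}" "F z = 0"
  obtains G where "G analytic_on {z}" "G z = deriv F z" "\<And>s. F s = (s - z) * G s"
proof -
  obtain S where S: "open S" "z \<in> S" "F holomorphic_on S"
    using assms(1) by (auto simp: analytic_at)
  define G where "G = (\<lambda>s. if s = z then deriv F z else (F s - F z) / (s - z))"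
  have "G holomorphic_on S" unfolding G_def by (rule pole_lemma_open[OF S(3,1)])
  hence "G analytic_on {z}" using S by (auto simp: analytic_at)
  thus ?thesis by (rule that) (auto simp: G_def assms)
qed

lemma local_form_improve:
  assumes "local_form f z N F" "F z = 0" shows "ord_ge f z (N + 1)"
proof -
  note F = local_formD[OF assms(1)]
  obtain G where G: "G analytic_on {z}" "\<And>s. F s = (s - z) * G s"
    using analytic_zero_factor[OF F(1) assms(2)] by blast
  have "\<forall>\<^sub>F s in at z. f s = (s - z) powi (N + 1) * G s"
    using F(2) eventually_at_neq
  proof eventually_elim
    case (elim s)
    thus ?case by (simp add: G(2) power_int_add)
  qed
  thus ?thesis unfolding ord_ge_def local_form_def using G by blast
qed

lemma analytic_at_tendsto: "F analytic_on {z} \<Longrightarrow> (F \<longlongrightarrow> F z) (at z)"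
  using analytic_at_imp_isCont isContD by blast

lemma analytic_eq_at:
  assumes "F analytic_on {z}" "G analytic_on {z}" "\<forall>\<^sub>F s in at z. F s = G s"
  shows "F z = G z"
  using tendsto_unique[OF _ Lim_transform_eventually[OF analytic_at_tendsto[OF assms(1)] assms(3)]
      analytic_at_tendsto[OF assms(2)]] by simp

text \<open>Comparing with a representation of higher order and cancelling the power leaves
  \<open>F s = (s - z) * G s\<close>. Combined with \<open>local_form_improve\<close>, it raises a
  known order one step at a time.\<close>

lemma local_form_order_unique:
  assumes "local_form f z N F" "ord_ge f z M" "N < M" shows "F z = 0"
proof -
  from ord_ge_mono[OF assms(2), of "N + 1"] assms(3) obtain G where
    G: "G analytic_on {z}" "\<forall>\<^sub>F s in at z. f s = (s - z) powi (N + 1) * G s"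
    by (auto simp: ord_ge_def local_form_def)
  note F = local_formD[OF assms(1)]
  have "\<forall>\<^sub>F s in at z. F s = (s - z) * G s"
    using F(2) G(2) eventually_at_neq
  proof eventually_elim
    case (elim s)
    thus ?case by (simp add: power_int_add)
  qed
  moreover have "(\<lambda>s. (s - z) * G s) analytic_on {z}" by (intro analytic_intros G)
  ultimately show ?thesis using analytic_eq_at[OF F(1)] by fastforce
qed

text \<open>The reflection about z multiplies (s - z)^N by (-1)^N, so the leading coefficient
  satisfies (-1)^N F(z) = \<epsilon> F(z).\<close>

lemma local_form_parity:
  assumes "local_form f z N F" "\<forall>\<^sub>F s in at z. f (2 * z - s) = \<epsilon> * f s" "\<epsilon> \<noteq> (- 1) powi N"
  shows "F z = 0"
proof -
  note F = local_formD[OF assms(1)]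
  have G: "(\<lambda>s. F (2 * z - s)) analytic_on {z}"
    using analytic_at_reflect[OF analytic_at_shift[of F "- z" "2 * z"]] F(1) by (simp add: add.commute)
  have ev: "\<forall>\<^sub>F s in at z. f (2 * z - s) = (2 * z - s - z) powi N * F (2 * z - s)"
  proof -
    have "\<forall>\<^sub>F s in at (- z + 2 * z). f s = (s - z) powi N * F s" using F(2) by simp
    hence "\<forall>\<^sub>F s in at z. f (- s + 2 * z) = (- s + 2 * z - z) powi N * F (- s + 2 * z)"
      unfolding eventually_at_shift eventually_at_minus .
    thus ?thesis by (simp add: algebra_simps)
  qed
  have "\<forall>\<^sub>F s in at z. (- 1) powi N * F (2 * z - s) = \<epsilon> * F s"
    using F(2) ev assms(2) eventually_at_neq
  proof eventually_elim
    case (elim s)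
    have "2 * z - s - z = (- 1) * (s - z)" by simp
    hence "(2 * z - s - z) powi N = (- 1) powi N * (s - z) powi N"
      by (metis power_int_mult_distrib)
    with elim show ?case by simp
  qed
  hence "(- 1) powi N * F (2 * z - z) = \<epsilon> * F z"
    by (rule analytic_eq_at[rotated 2]) (use F(1) G in \<open>auto intro!: analytic_intros\<close>)
  thus ?thesis using assms(3) by simp
qed

lemma ord_ge_parity_improve:
  assumes "ord_ge f z N" "\<forall>\<^sub>F s in at z. f (2 * z - s) = \<epsilon> * f s" "\<epsilon> \<noteq> (- 1) powi N"
  shows "ord_ge f z (N + 1)"
  using assms local_form_parity local_form_improve unfolding ord_ge_def by metis

text \<open>Integrating raises the order by one only for negative orders, where no residue can be lost.\<close>

lemma ord_ge_antideriv:
  assumes "ord_ge f z M" "ord_ge (deriv f) z (N - 1)" "N \<le> 0"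
  shows "ord_ge f z N"
proof (cases "M \<ge> N")
  case True
  thus ?thesis using ord_ge_mono assms by blast
next
  case False
  have "ord_ge f z (M + int k)" if "M + int k \<le> N" for k
    using that
  proof (induction k)
    case (Suc k)
    then obtain F where F: "local_form f z (M + int k) F" by (auto simp: ord_ge_def)
    from local_form_order_unique[OF local_form_deriv[OF F] assms(2)] Suc.prems
    have "of_int (M + int k) * F z = 0" by (simp del: of_int_add)
    moreover have "(of_int (M + int k) :: complex) \<noteq> 0"
      using Suc.prems assms(3) by (subst of_int_eq_0_iff) linarith
    ultimately have "F z = 0" by (simp del: of_int_add)
    from local_form_improve[OF F this] show ?case by (simp add: algebra_simps)
  qed (use assms in auto)
  from this[of "nat (N - M)"] show ?thesis using False by simp
qed

lemma ord_ge_shift: "ord_ge f (z + p) N \<longleftrightarrow> ord_ge (\<lambda>s. f (s + p)) z N"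
proof -
  have 1: "ord_ge (\<lambda>s. f (s + p)) z N" if *: "ord_ge f (z + p) N" for f z p
  proof -
    obtain F where "F analytic_on {z + p}" "\<forall>\<^sub>F s in at (z + p). f s = (s - (z + p)) powi N * F s"
      using * by (auto simp: ord_ge_def local_form_def)
    thus ?thesis unfolding ord_ge_def local_form_def eventually_at_shift
      by (intro exI[of _ "\<lambda>s. F (s + p)"]) (auto intro: analytic_at_shift)
  qed
  from 1[of f z p] 1[of "\<lambda>s. f (s + p)" "z + p" "- p"] show ?thesis by auto
qed

lemma ord_ge_reflect: "ord_ge f (- z) N \<longleftrightarrow> ord_ge (\<lambda>s. f (- s)) z N"
proof -
  have 1: "ord_ge (\<lambda>s. f (- s)) z N" if *: "ord_ge f (- z) N" for f z
  proof -
    obtain F where F: "F analytic_on {- z}" "\<forall>\<^sub>F s in at (- z). f s = (s - (- z)) powi N * F s"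
      using * by (auto simp: ord_ge_def local_form_def)
    have "\<forall>\<^sub>F s in at z. f (- s) = (s - z) powi N * ((- 1) powi N * F (- s))"
      using F(2)[unfolded eventually_at_minus]
    proof eventually_elim
      case (elim s)
      have "(- s - (- z)) powi N = ((- 1) * (s - z)) powi N" by (simp add: algebra_simps)
      also have "\<dots> = (- 1) powi N * (s - z) powi N" by (rule power_int_mult_distrib)
      finally show ?case using elim by simp
    qed
    moreover have "(\<lambda>s. (- 1) powi N * F (- s)) analytic_on {z}"
      by (intro analytic_on_mult analytic_on_const analytic_at_reflect F)
    ultimately show ?thesis unfolding ord_ge_def local_form_def by blast
  qed
  from 1[of f z] 1[of "\<lambda>s. f (- s)" "- z"] show ?thesis by auto
qed

text \<open>\<open>remove_sings\<close> glues the local analytic representatives. The last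
  conclusion leads back from the entire function to the actual values at regular points.\<close>

lemma entire_extension:
  assumes "\<And>z. ord_ge f z 0"
  obtains g where "g holomorphic_on UNIV" "\<And>z. \<forall>\<^sub>F s in at z. f s = g s"
    "\<And>z. f analytic_on {z} \<Longrightarrow> f z = g z"
proof -
  define g where "g = remove_sings f"
  have g: "g analytic_on {z} \<and> (\<forall>\<^sub>F s in at z. f s = g s)" for z
  proof -
    obtain F where F: "F analytic_on {z}" "\<forall>\<^sub>F s in at z. f s = F s"
      using assms[of z] by (auto simp: ord_ge_0_iff)
    obtain S where S: "open S" "z \<in> S" "F holomorphic_on S"
      using F(1) by (auto simp: analytic_at)
    have an: "F analytic_on {s}" if "s \<in> S" for s
      using S that by (auto simp: analytic_at)
    have gz: "g z = F z" using remove_sings_cong[OF F(2) refl] F(1) by (simp add: g_def)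
    have "\<forall>\<^sub>F s in at z. s \<in> S" using S by (simp add: eventually_at_in_open')
    hence ev: "\<forall>\<^sub>F s in at z. g s = F s"
      using eventually_at_imp_nhds[OF F(2)]
    proof eventually_elim
      case (elim s)
      have "\<forall>\<^sub>F u in at s. f u = F u" using elim(2) by (simp add: eventually_at_filter eventually_mono)
      from remove_sings_cong[OF this refl] an[OF elim(1)] show ?case by (simp add: g_def)
    qed
    hence "\<forall>\<^sub>F s in nhds z. g s = F s" using gz by (auto simp: eventually_at_filter elim: eventually_mono)
    hence "g analytic_on {z}" using analytic_at_cong F(1) by blast
    moreover have "\<forall>\<^sub>F s in at z. f s = g s" using F(2) ev by eventually_elim simp
    ultimately show ?thesis by blast
  qed
  show ?thesis
  proof (rule that[of g])
    show "g holomorphic_on UNIV"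
      using g by (metis analytic_imp_holomorphic analytic_on_analytic_at)
  qed (use g in \<open>auto simp: g_def\<close>)
qed

lemma entire_ev_eq:
  assumes "g holomorphic_on UNIV" "h holomorphic_on UNIV" "\<forall>\<^sub>F s in at z. g s = h s"
  shows "g w = h (w :: complex)"
proof -
  have an: "g analytic_on {x}" "h analytic_on {x}" for x
    using assms by (auto simp: analytic_at intro!: exI[of _ UNIV])
  obtain S where S: "open S" "z \<in> S" "\<And>s. s \<in> S \<Longrightarrow> s \<noteq> z \<Longrightarrow> g s = h s"
    using assms(3) unfolding eventually_at_topological by blast
  have "g s = h s" if "s \<in> S" for s
    using S(3)[OF that] analytic_eq_at[OF an assms(3)] by (cases "s = z") auto
  from analytic_continuation_open[of S UNIV g h w] this S assms show ?thesis by auto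
qed


section \<open>Periodicity and addition\<close>


context half_period_basis
begin

section \<open>The complement of the lattice and the half-periods\<close>

lemma eventually_not_Lat: "\<forall>\<^sub>F s in at z. s + a \<notin> Lat"
proof -
  have "\<not> (z + a) islimpt (Lat \<inter> cball (z + a) 1)"
    by (intro islimpt_finite finite_Lat_ball)
  hence "\<forall>\<^sub>F s in at (z + a). s \<notin> Lat \<inter> cball (z + a) 1" by (simp add: islimpt_iff_eventually)
  moreover have "\<forall>\<^sub>F s in at (z + a). s \<in> ball (z + a) 1" by (intro eventually_at_in_open') auto
  ultimately have "\<forall>\<^sub>F s in at (z + a). s \<notin> Lat" by eventually_elim auto
  thus ?thesis by (simp add: eventually_at_shift)
qed

lemma eventually_not_Lat': "\<forall>\<^sub>F s in at z. s - a \<notin> Lat" "\<forall>\<^sub>F s in at z. s \<notin> Lat"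
  using eventually_not_Lat[where z = z and a = "- a"] eventually_not_Lat[where z = z and a = 0] by simp_all

lemma closed_Lat: "closed Lat"
  unfolding closed_limpt islimpt_iff_eventually using eventually_not_Lat'(2) by blast

lemma open_Compl_Lat: "open (- Lat)"
  using closed_Lat by (simp add: open_Compl)

lemma countable_Lat: "countable Lat"
proof -
  have "Lat = (\<lambda>(m, n). of_int m * (2 * w1) + of_int n * (2 * w3)) ` (UNIV :: (int \<times> int) set)"
    by (auto simp: period_lattice_def)
  thus ?thesis by simp
qed

lemma connected_Compl_Lat: "connected (- Lat)"
  using path_connected_complement_countable[of Lat] countable_Lat
  by (simp add: path_connected_imp_connected)

lemma constant_off_Lat:
  assumes "\<And>z. z \<notin> Lat \<Longrightarrow> (f has_field_derivative 0) (at z)" "z \<notin> Lat" "w \<notin> Lat"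
  shows "f z = f w"
  using has_field_derivative_0_imp_constant_on[of "- Lat" f] assms open_Compl_Lat connected_Compl_Lat
  unfolding constant_on_def by fastforce

lemma real_coordinates_eq_0:
  assumes "of_real a * (2 * w1) + of_real b * (2 * w3) = 0"
  shows "a = 0 \<and> b = 0"
proof -
  obtain c where c: "c > 0"
    "\<And>m n :: real. c * (\<bar>m\<bar> + \<bar>n\<bar>) \<le> norm (of_real m * (2 * w1) + of_real n * (2 * w3))"
    by (rule lattice_coordinate_bound) blast
  have "c * (\<bar>a\<bar> + \<bar>b\<bar>) \<le> 0" using c(2)[of a b] assms by simp
  hence "\<bar>a\<bar> + \<bar>b\<bar> \<le> 0" using c(1) by (simp add: mult_le_0_iff)
  thus ?thesis by linarith
qed

lemma half_integer_Lat:
  assumes "of_int a * w1 + of_int b * w3 \<in> Lat"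
  shows "even a \<and> even b"
proof -
  obtain m n :: int where "of_int a * w1 + of_int b * w3 = of_int m * (2 * w1) + of_int n * (2 * w3)"
    using assms by (auto simp: period_lattice_def)
  hence "of_real (a / 2 - m) * (2 * w1) + of_real (b / 2 - n) * (2 * w3) = 0"
    by (simp add: algebra_simps)
  from real_coordinates_eq_0[OF this] have "real_of_int a = 2 * m" "real_of_int b = 2 * n" by auto
  hence "a = 2 * m" "b = 2 * n" by linarith+
  thus ?thesis by simp
qed

lemma hp_simps [simp]: "hp 0 = 0" "hp 1 = w1" "hp (Suc 0) = w1" "hp 2 = - (w1 + w3)" "hp 3 = w3"
  by (simp_all add: half_period_def)

lemma le3_cases: "i \<le> 3 \<Longrightarrow> i = 0 \<or> i = 1 \<or> i = 2 \<or> i = (3::nat)"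
  by linarith

lemma two_hp_Lat [simp]: "2 * hp i \<in> Lat"
proof -
  have "2 * - (w1 + w3) = of_int (- 1) * (2 * w1) + of_int (- 1) * (2 * w3)"
    by (simp add: algebra_simps)
  hence "2 * - (w1 + w3) \<in> Lat" by (simp only: LatI)
  thus ?thesis unfolding half_period_def by (simp split: if_splits)
qed

lemma hp_diff_notin_Lat:
  assumes "i \<le> 3" "j \<le> 3" "i \<noteq> j" shows "hp i - hp j \<notin> Lat"
proof
  define A :: "nat \<Rightarrow> int" where "A i = (if i = 1 then 1 else if i = 2 then - 1 else 0)" for i
  define B :: "nat \<Rightarrow> int" where "B i = (if i = 3 then 1 else if i = 2 then - 1 else 0)" for i
  have hp: "hp i = of_int (A i) * w1 + of_int (B i) * w3" if "i \<le> 3" for i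
    using le3_cases[OF that] by (auto simp: A_def B_def)
  assume "hp i - hp j \<in> Lat"
  moreover have "hp i - hp j = of_int (A i - A j) * w1 + of_int (B i - B j) * w3"
    using assms by (simp add: hp algebra_simps)
  ultimately have "even (A i - A j) \<and> even (B i - B j)"
    using half_integer_Lat[of "A i - A j" "B i - B j"] by (simp only:)
  thus False
    using le3_cases[OF assms(1)] le3_cases[OF assms(2)] assms(3) by (auto simp: A_def B_def)
qed

lemma hp_notin_Lat: "i \<le> 3 \<Longrightarrow> i \<noteq> 0 \<Longrightarrow> hp i \<notin> Lat"
  using hp_diff_notin_Lat[of i 0] by simp

lemma w1_notin_Lat [simp]: "w1 \<notin> Lat" and w3_notin_Lat [simp]: "w3 \<notin> Lat"
  using hp_notin_Lat[of 1] hp_notin_Lat[of 3] by auto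

text \<open>The correction terms hide periodicity in the defining sum. But
  \<open>wp (z + 2 * h) - wp z\<close> has derivative 0 because \<open>wp'\<close> is periodic, so
  it is constant off the lattice, and at z = -h it vanishes by evenness.\<close>

lemma wp_periodic:
  assumes "p \<in> Lat" "z \<notin> Lat" shows "wp (z + p) = wp z"
proof -
  have step: "wp (z + 2 * h) = wp z" if "h \<notin> Lat" "2 * h \<in> Lat" "z \<notin> Lat" for h z
  proof -
    have "(\<lambda>z. wp (z + 2 * h) - wp z) z = (\<lambda>z. wp (z + 2 * h) - wp z) (- h)"
    proof (rule constant_off_Lat[where f = "\<lambda>z. wp (z + 2 * h) - wp z"])
      fix z assume z: "z \<notin> Lat"
      hence z': "z + 2 * h \<notin> Lat" using that by (simp add: Lat_add_cancel)
      have "((\<lambda>z. wp (z + 2 * h) - wp z) has_field_derivative wp' (z + 2 * h) - wp' z) (at z)"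
        by (intro DERIV_diff DERIV_shift[THEN iffD1] wp_deriv z z')
      thus "((\<lambda>z. wp (z + 2 * h) - wp z) has_field_derivative 0) (at z)"
        using wp'_periodic that by simp
    qed (use that in auto)
    thus ?thesis by simp
  qed
  show ?thesis using assms
  proof (induction p rule: Lat_induct)
    case (w1 p)
    then show ?case using step[of w1 "z + p"] by (simp add: Lat_add_cancel add.assoc)
  next
    case (w3 p)
    then show ?case using step[of w3 "z + p"] by (simp add: Lat_add_cancel add.assoc)
  next
    case (minus_w1 p)
    then show ?case using step[of w1 "z + p - 2 * w1"] by (simp add: Lat_add_cancel Lat_diff_cancel add_diff_eq)
  next
    case (minus_w3 p)
    then show ?case using step[of w3 "z + p - 2 * w3"] by (simp add: Lat_add_cancel Lat_diff_cancel add_diff_eq)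
  qed simp
qed

lemma wz_translate:
  assumes "p \<in> Lat" "z \<notin> Lat" "w \<notin> Lat"
  shows "wz (z + p) - wz z = wz (w + p) - wz w"
proof -
  have "(\<lambda>z. wz (z + p) - wz z) z = (\<lambda>z. wz (z + p) - wz z) w"
  proof (rule constant_off_Lat[where f = "\<lambda>z. wz (z + p) - wz z"])
    fix z assume z: "z \<notin> Lat"
    hence z': "z + p \<notin> Lat" using assms by (simp add: Lat_add_cancel)
    have "((\<lambda>z. wz (z + p) - wz z) has_field_derivative - wp (z + p) - - wp z) (at z)"
      by (intro DERIV_diff DERIV_shift[THEN iffD1] wz_deriv z z')
    thus "((\<lambda>z. wz (z + p) - wz z) has_field_derivative 0) (at z)"
      using wp_periodic[OF assms(1) z] by simp
  qed (use assms in auto)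
  thus ?thesis .
qed

lemma wz_0 [simp]: "wz 0 = 0"
  using wz_minus[of 0] by simp

text \<open>The translation constant is evaluated at \<open>- hp i\<close>, where oddness of
  \<open>wz\<close> gives twice its value at \<open>hp i\<close>. The case i = 0 agrees with the
  convention \<open>wz 0 = 0\<close>.\<close>

lemma wz_quasi:
  assumes "i \<le> 3" "z \<notin> Lat" shows "wz (z + 2 * hp i) = wz z + 2 * wz (hp i)"
proof (cases "i = 0")
  case False
  from wz_translate[OF two_hp_Lat[of i] assms(2), of "- hp i"] show ?thesis
    using hp_notin_Lat[OF assms(1) False] by (simp add: algebra_simps)
qed simp

text \<open>The two translates of \<open>- hp i - hp k\<close> by \<open>2 * hp i\<close> and by
  \<open>2 * hp k\<close> are negatives of each other. Subtracting the two quasi-periodicity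
  relations eliminates the value at the base point.\<close>

lemma wz_hp_diff:
  assumes "i \<le> 3" "k \<le> 3" "i \<noteq> k"
  shows "wz (hp i - hp k) = wz (hp i) - wz (hp k)"
proof -
  define z where "z = - hp i - hp k"
  have n: "hp k - hp i \<notin> Lat" using hp_diff_notin_Lat assms by metis
  have z: "z \<notin> Lat" using n Lat_diff_cancel[of "2 * hp k" "hp k - hp i"] by (simp add: z_def algebra_simps)
  have "wz (z + 2 * hp i) = wz z + 2 * wz (hp i)" "wz (z + 2 * hp k) = wz z + 2 * wz (hp k)"
    using wz_quasi[OF assms(1) z] wz_quasi[OF assms(2) z] by auto
  moreover have "z + 2 * hp i = hp i - hp k" "z + 2 * hp k = - (hp i - hp k)" by (auto simp: z_def)
  ultimately have "wz (hp i - hp k) = wz z + 2 * wz (hp i)" "- wz (hp i - hp k) = wz z + 2 * wz (hp k)"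
    by (simp_all only: wz_minus)
  thus ?thesis by (simp add: algebra_simps) algebra
qed

text \<open>A value at a pole, produced by 1 / 0 = 0. Together with \<open>wz_0\<close> it lets
  double sums over all pairs include the diagonal, where their terms then vanish.\<close>

lemma wp_0 [simp]: "wp 0 = 0"
  by (simp add: weierstrass_p_def)

lemma wz_at_0:
  obtains h where "h analytic_on {0}" "h 0 = 0" "deriv h 0 = 0"
    "\<forall>\<^sub>F s in at 0. wz s = 1 / s + h s" "\<forall>\<^sub>F s in at 0. wp s = 1 / s ^ 2 - deriv h s"
proof -
  obtain S where S: "open S" "0 \<in> S" "\<And>s. s \<in> S \<Longrightarrow> s \<noteq> 0 \<Longrightarrow> s \<notin> Lat"
    using eventually_not_Lat'(2)[where z = 0] unfolding eventually_at_topological by blast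
  then obtain r where r: "r > 0" "ball 0 r \<subseteq> S" using openE by blast
  define R where "R = r / 3"
  have R: "R > 0" using r by (simp add: R_def)
  have near: "Lat_near R = {}"
    using S(3) r by (fastforce simp: Lat_near_def R_def subset_iff)
  have h: "deriv (log_tail R) analytic_on {0}"
    unfolding analytic_at using holomorphic_deriv[OF log_tail_holomorphic, of R] R
    by (intro exI[of _ "ball 0 R"]) auto
  show ?thesis
  proof (rule that[OF h])
    have ev: "\<forall>\<^sub>F s in at 0. s \<in> ball 0 R" using R by (intro eventually_at_in_open') auto
    \<comment> \<open>No nonzero lattice point is near, so the local formulas at 0 consist of 1 / 0
      = 0 and the tail only; the conventional values of \<open>wz\<close> and \<open>wp\<close> at 0
      then give both equations.\<close>
    show "deriv (log_tail R) 0 = 0" "deriv (deriv (log_tail R)) 0 = 0"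
      using wz_local[of 0 R] wp_local[of 0 R] near R by (auto simp: numeral_2_eq_2)
    show "\<forall>\<^sub>F s in at 0. wz s = 1 / s + deriv (log_tail R) s"
      using ev by eventually_elim (use wz_local near in simp)
    show "\<forall>\<^sub>F s in at 0. wp s = 1 / s\<^sup>2 - deriv (deriv (log_tail R)) s"
      using ev by eventually_elim (use wp_local near in \<open>simp add: numeral_2_eq_2\<close>)
  qed
qed

lemma wp_local_form:
  assumes "z - a \<in> Lat"
  obtains F where "local_form (\<lambda>x. wp (x - a)) z (- 2) F" "F z = 1"
proof -
  obtain h where h: "h analytic_on {0}" "\<forall>\<^sub>F s in at 0. wp s = 1 / s ^ 2 - deriv h s"
    by (rule wz_at_0) blast
  define F where "F = (\<lambda>x. 1 - (x - z) ^ 2 * deriv h (x - z))"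
  have "(\<lambda>x. deriv h (x + - z)) analytic_on {z}"
    using analytic_at_shift[of "deriv h" z "- z"] h(1) by (simp add: analytic_intros)
  hence "F analytic_on {z}" unfolding F_def by (auto intro!: analytic_intros)
  moreover have "\<forall>\<^sub>F x in at z. wp (x - a) = (x - z) powi (- 2) * F x"
  proof -
    have "\<forall>\<^sub>F x in at (z + (- z)). wp x = 1 / x ^ 2 - deriv h x" using h(2) by simp
    hence "\<forall>\<^sub>F x in at z. wp (x + - z) = 1 / (x + - z) ^ 2 - deriv h (x + - z)"
      by (simp only: eventually_at_shift)
    thus ?thesis using eventually_at_neq eventually_not_Lat'(1)[where z = z and a = z]
    proof eventually_elim
      case (elim x)
      have "wp (x - a) = wp (x - z + (z - a))" by simp
      also have "\<dots> = wp (x - z)" using wp_periodic[OF assms elim(3)] .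
      finally show ?case using elim(1,2)
        by (simp add: F_def power_int_minus field_simps)
    qed
  qed
  ultimately have "local_form (\<lambda>x. wp (x - a)) z (- 2) F" by (simp add: local_form_def)
  thus ?thesis by (rule that) (simp add: F_def)
qed

lemma wp_holomorphic: "wp holomorphic_on - Lat" and wz_holomorphic: "wz holomorphic_on - Lat"
  using wp_deriv wz_deriv by (auto simp: holomorphic_on_open open_Compl_Lat)

lemma wp_analytic: "z \<notin> Lat \<Longrightarrow> wp analytic_on {z}" and wz_analytic: "z \<notin> Lat \<Longrightarrow> wz analytic_on {z}"
  using wp_holomorphic wz_holomorphic open_Compl_Lat by (metis analytic_at ComplI)+

lemma wp_shift_analytic: "z - a \<notin> Lat \<Longrightarrow> (\<lambda>x. wp (x - a)) analytic_on {z}"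
  using analytic_at_shift[of wp z "- a"] wp_analytic by simp

lemma wz_shift_analytic: "z - a \<notin> Lat \<Longrightarrow> (\<lambda>x. wz (x - a)) analytic_on {z}"
  using analytic_at_shift[of wz z "- a"] wz_analytic by simp

text \<open>The residue is written with \<open>of_bool\<close> so that regular points and poles are
  covered by one formula and many such terms can be summed at a common point z.\<close>

lemma wz_simple_pole:
  "ord_ge (\<lambda>x. wz (x - a) - of_bool (z - a \<in> Lat) / (x - z)) z 0"
proof (cases "z - a \<in> Lat")
  case True
  obtain h where h: "h analytic_on {0}" "\<forall>\<^sub>F s in at 0. wz s = 1 / s + h s"
    by (rule wz_at_0) blast
  define c where "c = wz (w1 + (z - a)) - wz w1"
  have "\<forall>\<^sub>F x in at (z + (- z)). wz x = 1 / x + h x" using h(2) by simp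
  hence "\<forall>\<^sub>F x in at z. wz (x + - z) = 1 / (x + - z) + h (x + - z)"
    by (simp only: eventually_at_shift)
  hence "\<forall>\<^sub>F x in at z. wz (x - a) - of_bool (z - a \<in> Lat) / (x - z) = h (x - z) + c"
    using eventually_not_Lat'(1)[where z = z and a = z]
  proof eventually_elim
    case (elim x)
    from wz_translate[OF True elim(2) w1_notin_Lat]
    have "wz (x - z + (z - a)) - wz (x - z) = c" by (simp add: c_def)
    thus ?case using elim(1) True by (simp add: algebra_simps)
  qed
  moreover have "(\<lambda>x. h (x + - z)) analytic_on {z}"
    using analytic_at_shift[of h z "- z"] h(1) by simp
  hence "(\<lambda>x. h (x - z) + c) analytic_on {z}"
    by (auto intro!: analytic_intros)
  ultimately show ?thesis unfolding ord_ge_0_iff by blast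
qed (simp add: ord_ge_analytic wz_shift_analytic)

section \<open>Fundamental domain, Liouville's theorem and the addition formula\<close>

lemma real_coordinates:
  obtains a b :: real where "z = of_real a * (2 * w1) + of_real b * (2 * w3)"
proof -
  define \<tau> where "\<tau> = w3 / w1"
  define u where "u = z / (2 * w1)"
  define b where "b = Im u / Im \<tau>"
  define a where "a = Re u - b * Re \<tau>"
  have "Im \<tau> > 0" using upper by (simp add: \<tau>_def)
  hence "u = of_real a + of_real b * \<tau>" by (simp add: complex_eq_iff a_def b_def)
  hence "z = of_real a * (2 * w1) + of_real b * (2 * w3)"
    by (simp add: u_def \<tau>_def field_simps)
  thus ?thesis by (rule that)
qed

definition fundamental_domain :: "complex set" where
  "fundamental_domain = {of_real a * (2 * w1) + of_real b * (2 * w3) | a b :: real. 0 \<le> a \<and> a < 1 \<and> 0 \<le> b \<and> b < 1}"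

lemma fundamental_domain_reduce:
  obtains p where "p \<in> Lat" "z - p \<in> fundamental_domain"
proof -
  obtain a b :: real where z: "z = of_real a * (2 * w1) + of_real b * (2 * w3)"
    by (rule real_coordinates)
  have "z - (of_int \<lfloor>a\<rfloor> * (2 * w1) + of_int \<lfloor>b\<rfloor> * (2 * w3))
      = of_real (frac a) * (2 * w1) + of_real (frac b) * (2 * w3)"
    by (simp add: z frac_def algebra_simps)
  moreover have "of_real (frac a) * (2 * w1) + of_real (frac b) * (2 * w3) \<in> fundamental_domain"
    unfolding fundamental_domain_def using frac_ge_0 frac_lt_1 by blast
  ultimately show ?thesis using that[OF LatI] by metis
qed

lemma fundamental_domain_unique:
  assumes "u \<in> fundamental_domain" "v \<in> fundamental_domain" "u - v \<in> Lat"
  shows "u = v"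
proof -
  obtain a b c d :: real where ab: "u = of_real a * (2 * w1) + of_real b * (2 * w3)"
      "v = of_real c * (2 * w1) + of_real d * (2 * w3)"
      "0 \<le> a" "a < 1" "0 \<le> b" "b < 1" "0 \<le> c" "c < 1" "0 \<le> d" "d < 1"
    using assms(1,2) by (auto simp: fundamental_domain_def)
  obtain m n :: int where "u - v = of_int m * (2 * w1) + of_int n * (2 * w3)"
    using assms(3) by (auto simp: period_lattice_def)
  hence "of_real (a - c - of_int m) * (2 * w1) + of_real (b - d - of_int n) * (2 * w3) = 0"
    by (simp add: ab algebra_simps)
  from real_coordinates_eq_0[OF this] have "a - c = of_int m" "b - d = of_int n" by auto
  moreover have "m = 0" "n = 0" using ab(3-) calculation by linarith+
  ultimately show ?thesis by (simp add: ab)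
qed

text \<open>The closed counterpart of \<open>fundamental_domain\<close>: the half-open set has
  exactly one representative of each class, the closed one is compact.\<close>

definition fundamental_cell :: "complex set" where
  "fundamental_cell = (\<lambda>(a, b). of_real a * (2 * w1) + of_real b * (2 * w3)) ` ({0..1} \<times> {0..1::real})"

lemma fundamental_cell:
  "compact fundamental_cell" "fundamental_domain \<subseteq> fundamental_cell"
proof -
  show "compact fundamental_cell"
    unfolding fundamental_cell_def case_prod_unfold
    by (intro compact_continuous_image compact_Times compact_Icc continuous_intros)
  show "fundamental_domain \<subseteq> fundamental_cell"
    unfolding fundamental_domain_def fundamental_cell_def by force
qed

lemma periodic_Lat:
  assumes "\<And>z. f (z + 2 * w1) = f z" "\<And>z. f (z + 2 * w3) = (f z :: complex)" "p \<in> Lat"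
  shows "f (z + p) = f z"
  using assms(3)
proof (induction p rule: Lat_induct)
  case (w1 p)
  then show ?case using assms(1)[of "z + p"] by (simp add: add.assoc)
next
  case (w3 p)
  then show ?case using assms(2)[of "z + p"] by (simp add: add.assoc)
next
  case (minus_w1 p)
  then show ?case using assms(1)[of "z + p - 2 * w1"] by (simp add: add_diff_eq)
next
  case (minus_w3 p)
  then show ?case using assms(2)[of "z + p - 2 * w3"] by (simp add: add_diff_eq)
qed simp

lemma entire_periodic_constant:
  assumes "g holomorphic_on UNIV" "\<And>z. g (z + 2 * w1) = g z" "\<And>z. g (z + 2 * w3) = g z"
  obtains c where "\<And>z. g z = c"
proof -
  have "range g \<subseteq> g ` fundamental_cell"
  proof
    fix y assume "y \<in> range g"
    then obtain z where z: "y = g z" by blast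
    obtain p where p: "p \<in> Lat" "z - p \<in> fundamental_domain" by (rule fundamental_domain_reduce)
    have "g (z - p + p) = g (z - p)" by (rule periodic_Lat) (use assms p in auto)
    thus "y \<in> g ` fundamental_cell" using z p fundamental_cell(2) by (metis diff_add_cancel image_eqI subsetD)
  qed
  moreover have "compact (g ` fundamental_cell)"
    by (intro compact_continuous_image fundamental_cell)
       (use assms(1) holomorphic_on_imp_continuous_on continuous_on_subset in blast)
  ultimately have "bounded (range g)" using bounded_subset compact_imp_bounded by blast
  from Liouville_theorem[OF assms(1) this] show ?thesis using that by (auto simp: constant_on_def)
qed

lemma elliptic_constant:
  assumes "\<And>z. ord_ge f z 0"
    "\<And>z. \<forall>\<^sub>F s in at z. f (s + 2 * w1) = f s" "\<And>z. \<forall>\<^sub>F s in at z. f (s + 2 * w3) = f s"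
  obtains c where "\<And>z. \<forall>\<^sub>F s in at z. f s = c" "\<And>z. f analytic_on {z} \<Longrightarrow> f z = c"
proof -
  obtain g where g: "g holomorphic_on UNIV" "\<And>z. \<forall>\<^sub>F s in at z. f s = g s"
    "\<And>z. f analytic_on {z} \<Longrightarrow> f z = g z"
    using entire_extension[of f] assms(1) by blast
  have per: "g (z + p) = g z" if "\<And>z. \<forall>\<^sub>F s in at z. f (s + p) = f s" for p z
  proof -
    have "(\<lambda>z. g (z + p)) holomorphic_on UNIV"
      using holomorphic_on_compose_gen[of "\<lambda>z. z + p" UNIV g UNIV] g(1) by (simp add: o_def holomorphic_intros)
    moreover have "\<forall>\<^sub>F s in at 0. g (s + p) = g s"
      using that[of 0] g(2)[of 0] g(2)[of "0 + p", unfolded eventually_at_shift]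
      by eventually_elim simp
    ultimately show ?thesis using entire_ev_eq[OF _ g(1)] by blast
  qed
  obtain c where "\<And>z. g z = c"
    using entire_periodic_constant[OF g(1) per per] assms by blast
  with g show ?thesis by (intro that[of c]) auto
qed

text \<open>The difference of the two sides is elliptic in u, with possible poles only at the
  classes of 0 and -v. It is regular there, hence constant, and its extension to u = 0 has the value
  0.\<close>

lemma wz_addition:
  assumes "u \<notin> Lat" "v \<notin> Lat" "u + v \<notin> Lat"
  shows "(wz u + wz v - wz (u + v)) ^ 2 = wp u + wp v + wp (u + v)"
proof -
  define f where "f = (\<lambda>u. (wz u + wz v - wz (u + v)) ^ 2 - wp u - wp v - wp (u + v))"
  have per: "f (s + p) = f s" if "p \<in> Lat" "s \<notin> Lat" "s + v \<notin> Lat" for s p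
  proof -
    have "wz (s + p) - wz s = wz (s + v + p) - wz (s + v)" by (rule wz_translate) (use that in auto)
    hence 1: "wz (s + p) + wz v - wz (s + p + v) = wz s + wz v - wz (s + v)" by (simp add: algebra_simps)
    have 2: "s + p + v = s + v + p" by simp
    have 3: "wp (s + p) = wp s" using wp_periodic[OF that(1,2)] .
    have 4: "wp (s + p + v) = wp (s + v)" unfolding 2 using wp_periodic[OF that(1,3)] .
    show ?thesis by (simp only: f_def 1 3 4)
  qed
  \<comment> \<open>This reflection exchanges the two classes of possible poles, so the expansion at
    0 settles both.\<close>
  have refl: "f (- s - v) = f s" for s
  proof -
    have 1: "wz (- s - v) = - wz (s + v)" "wp (- s - v) = wp (s + v)" "- s - v + v = - s"
      using wz_minus[of "s + v"] wp_minus[of "s + v"] by simp_all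
    show ?thesis unfolding f_def 1 wz_minus wp_minus by algebra
  qed
  have f_analytic: "f analytic_on {s}" if "s \<notin> Lat" "s + v \<notin> Lat" for s
    unfolding f_def using wz_analytic[OF that(1)] wz_shift_analytic[of s "- v"]
      wp_analytic[OF that(1)] wp_shift_analytic[of s "- v"] that(2)
    by (intro analytic_on_diff analytic_on_power analytic_on_add analytic_on_const) simp_all
  obtain h where h: "h analytic_on {0}" "h 0 = 0" "deriv h 0 = 0"
    "\<forall>\<^sub>F s in at 0. wz s = 1 / s + h s" "\<forall>\<^sub>F s in at 0. wp s = 1 / s ^ 2 - deriv h s"
    by (rule wz_at_0) blast
  define k where "k = (\<lambda>s. h s + wz v - wz (s + v))"
  have k_an: "k analytic_on {0}"
    unfolding k_def using wz_shift_analytic[of 0 "- v"] assms h(1)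
    by (intro analytic_on_diff analytic_on_add analytic_on_const) simp_all
  have "((\<lambda>s. wz (s + v)) has_field_derivative - wp (0 + v)) (at 0)"
    by (intro DERIV_shift[THEN iffD1] wz_deriv) (use assms in simp)
  from DERIV_diff[OF DERIV_add[OF analytic_derivI[OF h(1)] DERIV_const] this]
  have "(k has_field_derivative deriv h 0 - - wp (0 + v)) (at 0)"
    unfolding k_def by simp
  hence k': "deriv k 0 = wp v" using h(3) by (simp add: DERIV_imp_deriv)
  obtain K where K: "K analytic_on {0}" "K 0 = deriv k 0" "\<And>s. k s = (s - 0) * K s"
    using analytic_zero_factor[OF k_an] h(2) by (auto simp: k_def)
  \<comment> \<open>What remains of (1 / s + k s)^2 - 1 / s^2 and the regular terms: as k vanishes
    at 0, the cross term 2 k(s) / s is the analytic 2 K(s). At s = 0 the sum is 2 k'(0) - 2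
    \<open>wp v\<close>, which is 0.\<close>
  define G where "G = (\<lambda>s. 2 * K s + k s ^ 2 + deriv h s - wp v - wp (s + v))"
  have G_an: "G analytic_on {0}"
    unfolding G_def using wp_shift_analytic[of 0 "- v"] assms K(1) k_an h(1)
    by (intro analytic_on_diff analytic_on_add analytic_on_mult analytic_on_power analytic_on_const
        analytic_deriv) simp_all
  have fG: "\<forall>\<^sub>F s in at 0. f s = G s"
    using h(4,5) eventually_at_neq
  proof eventually_elim
    case (elim s)
    have X: "wz s + wz v - wz (s + v) = 1 / s + k s" using elim by (simp add: k_def)
    have "f s = (1 / s + k s) ^ 2 - (1 / s ^ 2 - deriv h s) - wp v - wp (s + v)"
      by (simp only: f_def X elim(2))
    also have "(1 / s + k s) ^ 2 = 1 / s ^ 2 + 2 * K s + k s ^ 2"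
      using elim K(3)[of s] by (simp add: power2_eq_square field_simps)
    finally show ?case by (simp add: G_def)
  qed
  have ord0: "ord_ge f 0 0" unfolding ord_ge_0_iff using fG G_an by blast
  have ev: "\<forall>\<^sub>F s in at z. s \<notin> Lat \<and> s + v \<notin> Lat" for z
    using eventually_not_Lat[where z = z and a = 0] eventually_not_Lat[where z = z and a = v] by (simp add: eventually_conj_iff)
  have ord_Lat: "ord_ge f z 0" if "z \<in> Lat" for z
  proof -
    have "\<forall>\<^sub>F s in at z. f s = f (s - z)"
      using ev[of z] by eventually_elim (use per[of "- z"] that in auto)
    moreover have "ord_ge (\<lambda>s. f (s - z)) z 0"
      using ord_ge_shift[of f z "- z" 0] ord0 by simp
    ultimately show ?thesis by (rule ord_ge_cong[rotated])
  qed
  have ord: "ord_ge f z 0" for z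
  proof (cases "z \<in> Lat")
    case False
    show ?thesis
    proof (cases "z + v \<in> Lat")
      case True
      have "- z + - v \<in> Lat" using Lat_minus[OF True] by simp
      hence "ord_ge f (- z + - v) 0" by (rule ord_Lat)
      hence "ord_ge (\<lambda>s. f (s + - v)) (- z) 0" by (simp only: ord_ge_shift)
      hence "ord_ge (\<lambda>s. f (- s + - v)) z 0" by (simp only: ord_ge_reflect)
      thus ?thesis using refl by simp
    qed (use False f_analytic ord_ge_analytic in auto)
  qed (use ord_Lat in auto)
  obtain c where c: "\<And>z. \<forall>\<^sub>F s in at z. f s = c" "\<And>z. f analytic_on {z} \<Longrightarrow> f z = c"
  proof (rule elliptic_constant[of f])
    show "\<forall>\<^sub>F s in at z. f (s + 2 * w1) = f s" "\<forall>\<^sub>F s in at z. f (s + 2 * w3) = f s" for z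
      using ev[of z] by (eventually_elim, use per in auto)+
  qed (use ord in auto)
  have "\<forall>\<^sub>F s in at 0. G s = c" using fG c(1)[of 0] by eventually_elim simp
  from analytic_eq_at[OF G_an _ this] have "G 0 = c" by simp
  hence "c = 0" using K h(2,3) k' by (simp add: G_def k_def)
  thus ?thesis using c(2)[OF f_analytic] assms by (simp add: f_def algebra_simps)
qed

text \<open>Does the work of the Legendre relation. If both quasi-periods were the same multiple
  \<kappa> of the half-periods, sigma times exp(-\<kappa> z^2 / 2) would change only its sign under
  both periods. Its square would be entire and elliptic, hence constant, although it vanishes
  exactly on the lattice.\<close>

lemma eta_independent: "wz w1 * w3 \<noteq> wz w3 * w1"
proof
  assume eq: "wz w1 * w3 = wz w3 * w1"
  define \<kappa> where "\<kappa> = wz w1 / w1"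
  have \<kappa>: "wz w1 = \<kappa> * w1" "wz w3 = \<kappa> * w3"
    using eq by (simp_all add: \<kappa>_def field_simps)
  define s where "s = (\<lambda>z. ws z * exp (- (\<kappa> * z ^ 2 / 2)))"
  have s_deriv: "(s has_field_derivative s z * (wz z - \<kappa> * z)) (at z)" if "z \<notin> Lat" for z
    unfolding s_def using ws_deriv[OF that] by (auto intro!: derivative_eq_intros simp: algebra_simps)
  have s_nz: "s z \<noteq> 0 \<longleftrightarrow> z \<notin> Lat" for z by (simp add: s_def ws_eq_0_iff)
  have s_odd: "s (- z) = - s z" for z by (simp add: s_def)
  have anti: "s (z + 2 * h) = - s z" if h: "h \<notin> Lat" "2 * h \<in> Lat" "wz h = \<kappa> * h" for h z
  proof (cases "z \<in> Lat")
    case False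
    have "(\<lambda>z. s (z + 2 * h) / s z) z = (\<lambda>z. s (z + 2 * h) / s z) (- h)"
    proof (rule constant_off_Lat[where f = "\<lambda>z. s (z + 2 * h) / s z"])
      fix z assume z: "z \<notin> Lat"
      hence z': "z + 2 * h \<notin> Lat" using h by (simp add: Lat_add_cancel)
      have "((\<lambda>z. s (z + 2 * h)) has_field_derivative s (z + 2 * h) * (wz (z + 2 * h) - \<kappa> * (z + 2 * h))) (at z)"
        by (intro DERIV_shift[THEN iffD1] s_deriv z')
      moreover have "wz (z + 2 * h) = wz z + 2 * (\<kappa> * h)"
        using wz_translate[OF h(2) z, of "- h"] h by (simp add: algebra_simps)
      ultimately have "((\<lambda>z. s (z + 2 * h)) has_field_derivative s (z + 2 * h) * (wz z - \<kappa> * z)) (at z)"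
        by (simp add: algebra_simps)
      from DERIV_divide[OF this s_deriv[OF z]] z s_nz
      show "((\<lambda>z. s (z + 2 * h) / s z) has_field_derivative 0) (at z)"
        by (simp add: algebra_simps)
    qed (use False h in auto)
    also have "\<dots> = - 1" using s_nz[of h] s_odd h by simp
    finally show ?thesis using s_nz False by (simp add: field_simps)
  next
    case True
    hence "s z = 0" "s (z + 2 * h) = 0" using s_nz h by (meson Lat_add_cancel)+
    thus ?thesis by simp
  qed
  have "s holomorphic_on UNIV" unfolding s_def
    by (rule holomorphic_on_mult[OF ws_holomorphic]) (auto intro!: holomorphic_intros)
  hence "(\<lambda>z. s z ^ 2) holomorphic_on UNIV" by (rule holomorphic_on_power)
  then obtain c where c: "\<And>z. s z ^ 2 = c"
    by (rule entire_periodic_constant) (use anti \<kappa> in auto)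
  from c[of 0] c[of w1] have "s w1 = 0" using s_nz[of 0] by auto
  thus False using s_nz by auto
qed

end


section \<open>The Bethe ansatz equations\<close>


definition log_deriv_at :: "(complex \<Rightarrow> complex) \<Rightarrow> complex \<Rightarrow> complex \<Rightarrow> bool" where
  "log_deriv_at f d x \<longleftrightarrow> f x \<noteq> 0 \<and> (f has_field_derivative f x * d) (at x)"

lemma log_deriv_at_mult:
  "log_deriv_at f a x \<Longrightarrow> log_deriv_at g b x \<Longrightarrow> log_deriv_at (\<lambda>x. f x * g x) (a + b) x"
  unfolding log_deriv_at_def by (auto intro!: derivative_eq_intros simp: algebra_simps)

lemma log_deriv_at_divide:
  assumes "log_deriv_at f a x" "log_deriv_at g b x"
  shows "log_deriv_at (\<lambda>x. f x / g x) (a - b) x"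
proof -
  have "((\<lambda>x. f x / g x) has_field_derivative (f x * a * g x - f x * (g x * b)) / (g x * g x)) (at x)"
    using assms unfolding log_deriv_at_def by (intro DERIV_divide) auto
  also have "(f x * a * g x - f x * (g x * b)) / (g x * g x) = f x / g x * (a - b)"
    using assms by (simp add: log_deriv_at_def field_simps)
  finally show ?thesis using assms by (simp add: log_deriv_at_def)
qed

lemma log_deriv_at_const: "c \<noteq> 0 \<Longrightarrow> log_deriv_at (\<lambda>_. c) 0 x"
  by (simp add: log_deriv_at_def)

lemma log_deriv_at_prod:
  assumes "\<And>i. i \<in> I \<Longrightarrow> log_deriv_at (f i) (d i) x" "finite I"
  shows "log_deriv_at (\<lambda>x. \<Prod>i\<in>I. f i x) (\<Sum>i\<in>I. d i) x"
  using assms(2,1) by (induction I) (auto intro!: log_deriv_at_mult log_deriv_at_const)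

lemma log_deriv_at_power:
  assumes "log_deriv_at f d x" shows "log_deriv_at (\<lambda>x. f x ^ n) (of_nat n * d) x"
proof (induction n)
  case (Suc n)
  from log_deriv_at_mult[OF assms Suc.IH] show ?case by (simp add: algebra_simps)
qed (simp add: log_deriv_at_const)

lemma log_deriv_at_exp: "log_deriv_at (\<lambda>x. exp (c * x)) c x"
  unfolding log_deriv_at_def by (auto intro!: derivative_eq_intros)

lemma sum_symmetric_pairs:
  fixes f :: "nat \<Rightarrow> nat \<Rightarrow> complex"
  assumes "\<And>j k. f j k = f k j" "\<And>j. f j j = 0"
  shows "(\<Sum>j=1..n. \<Sum>k=1..n. f j k) = 2 * (\<Sum>k=1..n. \<Sum>j=1..<k. f j k)"
proof (induction n)
  case (Suc n)
  have "(\<Sum>j=1..Suc n. \<Sum>k=1..Suc n. f j k)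
      = (\<Sum>j=1..n. \<Sum>k=1..n. f j k) + (\<Sum>j=1..n. f j (Suc n)) + (\<Sum>k=1..n. f (Suc n) k)"
    using assms(2) by (simp add: sum.distrib)
  also have "(\<Sum>k=1..n. f (Suc n) k) = (\<Sum>j=1..n. f j (Suc n))"
    using assms(1) by (intro sum.cong) auto
  also have "{1..n} = {1..<Suc n}" by auto
  finally show ?case using Suc by (simp add: atLeastLessThanSuc_atLeastAtMost)
qed simp

lemma sum_0_3: "(\<Sum>i=0..3::nat. f i) = f 0 + f 1 + f 2 + f 3"
  for f :: "nat \<Rightarrow> 'a :: comm_monoid_add"
  by (simp add: numeral_3_eq_3 numeral_2_eq_2 ac_simps)

lemma sum_1_3: "(\<Sum>i=1..3::nat. f i) = f 1 + f 2 + f 3"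
  for f :: "nat \<Rightarrow> 'a :: comm_monoid_add"
  by (simp add: numeral_3_eq_3 numeral_2_eq_2 ac_simps)

lemma sum_Suc0_3: "(\<Sum>i=Suc 0..3. f i) = f (Suc 0) + f 2 + f 3"
  for f :: "nat \<Rightarrow> 'a :: comm_monoid_add"
  using sum_1_3[of f] by simp

context half_period_basis
begin

text \<open>The addition formula for u = x - p_a and v = p_b - x linearises every product of two
  zeta values, except for the squares of single ones. These squares are multiplied by the total
  weight of the other index, and the weights sum to 0.\<close>

lemma wz_sum_square:
  fixes A :: "'i set" and r p :: "'i \<Rightarrow> complex"
  assumes "finite A" "(\<Sum>a\<in>A. r a) = 0"
    "\<And>a b. a \<in> A \<Longrightarrow> b \<in> A \<Longrightarrow> a \<noteq> b \<Longrightarrow> p a - p b \<notin> Lat" "\<And>a. a \<in> A \<Longrightarrow> x - p a \<notin> Lat"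
  shows "(\<Sum>a\<in>A. r a * wz (x - p a)) ^ 2 =
     (\<Sum>a\<in>A. r a ^ 2 * wp (x - p a))
     + (\<Sum>a\<in>A. 2 * r a * (\<Sum>b\<in>A. r b * wz (p a - p b)) * wz (x - p a))
     + (\<Sum>a\<in>A. \<Sum>b\<in>A. r a * r b * (wz (p a - p b) ^ 2 - wp (p a - p b))) / 2"
proof -
  define Z where "Z a = wz (x - p a)" for a
  define P where "P a = wp (x - p a)" for a
  define W where "W a b = wz (p a - p b)" for a b
  define Q where "Q a b = wz (p a - p b) ^ 2 - wp (p a - p b)" for a b
  have W: "W b a = - W a b" for a b using wz_minus[of "p a - p b"] by (simp add: W_def)
  \<comment> \<open>On the diagonal \<open>W\<close> and \<open>Q\<close> vanish by the values at 0,
    and only the correction \<open>2 * P a\<close> is needed. It is the source of the double poles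
    r_a^2 \<open>wp\<close> in the result.\<close>
  have pair: "2 * (Z a * Z b) = (Z a ^ 2 - P a) + (Z b ^ 2 - P b) + Q a b + 2 * (Z a * W a b) - 2 * (Z b * W a b)
      + (if a = b then 2 * P a else 0)" if "a \<in> A" "b \<in> A" for a b
  proof (cases "a = b")
    case False
    have uv: "x - p a + (p b - x) = - (p a - p b)" by simp
    have "(wz (x - p a) + wz (p b - x) - wz (x - p a + (p b - x))) ^ 2
        = wp (x - p a) + wp (p b - x) + wp (x - p a + (p b - x))"
      by (rule wz_addition)
         (use assms(3,4) that False Lat_diff_commute in \<open>auto simp: Lat_diff_commute[of "p b"]\<close>)
    moreover have "wz (p b - x) = - Z b" "wp (p b - x) = P b"
      using wz_minus[of "x - p b"] wp_minus[of "x - p b"] by (simp_all add: Z_def P_def)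
    ultimately have "(Z a - Z b + W a b) ^ 2 = P a + P b + wp (p a - p b)"
      unfolding uv wz_minus wp_minus by (simp add: Z_def P_def W_def)
    hence "2 * (Z a * Z b) = (Z a ^ 2 - P a) + (Z b ^ 2 - P b) + (W a b ^ 2 - wp (p a - p b))
        + 2 * (Z a * W a b) - 2 * (Z b * W a b)" by algebra
    thus ?thesis using False by (simp add: Q_def W_def)
  qed (simp add: W_def Q_def power2_eq_square)
  have "2 * (\<Sum>a\<in>A. r a * Z a) ^ 2 = (\<Sum>a\<in>A. \<Sum>b\<in>A. r a * r b * (2 * (Z a * Z b)))"
    unfolding power2_eq_square sum_product by (simp add: sum_distrib_left mult_ac)
  also have "\<dots> = (\<Sum>a\<in>A. \<Sum>b\<in>A. r a * (Z a ^ 2 - P a) * r b + r a * (r b * (Z b ^ 2 - P b))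
      + r a * r b * Q a b + 2 * (r a * Z a * (r b * W a b)) + 2 * (r b * Z b * (r a * W b a))
      + (if a = b then 2 * (r a ^ 2 * P a) else 0))"
  proof (intro sum.cong refl)
    fix a b assume "a \<in> A" "b \<in> A"
    from pair[OF this] show "r a * r b * (2 * (Z a * Z b)) = r a * (Z a ^ 2 - P a) * r b + r a * (r b * (Z b ^ 2 - P b))
      + r a * r b * Q a b + 2 * (r a * Z a * (r b * W a b)) + 2 * (r b * Z b * (r a * W b a))
      + (if a = b then 2 * (r a ^ 2 * P a) else 0)"
      by (simp only:) (simp add: W[of b a] algebra_simps power2_eq_square)
  qed
  also have "\<dots> = (\<Sum>a\<in>A. \<Sum>b\<in>A. r a * (Z a ^ 2 - P a) * r b) + (\<Sum>a\<in>A. \<Sum>b\<in>A. r a * (r b * (Z b ^ 2 - P b)))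
      + (\<Sum>a\<in>A. \<Sum>b\<in>A. r a * r b * Q a b) + (\<Sum>a\<in>A. \<Sum>b\<in>A. 2 * (r a * Z a * (r b * W a b)))
      + (\<Sum>a\<in>A. \<Sum>b\<in>A. 2 * (r b * Z b * (r a * W b a)))
      + (\<Sum>a\<in>A. \<Sum>b\<in>A. if a = b then 2 * (r a ^ 2 * P a) else 0)"
    by (simp only: sum.distrib)
  \<comment> \<open>Here and in the next line one index enters only through its weight, and the
    weights sum to 0.\<close>
  also have "(\<Sum>a\<in>A. \<Sum>b\<in>A. r a * (Z a ^ 2 - P a) * r b) = 0"
    by (simp only: sum_distrib_left[symmetric] assms(2)) simp
  also have "(\<Sum>a\<in>A. \<Sum>b\<in>A. r a * (r b * (Z b ^ 2 - P b))) = 0"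
    by (simp only: sum_distrib_left[symmetric] sum_distrib_right[symmetric] assms(2)) simp
  also have "(\<Sum>a\<in>A. \<Sum>b\<in>A. 2 * (r b * Z b * (r a * W b a))) = (\<Sum>a\<in>A. \<Sum>b\<in>A. 2 * (r a * Z a * (r b * W a b)))"
    by (rule sum.swap)
  also have "(\<Sum>a\<in>A. \<Sum>b\<in>A. 2 * (r a * Z a * (r b * W a b))) = (\<Sum>a\<in>A. 2 * r a * (\<Sum>b\<in>A. r b * W a b) * Z a)"
    by (intro sum.cong refl) (simp add: sum_distrib_left sum_distrib_right mult_ac)
  also have "(\<Sum>a\<in>A. \<Sum>b\<in>A. if a = b then 2 * (r a ^ 2 * P a) else 0) = 2 * (\<Sum>a\<in>A. r a ^ 2 * P a)"
    using assms(1) by (simp add: sum_distrib_left)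
  finally have "2 * (\<Sum>a\<in>A. r a * Z a) ^ 2 = 2 * ((\<Sum>a\<in>A. r a ^ 2 * P a)
      + (\<Sum>a\<in>A. 2 * r a * (\<Sum>b\<in>A. r b * W a b) * Z a) + (\<Sum>a\<in>A. \<Sum>b\<in>A. r a * r b * Q a b) / 2)"
    by simp
  thus ?thesis unfolding Z_def P_def W_def Q_def by (subst (asm) mult_cancel_left) simp
qed

section \<open>The Bethe ansatz function and its logarithmic derivative\<close>

lemma cosigma_log_deriv:
  assumes "i \<le> 3" "i \<noteq> 0" "x + hp i \<notin> Lat"
  shows "log_deriv_at (cosigma w1 w3 i) (wz (x + hp i) - wz (hp i)) x"
proof -
  have "log_deriv_at (\<lambda>x. ws (x + hp i)) (wz (x + hp i)) x"
    unfolding log_deriv_at_def using assms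
    by (auto simp: ws_eq_0_iff intro!: DERIV_shift[THEN iffD1] ws_deriv)
  moreover have "ws (hp i) \<noteq> 0" using hp_notin_Lat assms by (simp add: ws_eq_0_iff)
  ultimately have "log_deriv_at (\<lambda>x. exp (- wz (hp i) * x) * ws (x + hp i) / ws (hp i))
      (- wz (hp i) + wz (x + hp i) - 0) x"
    by (intro log_deriv_at_divide log_deriv_at_mult log_deriv_at_exp log_deriv_at_const)
  moreover have "cosigma w1 w3 i = (\<lambda>x. exp (- wz (hp i) * x) * ws (x + hp i) / ws (hp i))"
    by (simp add: cosigma_def half_period_eta_def fun_eq_iff)
  ultimately show ?thesis by (simp add: algebra_simps)
qed

lemma cosigma_holomorphic: "cosigma w1 w3 i holomorphic_on A"
proof -
  have "(\<lambda>x. ws (x + hp i)) holomorphic_on A"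
    using holomorphic_on_compose_gen[of "\<lambda>x. x + hp i" A ws UNIV] ws_holomorphic
    by (simp add: o_def holomorphic_intros)
  hence "(\<lambda>x. exp (- half_period_eta w1 w3 i * x) * ws (x + hp i) / ws (hp i)) holomorphic_on A"
    by (cases "ws (hp i) = 0") (auto intro!: holomorphic_intros)
  thus ?thesis unfolding cosigma_def[abs_def] .
qed

lemma cosigma_nonzero: "i \<le> 3 \<Longrightarrow> i \<noteq> 0 \<Longrightarrow> x + hp i \<notin> Lat \<Longrightarrow> cosigma w1 w3 i x \<noteq> 0"
  using hp_notin_Lat by (simp add: cosigma_def ws_eq_0_iff)

text \<open>
  The zeros \<open>-t\<^sub>j\<close> (left summand) and the poles \<open>-\<omega>\<^sub>i\<close> (right summand) of the Bethe ansatz function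
  are treated as one family, with the residues of the logarithmic derivative as weights.
\<close>

definition bethe_index :: "(nat \<Rightarrow> nat) \<Rightarrow> (nat + nat) set" where
  "bethe_index l = {1..heun_size l} <+> {0..3}"

definition bethe_point :: "(nat \<Rightarrow> complex) \<Rightarrow> nat + nat \<Rightarrow> complex" where
  "bethe_point t = case_sum (\<lambda>j. - t j) (\<lambda>i. - hp i)"

definition bethe_residue :: "(nat \<Rightarrow> nat) \<Rightarrow> nat + nat \<Rightarrow> complex" where
  "bethe_residue l = case_sum (\<lambda>_. 1) (\<lambda>i. - of_nat (l i))"

text \<open>Besides c, the exponential in each co-sigma factor of the denominator contributes its
  \<eta>_i to the logarithmic derivative.\<close>

definition bethe_const :: "(nat \<Rightarrow> nat) \<Rightarrow> complex \<Rightarrow> complex" where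
  "bethe_const l c = c + (\<Sum>i=1..3. of_nat (l i) * wz (hp i))"

definition bethe_phi :: "(nat \<Rightarrow> nat) \<Rightarrow> complex \<Rightarrow> (nat \<Rightarrow> complex) \<Rightarrow> complex \<Rightarrow> complex" where
  "bethe_phi l c t x = bethe_const l c +
     (\<Sum>a\<in>bethe_index l. bethe_residue l a * wz (x - bethe_point t a))"

text \<open>All four classes of half-periods are removed, including those with
  \<open>l i = 0\<close>, so that each term of a sum over \<open>bethe_index\<close> is regular.
  Identities proved here extend to the larger domain of the equation by
  \<open>heun_solutionI\<close>.\<close>

definition bethe_domain :: "(nat \<Rightarrow> nat) \<Rightarrow> (nat \<Rightarrow> complex) \<Rightarrow> complex set" where
  "bethe_domain l t = {x. \<forall>a\<in>bethe_index l. x - bethe_point t a \<notin> Lat}"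

lemma finite_bethe_index [simp]: "finite (bethe_index l)"
  by (simp add: bethe_index_def)

lemma bethe_sum:
  "(\<Sum>a\<in>bethe_index l. f a) = (\<Sum>j=1..heun_size l. f (Inl j)) + (\<Sum>i=0..3. f (Inr i))"
  by (simp add: bethe_index_def sum.Plus)

lemma bethe_domainD:
  assumes "x \<in> bethe_domain l t"
  shows "\<And>j. j \<in> {1..heun_size l} \<Longrightarrow> x + t j \<notin> Lat" "\<And>i. i \<le> 3 \<Longrightarrow> x + hp i \<notin> Lat" "x \<notin> Lat"
  using assms unfolding bethe_domain_def bethe_index_def bethe_point_def
proof -
  show 2: "i \<le> 3 \<Longrightarrow> x + hp i \<notin> Lat" for i
    using assms unfolding bethe_domain_def bethe_index_def bethe_point_def by force
  show "j \<in> {1..heun_size l} \<Longrightarrow> x + t j \<notin> Lat" for j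
    using assms unfolding bethe_domain_def bethe_index_def bethe_point_def by force
  show "x \<notin> Lat" using 2[of 0] by simp
qed

lemma eventually_bethe_domain: "\<forall>\<^sub>F x in at z. x \<in> bethe_domain l t"
  unfolding bethe_domain_def mem_Collect_eq
  by (intro eventually_ball_finite ballI eventually_not_Lat') simp

lemma open_bethe_domain: "open (bethe_domain l t)"
proof -
  have "bethe_domain l t = (\<Inter>a\<in>bethe_index l. (\<lambda>x. x - bethe_point t a) -` (- Lat))"
    by (auto simp: bethe_domain_def)
  thus ?thesis by (auto intro!: open_INT open_vimage open_Compl_Lat continuous_intros)
qed

lemma open_heun_domain: "open (heun_domain w1 w3 l)"
proof -
  have "heun_domain w1 w3 l = (\<Inter>i\<in>{i\<in>{..3}. l i > 0}. (\<lambda>x. x + hp i) -` (- Lat))"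
    by (auto simp: heun_domain_def)
  thus ?thesis by (auto intro!: open_INT open_vimage open_Compl_Lat continuous_intros)
qed

lemma bethe_domain_subset: "bethe_domain l t \<subseteq> heun_domain w1 w3 l"
  using bethe_domainD(2) by (auto simp: heun_domain_def)

lemma heun_potential_analytic:
  assumes "x \<in> heun_domain w1 w3 l" shows "heun_potential w1 w3 l analytic_on {x}"
proof -
  have "(\<lambda>x. of_nat (l i * (l i + 1)) * wp (x + hp i)) analytic_on {x}" if "i \<in> {0..3}" for i
  proof (cases "l i = 0")
    case False
    hence "x + hp i \<notin> Lat" using assms that by (auto simp: heun_domain_def)
    thus ?thesis using wp_shift_analytic[of x "- hp i"] by (intro analytic_intros) simp
  qed simp
  hence "(\<lambda>x. \<Sum>i=0..3. of_nat (l i * (l i + 1)) * wp (x + hp i)) analytic_on {x}"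
    by (intro analytic_on_sum) auto
  thus ?thesis unfolding heun_potential_def[abs_def] .
qed

lemma heun_Lambda_holomorphic: "heun_Lambda w1 w3 l c t holomorphic_on heun_domain w1 w3 l"
proof -
  have "(\<lambda>x. ws (x + t j)) holomorphic_on A" for A j
    using holomorphic_on_compose_gen[of "\<lambda>x. x + t j" A ws UNIV] ws_holomorphic
    by (simp add: o_def holomorphic_intros)
  moreover have "ws x ^ l 0 * (\<Prod>i=1..3. cosigma w1 w3 i x ^ l i) \<noteq> 0" if "x \<in> heun_domain w1 w3 l" for x
  proof -
    have "cosigma w1 w3 i x ^ l i \<noteq> 0" if "i \<in> {1..3}" for i
      using cosigma_nonzero[of i x] \<open>x \<in> heun_domain w1 w3 l\<close> that by (auto simp: heun_domain_def)
    moreover have "ws x ^ l 0 \<noteq> 0" using that by (force simp: heun_domain_def ws_eq_0_iff)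
    ultimately show ?thesis by simp
  qed
  ultimately show ?thesis
    unfolding heun_Lambda_def[abs_def]
    by (intro holomorphic_on_mult holomorphic_on_divide holomorphic_on_prod holomorphic_on_power
        ws_holomorphic cosigma_holomorphic) (auto intro!: holomorphic_intros)
qed

lemma heun_Lambda_log_deriv:
  assumes "x \<in> bethe_domain l t"
  shows "log_deriv_at (heun_Lambda w1 w3 l c t) (bethe_phi l c t x) x"
proof -
  note D = bethe_domainD[OF assms]
  have "log_deriv_at (\<lambda>x. ws (x + t j)) (wz (x + t j)) x" if "j \<in> {1..heun_size l}" for j
    unfolding log_deriv_at_def using D(1)[OF that]
    by (auto simp: ws_eq_0_iff intro!: DERIV_shift[THEN iffD1] ws_deriv)
  moreover have "log_deriv_at ws (wz x) x"
    unfolding log_deriv_at_def using D(3) by (auto simp: ws_eq_0_iff intro!: ws_deriv)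
  moreover have "log_deriv_at (cosigma w1 w3 i) (wz (x + hp i) - wz (hp i)) x" if "i \<in> {1..3}" for i
    using cosigma_log_deriv D(2) that by auto
  ultimately have "log_deriv_at (\<lambda>x. (\<Prod>j=1..heun_size l. ws (x + t j)) /
     (ws x ^ l 0 * (\<Prod>i=1..3. cosigma w1 w3 i x ^ l i)) * exp (c * x))
     ((\<Sum>j=1..heun_size l. wz (x + t j)) - (of_nat (l 0) * wz x +
        (\<Sum>i=1..3. of_nat (l i) * (wz (x + hp i) - wz (hp i)))) + c) x"
    by (intro log_deriv_at_mult log_deriv_at_divide log_deriv_at_prod log_deriv_at_power log_deriv_at_exp) auto
  moreover have "(\<Sum>j=1..heun_size l. wz (x + t j)) - (of_nat (l 0) * wz x +
        (\<Sum>i=1..3. of_nat (l i) * (wz (x + hp i) - wz (hp i)))) + c = bethe_phi l c t x"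
    by (simp add: bethe_phi_def bethe_const_def bethe_sum bethe_point_def bethe_residue_def
        sum_0_3 sum_Suc0_3 algebra_simps)
  ultimately show ?thesis unfolding heun_Lambda_def[abs_def] by simp
qed

lemma bethe_phi_deriv:
  assumes "x \<in> bethe_domain l t"
  shows "(bethe_phi l c t has_field_derivative
           - (\<Sum>a\<in>bethe_index l. bethe_residue l a * wp (x - bethe_point t a))) (at x)"
proof -
  have "((\<lambda>x. wz (x + - bethe_point t a)) has_field_derivative - wp (x + - bethe_point t a)) (at x)"
    if "a \<in> bethe_index l" for a
    by (intro DERIV_shift[THEN iffD1] wz_deriv) (use assms that in \<open>auto simp: bethe_domain_def\<close>)
  hence "((\<lambda>x. bethe_const l c + (\<Sum>a\<in>bethe_index l. bethe_residue l a * wz (x - bethe_point t a)))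
      has_field_derivative 0 + (\<Sum>a\<in>bethe_index l. bethe_residue l a * - wp (x - bethe_point t a))) (at x)"
    by (intro DERIV_add DERIV_const DERIV_sum DERIV_cmult) simp
  thus ?thesis unfolding bethe_phi_def[abs_def] by (simp add: sum_negf)
qed

lemma heun_Lambda_deriv2:
  assumes "x \<in> bethe_domain l t"
  shows "(deriv ^^ 2) (heun_Lambda w1 w3 l c t) x = heun_Lambda w1 w3 l c t x *
     (bethe_phi l c t x ^ 2 - (\<Sum>a\<in>bethe_index l. bethe_residue l a * wp (x - bethe_point t a)))"
proof (rule deriv2_eqI[OF open_bethe_domain assms])
  fix y assume "y \<in> bethe_domain l t"
  thus "(heun_Lambda w1 w3 l c t has_field_derivative heun_Lambda w1 w3 l c t y * bethe_phi l c t y) (at y)"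
    using heun_Lambda_log_deriv by (simp add: log_deriv_at_def)
next
  have "(heun_Lambda w1 w3 l c t has_field_derivative heun_Lambda w1 w3 l c t x * bethe_phi l c t x) (at x)"
    using heun_Lambda_log_deriv[OF assms] by (simp add: log_deriv_at_def)
  from DERIV_mult[OF this bethe_phi_deriv[OF assms]]
  show "((\<lambda>y. heun_Lambda w1 w3 l c t y * bethe_phi l c t y) has_field_derivative heun_Lambda w1 w3 l c t x *
     (bethe_phi l c t x ^ 2 - (\<Sum>a\<in>bethe_index l. bethe_residue l a * wp (x - bethe_point t a)))) (at x)"
    by (rule DERIV_cong) (simp add: algebra_simps power2_eq_square)
qed

text \<open>For holomorphic f the defect of the equation is analytic on the whole domain, so
  punctured neighbourhoods suffice and exceptional isolated points may be skipped.\<close>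

lemma heun_solutionI:
  assumes "f holomorphic_on heun_domain w1 w3 l"
    "\<And>z. \<forall>\<^sub>F x in at z. heun_H w1 w3 l f x - E * f x = 0"
  shows "f \<in> heun_solutions w1 w3 l E (heun_domain w1 w3 l)"
proof -
  have "heun_H w1 w3 l f x - E * f x = 0" if x: "x \<in> heun_domain w1 w3 l" for x
  proof -
    have "(deriv ^^ 2) f analytic_on {x}" "f analytic_on {x}"
      using assms(1) holomorphic_higher_deriv[OF assms(1) open_heun_domain, of 2] open_heun_domain x
      unfolding analytic_at by blast+
    hence "(\<lambda>x. heun_H w1 w3 l f x - E * f x) analytic_on {x}"
      unfolding heun_H_def[abs_def] using heun_potential_analytic[OF x] by (intro analytic_intros) auto
    from analytic_eq_at[OF this _ assms(2)] show ?thesis by simp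
  qed
  thus ?thesis using assms(1) by (simp add: heun_solutions_def)
qed

lemma bethe_residue_sum: "(\<Sum>a\<in>bethe_index l. bethe_residue l a) = 0"
  by (simp add: bethe_sum bethe_residue_def heun_size_def sum_negf)

lemma bethe_points_distinct:
  assumes "heun_admissible w1 w3 l t" "a \<in> bethe_index l" "b \<in> bethe_index l" "a \<noteq> b"
  shows "bethe_point t a - bethe_point t b \<notin> Lat"
proof (cases a; cases b)
  fix j k assume [simp]: "a = Inl j" "b = Inl k"
  have "t k - t j \<notin> Lat" using assms by (auto simp: heun_admissible_def bethe_index_def)
  thus ?thesis by (simp add: bethe_point_def)
next
  fix j i assume [simp]: "a = Inl j" "b = Inr i"
  have "t j - hp i \<notin> Lat" using assms by (auto simp: heun_admissible_def bethe_index_def)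
  thus ?thesis using Lat_diff_commute[of "t j" "hp i"] by (simp add: bethe_point_def)
next
  fix i j assume [simp]: "a = Inr i" "b = Inl j"
  have "t j - hp i \<notin> Lat" using assms by (auto simp: heun_admissible_def bethe_index_def)
  thus ?thesis by (simp add: bethe_point_def)
next
  fix i k assume [simp]: "a = Inr i" "b = Inr k"
  have "hp k - hp i \<notin> Lat" using assms by (intro hp_diff_notin_Lat) (auto simp: bethe_index_def)
  thus ?thesis by (simp add: bethe_point_def)
qed

text \<open>With \<open>bethe_const\<close> added, this is the value at the a-th point of the
  logarithmic derivative stripped of its own pole. The term b = a contributes
  \<open>wz 0 = 0\<close>.\<close>

definition bethe_B :: "(nat \<Rightarrow> nat) \<Rightarrow> (nat \<Rightarrow> complex) \<Rightarrow> nat + nat \<Rightarrow> complex" where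
  "bethe_B l t a = (\<Sum>b\<in>bethe_index l. bethe_residue l b * wz (bethe_point t a - bethe_point t b))"

definition bethe_energy :: "(nat \<Rightarrow> nat) \<Rightarrow> complex \<Rightarrow> (nat \<Rightarrow> complex) \<Rightarrow> complex" where
  "bethe_energy l c t = - (bethe_const l c ^ 2) -
     (\<Sum>a\<in>bethe_index l. \<Sum>b\<in>bethe_index l. bethe_residue l a * bethe_residue l b *
        (wz (bethe_point t a - bethe_point t b) ^ 2 - wp (bethe_point t a - bethe_point t b))) / 2"

text \<open>Divided by the function itself, the second derivative is \<phi>^2 + \<phi>'.
  \<open>wz_sum_square\<close> expands \<phi>^2; its double poles together with those of \<phi>'
  form the potential, leaving simple poles and a constant.\<close>

lemma heun_H_Lambda:
  assumes "heun_admissible w1 w3 l t" "x \<in> bethe_domain l t"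
  shows "heun_H w1 w3 l (heun_Lambda w1 w3 l c t) x - E * heun_Lambda w1 w3 l c t x =
     (bethe_energy l c t - E - (\<Sum>a\<in>bethe_index l.
        2 * bethe_residue l a * (bethe_B l t a + bethe_const l c) * wz (x - bethe_point t a)))
     * heun_Lambda w1 w3 l c t x"
proof -
  define S where "S = (\<Sum>a\<in>bethe_index l. bethe_residue l a * wz (x - bethe_point t a))"
  define k where "k = bethe_const l c"
  define T where "T = (\<Sum>a\<in>bethe_index l. 2 * bethe_residue l a * bethe_B l t a * wz (x - bethe_point t a))"
  have sq: "S ^ 2 = (\<Sum>a\<in>bethe_index l. bethe_residue l a ^ 2 * wp (x - bethe_point t a))
     + T + (- bethe_energy l c t - k ^ 2)"
    unfolding S_def T_def bethe_B_def bethe_energy_def k_def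
    by (subst wz_sum_square)
       (use assms bethe_points_distinct in \<open>auto simp: bethe_residue_sum bethe_domain_def\<close>)
  \<comment> \<open>For a residue r the coefficient is r^2 - r: it is 0 at the zeros, where r = 1,
    and l_i (l_i + 1) at the poles, where r = -l_i.\<close>
  have pot: "heun_potential w1 w3 l x = (\<Sum>a\<in>bethe_index l. bethe_residue l a ^ 2 * wp (x - bethe_point t a))
      - (\<Sum>a\<in>bethe_index l. bethe_residue l a * wp (x - bethe_point t a))"
    by (simp add: heun_potential_def bethe_sum bethe_residue_def bethe_point_def
        sum_subtractf[symmetric] sum.distrib[symmetric] sum_negf power2_eq_square algebra_simps)
  have phi: "bethe_phi l c t x = k + S" by (simp add: bethe_phi_def S_def k_def)
  have "(\<Sum>a\<in>bethe_index l. 2 * bethe_residue l a * (bethe_B l t a + bethe_const l c) * wz (x - bethe_point t a))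
      = T + 2 * k * S"
    by (simp add: T_def S_def k_def sum_distrib_left sum.distrib[symmetric] algebra_simps)
  thus ?thesis
    unfolding heun_H_def heun_Lambda_deriv2[OF assms(2)] pot phi
    using sq by (simp only:) algebra
qed

text \<open>The translates of zeta at points that are distinct modulo periods are linearly
  independent modulo constants, since each has a pole of its own. So all coefficients in the defect
  must vanish, and then its constant term as well.\<close>

lemma heun_Lambda_solution_iff:
  assumes "heun_admissible w1 w3 l t"
  shows "heun_Lambda w1 w3 l c t \<in> heun_solutions w1 w3 l E (heun_domain w1 w3 l) \<longleftrightarrow>
     (\<forall>a\<in>bethe_index l. bethe_residue l a * (bethe_B l t a + bethe_const l c) = 0) \<and> E = bethe_energy l c t"
proof
  assume *: "(\<forall>a\<in>bethe_index l. bethe_residue l a * (bethe_B l t a + bethe_const l c) = 0) \<and> E = bethe_energy l c t"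
  show "heun_Lambda w1 w3 l c t \<in> heun_solutions w1 w3 l E (heun_domain w1 w3 l)"
  proof (rule heun_solutionI[OF heun_Lambda_holomorphic])
    fix z
    show "\<forall>\<^sub>F x in at z. heun_H w1 w3 l (heun_Lambda w1 w3 l c t) x - E * heun_Lambda w1 w3 l c t x = 0"
      using eventually_bethe_domain[where z = z and l = l and t = t]
    proof eventually_elim
      case (elim x)
      have "(\<Sum>a\<in>bethe_index l. 2 * bethe_residue l a * (bethe_B l t a + bethe_const l c) * wz (x - bethe_point t a)) = 0"
        using * by (intro sum.neutral ballI) force
      thus ?case unfolding heun_H_Lambda[OF assms elim] using * by simp
    qed
  qed
next
  assume sol: "heun_Lambda w1 w3 l c t \<in> heun_solutions w1 w3 l E (heun_domain w1 w3 l)"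
  define m where "m a = 2 * bethe_residue l a * (bethe_B l t a + bethe_const l c)" for a
  define K where "K = bethe_energy l c t - E"
  have eq: "(\<Sum>a\<in>bethe_index l. m a * wz (x - bethe_point t a)) = K" if x: "x \<in> bethe_domain l t" for x
  proof -
    have "heun_H w1 w3 l (heun_Lambda w1 w3 l c t) x - E * heun_Lambda w1 w3 l c t x = 0"
      using sol x bethe_domain_subset by (auto simp: heun_solutions_def)
    moreover have "heun_Lambda w1 w3 l c t x \<noteq> 0"
      using heun_Lambda_log_deriv[OF x] by (simp add: log_deriv_at_def)
    ultimately show ?thesis unfolding heun_H_Lambda[OF assms x] by (simp add: K_def m_def)
  qed
  \<comment> \<open>At the a-th point only the a-th term has a pole. Subtracting the principal parts
    of all terms shows that m_a / (x - z) is regular there.\<close>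
  have m0: "m a = 0" if a: "a \<in> bethe_index l" for a
  proof -
    define z where "z = bethe_point t a"
    have z: "z - bethe_point t b \<in> Lat \<longleftrightarrow> b = a" if "b \<in> bethe_index l" for b
      using bethe_points_distinct[OF assms a that] by (auto simp: z_def)
    have "ord_ge (\<lambda>x. \<Sum>b\<in>bethe_index l. m b * (wz (x - bethe_point t b)
        - of_bool (z - bethe_point t b \<in> Lat) / (x - z))) z 0"
      by (intro ord_ge_sum ord_ge_cmult wz_simple_pole)
    moreover have "\<forall>\<^sub>F x in at z. K - m a / (x - z) = (\<Sum>b\<in>bethe_index l. m b * (wz (x - bethe_point t b)
        - of_bool (z - bethe_point t b \<in> Lat) / (x - z)))"
      using eventually_bethe_domain[where z = z and l = l and t = t]
    proof eventually_elim
      case (elim x)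
      have "(\<Sum>b\<in>bethe_index l. m b * (of_bool (z - bethe_point t b \<in> Lat) / (x - z)))
          = (\<Sum>b\<in>bethe_index l. if b = a then m a / (x - z) else 0)"
        using z by (intro sum.cong) auto
      also have "\<dots> = m a / (x - z)" using a by simp
      finally show ?case using eq[OF elim] by (simp add: right_diff_distrib sum_subtractf)
    qed
    ultimately have "ord_ge (\<lambda>x. K - m a / (x - z)) z 0" by (rule ord_ge_cong)
    from ord_ge_diff[OF ord_ge_const[of 0 K z] this] have "ord_ge (\<lambda>x. m a / (x - z)) z 0" by simp
    moreover have "local_form (\<lambda>x. m a / (x - z)) z (- 1) (\<lambda>_. m a)"
      by (simp add: local_form_def power_int_minus divide_inverse mult.commute)
    ultimately show "m a = 0" using local_form_order_unique by fastforce
  qed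
  obtain x where "x \<in> bethe_domain l t"
    using eventually_happens[OF eventually_bethe_domain[where z = 0 and l = l and t = t]] by auto
  from eq[OF this] m0 have "K = 0" by simp
  with m0 show "(\<forall>a\<in>bethe_index l. bethe_residue l a * (bethe_B l t a + bethe_const l c) = 0) \<and> E = bethe_energy l c t"
    by (auto simp: m_def K_def)
qed

section \<open>Explicit form of the Bethe equations and of the eigenvalue\<close>

lemma wz_hp_diff': "i \<le> 3 \<Longrightarrow> k \<le> 3 \<Longrightarrow> wz (hp i - hp k) = wz (hp i) - wz (hp k)"
  using wz_hp_diff[of i k] by (cases "i = k") auto

lemma bethe_condition_zero:
  assumes "j \<in> {1..heun_size l}"
  shows "bethe_residue l (Inl j) * (bethe_B l t (Inl j) + bethe_const l c) = 0 \<longleftrightarrow>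
     (\<Sum>k\<in>{1..heun_size l} - {j}. wz (- t j + t k)) - of_nat (l 0) * wz (- t j)
              - (\<Sum>i=1..3. of_nat (l i) * (wz (- t j + hp i) - wz (hp i))) = - c"
proof -
  have "(\<Sum>k=1..heun_size l. wz (- t j + t k)) = (\<Sum>k\<in>{1..heun_size l} - {j}. wz (- t j + t k))"
    using assms by (subst sum.remove[of _ j]) auto
  hence "bethe_residue l (Inl j) * (bethe_B l t (Inl j) + bethe_const l c) =
     (\<Sum>k\<in>{1..heun_size l} - {j}. wz (- t j + t k)) - of_nat (l 0) * wz (- t j)
              - (\<Sum>i=1..3. of_nat (l i) * (wz (- t j + hp i) - wz (hp i))) + c"
    by (simp add: bethe_B_def bethe_sum bethe_residue_def bethe_point_def bethe_const_def
        sum_0_3 sum_Suc0_3 algebra_simps)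
  thus ?thesis by (simp only: eq_neg_iff_add_eq_0)
qed

text \<open>Zeta splits on differences of half-periods, so the contribution of the other poles
  collapses to the \<eta>-part of \<open>bethe_const\<close> and the total weight times
  \<eta>_i.\<close>

lemma bethe_condition_pole:
  assumes "i \<le> 3"
  shows "bethe_residue l (Inr i) * (bethe_B l t (Inr i) + bethe_const l c) =
     - of_nat (l i) * (c + of_nat (heun_size l) * wz (hp i) + (\<Sum>j=1..heun_size l. wz (- hp i + t j)))"
proof -
  have "(\<Sum>k=0..3. of_nat (l k) * wz (- hp i - - hp k)) = (\<Sum>k=0..3. of_nat (l k) * (wz (hp k) - wz (hp i)))"
    by (intro sum.cong refl) (use wz_hp_diff'[of _ i] assms in simp)
  hence "bethe_B l t (Inr i) = (\<Sum>j=1..heun_size l. wz (- hp i + t j))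
      - (\<Sum>k=0..3. of_nat (l k) * (wz (hp k) - wz (hp i)))"
    by (simp add: bethe_B_def bethe_sum bethe_residue_def bethe_point_def sum_negf)
  also have "\<dots> = (\<Sum>j=1..heun_size l. wz (- hp i + t j)) - (bethe_const l c - c) + of_nat (heun_size l) * wz (hp i)"
    unfolding bethe_const_def heun_size_def sum_0_3 sum_1_3 of_nat_add by (simp add: algebra_simps)
  finally show ?thesis by (simp add: bethe_residue_def algebra_simps)
qed

lemma bethe_conditions:
  "(\<forall>a\<in>bethe_index l. bethe_residue l a * (bethe_B l t a + bethe_const l c) = 0) \<longleftrightarrow>
     (\<forall>j\<in>{1..heun_size l}. (\<Sum>k\<in>{1..heun_size l} - {j}. wz (- t j + t k)) - of_nat (l 0) * wz (- t j)
              - (\<Sum>i=1..3. of_nat (l i) * (wz (- t j + hp i) - wz (hp i))) = - c) \<and>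
     (1 - of_bool (l 0 = 0)) * (c + (\<Sum>j=1..heun_size l. wz (t j))) = 0 \<and>
     (\<forall>i\<in>{1..3}. (1 - of_bool (l i = 0)) *
        (c + of_nat (heun_size l) * wz (hp i) + (\<Sum>j=1..heun_size l. wz (- hp i + t j))) = 0)"
proof -
  define P where "P a \<longleftrightarrow> bethe_residue l a * (bethe_B l t a + bethe_const l c) = 0" for a
  have "(\<forall>a\<in>bethe_index l. P a) \<longleftrightarrow> (\<forall>j\<in>{1..heun_size l}. P (Inl j)) \<and> P (Inr 0) \<and> (\<forall>i\<in>{1..3}. P (Inr i))"
  proof -
    have "{0..3::nat} = insert 0 {1..3}" by auto
    thus ?thesis by (auto simp: bethe_index_def Plus_def)
  qed
  moreover have "P (Inl j) \<longleftrightarrow> (\<Sum>k\<in>{1..heun_size l} - {j}. wz (- t j + t k)) - of_nat (l 0) * wz (- t j)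
              - (\<Sum>i=1..3. of_nat (l i) * (wz (- t j + hp i) - wz (hp i))) = - c" if "j \<in> {1..heun_size l}" for j
    unfolding P_def by (rule bethe_condition_zero[OF that])
  moreover have pole: "P (Inr i) \<longleftrightarrow> (1 - of_bool (l i = 0)) *
        (c + of_nat (heun_size l) * wz (hp i) + (\<Sum>j=1..heun_size l. wz (- hp i + t j))) = 0" if "i \<le> 3" for i
    unfolding P_def bethe_condition_pole[OF that] by simp
  moreover have "P (Inr 0) \<longleftrightarrow> (1 - of_bool (l 0 = 0)) * (c + (\<Sum>j=1..heun_size l. wz (t j))) = 0"
    using pole[of 0] by simp
  ultimately show ?thesis unfolding P_def[symmetric] by simp
qed

text \<open>The three nonzero half-periods sum to 0, so the difference of two of them is congruent
  to the third, up to sign.\<close>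

lemma wp_hp_diff:
  "wp (w1 + (w1 + w3)) = half_period_e w1 w3 3" "wp (w1 - w3) = half_period_e w1 w3 2"
  "wp (w1 + w3 + w3) = half_period_e w1 w3 1"
proof -
  have "wp (w3 + 2 * w1) = wp w3" by (rule wp_periodic) auto
  thus "wp (w1 + (w1 + w3)) = half_period_e w1 w3 3"
    by (simp add: half_period_e_def algebra_simps mult_2)
  have "- (w1 + w3) \<notin> Lat" using hp_notin_Lat[of 2] by simp
  from wp_periodic[OF Lat_2w1 this] show "wp (w1 - w3) = half_period_e w1 w3 2"
    by (simp add: half_period_e_def algebra_simps mult_2)
  have "wp (w1 + 2 * w3) = wp w1" by (rule wp_periodic) auto
  thus "wp (w1 + w3 + w3) = half_period_e w1 w3 1"
    by (simp add: half_period_e_def algebra_simps mult_2)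
qed

text \<open>The double sum is split into blocks of zeros and poles. In the block of pole pairs the
  mixed products \<eta>_i \<eta>_k cancel against those in the square of \<open>bethe_const\<close>,
  which leaves only the terms l_i \<eta>_i (2 c + l \<eta>_i).\<close>

lemma bethe_energy_eq:
  fixes l :: "nat \<Rightarrow> nat"
  defines "e \<equiv> half_period_e w1 w3" and "\<eta> \<equiv> half_period_eta w1 w3" and "L \<equiv> heun_size l"
  shows "bethe_energy l c t = - (c ^ 2)
             + of_nat (l 0 * l 1 + l 2 * l 3) * e 1
             + of_nat (l 0 * l 2 + l 1 * l 3) * e 2
             + of_nat (l 0 * l 3 + l 1 * l 2) * e 3
             - (\<Sum>i=1..3. of_nat (l i) * \<eta> i * (2 * c + of_nat L * \<eta> i))
             - (\<Sum>j=1..L. \<Sum>i=0..3. of_nat (l i) * (wp (t j - hp i) - wz (t j - hp i) ^ 2))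
             + (\<Sum>k=1..L. \<Sum>j=1..<k. wp (t j - t k) - wz (t j - t k) ^ 2)"
proof -
  define g where "g x = wz x ^ 2 - wp x" for x
  have g_minus: "g (- x) = g x" for x by (simp add: g_def)
  have g_diff: "g (- x + y) = g (x - y)" "g (- x - - y) = g (x - y)" "g (y - x) = g (x - y)" for x y
    using g_minus[of "x - y"] by simp_all
  have g0: "g 0 = 0" by (simp add: g_def)
  have eta: "\<eta> i = wz (hp i)" for i by (simp add: \<eta>_def half_period_eta_def)
  have tt: "(\<Sum>j=1..L. \<Sum>k=1..L. g (- t j - - t k)) = 2 * (\<Sum>k=1..L. \<Sum>j=1..<k. g (t j - t k))"
    unfolding g_diff(2) by (rule sum_symmetric_pairs) (auto simp: g_diff(3) g0)
  \<comment> \<open>Each e_i is met by two pairs: the pair of 0 and i, and the pair of the two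
    remaining indices, whose difference is congruent to the half-period i.\<close>
  have hh: "(\<Sum>i=0..3. \<Sum>k=0..3. of_nat (l i) * of_nat (l k) * g (- hp i - - hp k)) =
      2 * ((\<Sum>i=1..3. of_nat (l i) * \<eta> i ^ 2 * (of_nat L - of_nat (l i)))
        - 2 * (of_nat (l 1 * l 2) * \<eta> 1 * \<eta> 2 + of_nat (l 1 * l 3) * \<eta> 1 * \<eta> 3 + of_nat (l 2 * l 3) * \<eta> 2 * \<eta> 3)
        - (of_nat (l 0 * l 1 + l 2 * l 3) * e 1 + of_nat (l 0 * l 2 + l 1 * l 3) * e 2
             + of_nat (l 0 * l 3 + l 1 * l 2) * e 3))"
  proof -
    have gh: "g (hp i - hp k) = (\<eta> i - \<eta> k) ^ 2 - wp (hp i - hp k)" if "i \<le> 3" "k \<le> 3" for i k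
      using wz_hp_diff'[OF that] by (simp add: g_def eta)
    have e0: "\<eta> 0 = 0" by (simp add: eta)
    have w0: "wp (hp 0 - hp i) = e i" for i
      by (simp only: hp_simps(1) diff_0 wp_minus e_def half_period_e_def)
    have "hp 1 - hp 2 = w1 + (w1 + w3)" "hp 1 - hp 3 = w1 - w3" "hp 2 - hp 3 = - (w1 + w3 + w3)"
      by simp_all
    hence w: "wp (hp 1 - hp 2) = e 3" "wp (hp 1 - hp 3) = e 2" "wp (hp 2 - hp 3) = e 1"
      by (simp_all only: wp_minus wp_hp_diff e_def)
    have gs: "g (hp 0 - hp 1) = \<eta> 1 ^ 2 - e 1" "g (hp 0 - hp 2) = \<eta> 2 ^ 2 - e 2" "g (hp 0 - hp 3) = \<eta> 3 ^ 2 - e 3"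
      "g (hp 1 - hp 2) = (\<eta> 1 - \<eta> 2) ^ 2 - e 3" "g (hp 1 - hp 3) = (\<eta> 1 - \<eta> 3) ^ 2 - e 2"
      "g (hp 2 - hp 3) = (\<eta> 2 - \<eta> 3) ^ 2 - e 1"
      by (subst gh; simp add: w0 w w[unfolded One_nat_def] e0 del: hp_simps)+
    have gs': "g (hp 1 - hp 0) = g (hp 0 - hp 1)" "g (hp 2 - hp 0) = g (hp 0 - hp 2)" "g (hp 3 - hp 0) = g (hp 0 - hp 3)"
      "g (hp 2 - hp 1) = g (hp 1 - hp 2)" "g (hp 3 - hp 1) = g (hp 1 - hp 3)" "g (hp 3 - hp 2) = g (hp 2 - hp 3)"
      by (rule g_diff(3))+
    show ?thesis
      unfolding sum_0_3 sum_1_3 g_diff(2) gs' gs L_def heun_size_def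
      by (simp add: g0 del: hp_simps) algebra
  qed
  have th: "(\<Sum>j=1..L. \<Sum>i=0..3. - of_nat (l i) * g (- t j - - hp i)) = - (\<Sum>j=1..L. \<Sum>i=0..3. of_nat (l i) * g (t j - hp i))"
    unfolding g_diff(2) by (simp add: sum_negf)
  have ht: "(\<Sum>i=0..3. \<Sum>j=1..L. - of_nat (l i) * g (- hp i - - t j)) = - (\<Sum>j=1..L. \<Sum>i=0..3. of_nat (l i) * g (t j - hp i))"
    unfolding g_diff(2) by (subst sum.swap) (simp add: sum_negf g_diff(3)[of "hp _"])
  have "(\<Sum>a\<in>bethe_index l. \<Sum>b\<in>bethe_index l. bethe_residue l a * bethe_residue l b *
        (wz (bethe_point t a - bethe_point t b) ^ 2 - wp (bethe_point t a - bethe_point t b)))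
      = (\<Sum>j=1..L. \<Sum>k=1..L. g (- t j - - t k))
      + (\<Sum>j=1..L. \<Sum>i=0..3. - of_nat (l i) * g (- t j - - hp i))
      + (\<Sum>i=0..3. \<Sum>j=1..L. - of_nat (l i) * g (- hp i - - t j))
      + (\<Sum>i=0..3. \<Sum>k=0..3. of_nat (l i) * of_nat (l k) * g (- hp i - - hp k))"
    unfolding g_def[symmetric]
    by (simp only: bethe_sum sum.distrib L_def) (simp add: bethe_residue_def bethe_point_def)
  hence "bethe_energy l c t = - (bethe_const l c ^ 2) - (\<Sum>k=1..L. \<Sum>j=1..<k. g (t j - t k))
     + (\<Sum>j=1..L. \<Sum>i=0..3. of_nat (l i) * g (t j - hp i))
     - ((\<Sum>i=1..3. of_nat (l i) * \<eta> i ^ 2 * (of_nat L - of_nat (l i)))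
        - 2 * (of_nat (l 1 * l 2) * \<eta> 1 * \<eta> 2 + of_nat (l 1 * l 3) * \<eta> 1 * \<eta> 3 + of_nat (l 2 * l 3) * \<eta> 2 * \<eta> 3)
        - (of_nat (l 0 * l 1 + l 2 * l 3) * e 1 + of_nat (l 0 * l 2 + l 1 * l 3) * e 2
             + of_nat (l 0 * l 3 + l 1 * l 2) * e 3))"
    unfolding tt th ht hh bethe_energy_def by (simp add: field_simps)
  also have "(\<Sum>k=1..L. \<Sum>j=1..<k. g (t j - t k)) = - (\<Sum>k=1..L. \<Sum>j=1..<k. wp (t j - t k) - wz (t j - t k) ^ 2)"
    by (simp add: g_def sum_negf[symmetric])
  also have "(\<Sum>j=1..L. \<Sum>i=0..3. of_nat (l i) * g (t j - hp i))
      = - (\<Sum>j=1..L. \<Sum>i=0..3. of_nat (l i) * (wp (t j - hp i) - wz (t j - hp i) ^ 2))"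
    by (simp add: g_def sum_negf[symmetric] algebra_simps)
  also have "bethe_const l c = c + (of_nat (l 1) * \<eta> 1 + of_nat (l 2) * \<eta> 2 + of_nat (l 3) * \<eta> 3)"
    unfolding bethe_const_def sum_1_3 eta ..
  finally show ?thesis unfolding sum_1_3 of_nat_add of_nat_mult by algebra
qed

end


section \<open>Elliptic functions on the domain of the equation\<close>


locale heun = half_period_basis +
  fixes l :: "nat \<Rightarrow> nat"
begin

abbreviation D where "D \<equiv> heun_domain w1 w3 l"
abbreviation V where "V \<equiv> heun_potential w1 w3 l"

section \<open>The domain of the equation and elliptic functions of given parity\<close>

lemma D_add_Lat: "p \<in> Lat \<Longrightarrow> x + p \<in> D \<longleftrightarrow> x \<in> D"
proof -
  assume p: "p \<in> Lat"
  have "x + p + hp i = x + hp i + p" for i by simp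
  hence "x + p + hp i \<in> Lat \<longleftrightarrow> x + hp i \<in> Lat" for i
    by (simp only: Lat_add_cancel[OF p])
  thus ?thesis by (simp add: heun_domain_def)
qed

lemma D_minus: "- x \<in> D \<longleftrightarrow> x \<in> D"
proof -
  have "- x + hp i \<in> Lat \<longleftrightarrow> x + hp i \<in> Lat" for i
    using Lat_diff_cancel[OF two_hp_Lat[of i], of "x + hp i"] Lat_minus_iff[of "x - hp i"]
    by (simp add: algebra_simps)
  thus ?thesis by (simp add: heun_domain_def)
qed

lemma D_I: "x \<in> D \<Longrightarrow> i \<le> 3 \<Longrightarrow> l i > 0 \<Longrightarrow> x + hp i \<notin> Lat"
  by (simp add: heun_domain_def)

lemma not_D: "x \<notin> D \<Longrightarrow> \<exists>i\<le>3. l i > 0 \<and> x + hp i \<in> Lat"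
  by (auto simp: heun_domain_def)

lemma countable_Compl_D: "countable (- D)"
proof -
  have "- D \<subseteq> (\<Union>i\<in>{..3}. (\<lambda>w. w - hp i) ` Lat)"
  proof
    fix x assume "x \<in> - D"
    then obtain i where "i \<le> 3" "x + hp i \<in> Lat" using not_D by blast
    thus "x \<in> (\<Union>i\<in>{..3}. (\<lambda>w. w - hp i) ` Lat)"
      by (auto intro!: bexI[of _ i] image_eqI[of _ _ "x + hp i"])
  qed
  thus ?thesis by (rule countable_subset) (simp add: countable_Lat)
qed

lemma connected_D: "connected D"
  using path_connected_complement_countable[OF _ countable_Compl_D]
  by (simp add: path_connected_imp_connected)

lemma eventually_D: "\<forall>\<^sub>F x in at z. x \<in> D"
proof -
  have "\<forall>\<^sub>F x in at z. \<forall>i\<in>{..3}. x + hp i \<notin> Lat"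
    by (intro eventually_ball_finite ballI eventually_not_Lat) simp
  thus ?thesis by eventually_elim (auto simp: heun_domain_def)
qed

lemma constant_on_D:
  assumes "\<And>x. x \<in> D \<Longrightarrow> (f has_field_derivative 0) (at x)" "x \<in> D" "y \<in> D"
  shows "f x = f y"
  using has_field_derivative_0_imp_constant_on[of D f] assms open_heun_domain connected_D
  unfolding constant_on_def by fastforce

lemma D_nonempty: obtains x where "x \<in> D"
  using eventually_happens[OF eventually_D[of 0]] by auto

text \<open>Elliptic functions of parity \<epsilon> with poles outside D only. The last clause
  excludes essential singularities; it is stated at one representative of each class and spreads by
  periodicity.\<close>

definition ell :: "complex \<Rightarrow> (complex \<Rightarrow> complex) \<Rightarrow> bool" where
  "ell \<epsilon> F \<longleftrightarrow> F holomorphic_on D \<and> (\<forall>x\<in>D. F (- x) = \<epsilon> * F x) \<and>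
     (\<forall>x\<in>D. \<forall>p\<in>Lat. F (x + p) = F x) \<and> (\<forall>i\<le>3. l i > 0 \<longrightarrow> (\<exists>N. ord_ge F (- hp i) N))"

lemma ellD:
  assumes "ell \<epsilon> F"
  shows "F holomorphic_on D" "\<And>x. x \<in> D \<Longrightarrow> F (- x) = \<epsilon> * F x"
    "\<And>x p. x \<in> D \<Longrightarrow> p \<in> Lat \<Longrightarrow> F (x + p) = F x"
    "\<And>i. i \<le> 3 \<Longrightarrow> l i > 0 \<Longrightarrow> \<exists>N. ord_ge F (- hp i) N"
  using assms by (auto simp: ell_def)

lemma holomorphic_D_analytic: "F holomorphic_on D \<Longrightarrow> x \<in> D \<Longrightarrow> F analytic_on {x}"
  using open_heun_domain by (auto simp: analytic_at)

lemma ell_analytic: "ell \<epsilon> F \<Longrightarrow> x \<in> D \<Longrightarrow> F analytic_on {x}"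
  using ellD(1) holomorphic_D_analytic by blast

lemma ell_const: "ell 1 (\<lambda>_. c)"
  unfolding ell_def using ord_ge_const[of 0] by auto

lemma ell_mult:
  assumes "ell a F" "ell b G" shows "ell (a * b) (\<lambda>x. F x * G x)"
  unfolding ell_def
proof (intro conjI ballI allI impI)
  fix i assume "i \<le> 3" "0 < l i"
  thus "\<exists>N. ord_ge (\<lambda>x. F x * G x) (- hp i) N"
    using ellD(4)[OF assms(1)] ellD(4)[OF assms(2)] ord_ge_mult by blast
qed (use ellD[OF assms(1)] ellD[OF assms(2)] in \<open>auto intro!: holomorphic_intros simp: mult_ac\<close>)

lemma ell_add:
  assumes "ell a F" "ell a G" shows "ell a (\<lambda>x. F x + G x)"
  unfolding ell_def
proof (intro conjI ballI allI impI)
  fix i assume i: "i \<le> 3" "0 < l i"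
  obtain N M where "ord_ge F (- hp i) N" "ord_ge G (- hp i) M"
    using ellD(4)[OF assms(1) i] ellD(4)[OF assms(2) i] by blast
  hence "ord_ge F (- hp i) (min N M)" "ord_ge G (- hp i) (min N M)"
    using ord_ge_mono by (meson min.cobounded1 min.cobounded2)+
  thus "\<exists>N. ord_ge (\<lambda>x. F x + G x) (- hp i) N" using ord_ge_add by blast
qed (use ellD[OF assms(1)] ellD[OF assms(2)] in \<open>auto intro!: holomorphic_intros simp: distrib_left\<close>)

lemma ell_cmult: "ell a F \<Longrightarrow> ell a (\<lambda>x. c * F x)"
  using ell_mult[OF ell_const[of c]] by simp

lemma ell_diff: "ell a F \<Longrightarrow> ell a G \<Longrightarrow> ell a (\<lambda>x. F x - G x)"
  using ell_add[of a F "\<lambda>x. - 1 * G x"] ell_cmult[of a G "- 1"] by simp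

lemma ell_sum: "finite I \<Longrightarrow> (\<And>i. i \<in> I \<Longrightarrow> ell 1 (F i)) \<Longrightarrow> ell 1 (\<lambda>x. \<Sum>i\<in>I. F i x)"
  by (induction I rule: finite_induct) (auto intro!: ell_add ell_const)

lemma ell_power: "ell 1 F \<Longrightarrow> ell 1 (\<lambda>x. F x ^ n)"
proof (induction n)
  case (Suc n)
  from ell_mult[OF Suc.prems Suc.IH[OF Suc.prems]] show ?case by simp
qed (use ell_const[of 1] in simp)

lemma ell_deriv:
  assumes "ell a F" shows "ell (- a) (deriv F)"
  unfolding ell_def
proof (intro conjI ballI allI impI)
  show "deriv F holomorphic_on D" using holomorphic_deriv[OF ellD(1)[OF assms] open_heun_domain] .
next
  fix x assume x: "x \<in> D"
  have d: "(F has_field_derivative deriv F y) (at y)" if "y \<in> D" for y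
    using holomorphic_derivI[OF ellD(1)[OF assms] open_heun_domain that] .
  have "((\<lambda>y. F (- y)) has_field_derivative deriv F (- x) * - 1) (at x)"
    by (rule DERIV_chain2[of F]) (use d[of "- x"] x D_minus in \<open>auto intro!: derivative_eq_intros\<close>)
  moreover have "((\<lambda>y. F (- y)) has_field_derivative a * deriv F x) (at x)"
    by (rule has_field_derivative_transform_within_open[OF DERIV_cmult[OF d[OF x]] open_heun_domain x])
       (use ellD(2)[OF assms] in auto)
  ultimately show "deriv F (- x) = - a * deriv F x" using DERIV_unique by fastforce
next
  fix x p assume x: "x \<in> D" and p: "p \<in> Lat"
  have d: "(F has_field_derivative deriv F y) (at y)" if "y \<in> D" for y
    using holomorphic_derivI[OF ellD(1)[OF assms] open_heun_domain that] .
  have "((\<lambda>y. F (y + p)) has_field_derivative deriv F (x + p)) (at x)"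
    by (intro DERIV_shift[THEN iffD1] d) (use x p D_add_Lat in auto)
  moreover have "((\<lambda>y. F (y + p)) has_field_derivative deriv F x) (at x)"
    by (rule has_field_derivative_transform_within_open[OF d[OF x] open_heun_domain x])
       (use ellD(3)[OF assms] p in auto)
  ultimately show "deriv F (x + p) = deriv F x" using DERIV_unique by blast
next
  fix i assume "i \<le> 3" "0 < l i"
  thus "\<exists>N. ord_ge (deriv F) (- hp i) N" using ellD(4)[OF assms] ord_ge_deriv by blast
qed

lemma wp_shift_even: "x + hp i \<notin> Lat \<Longrightarrow> wp (- x + hp i) = wp (x + hp i)"
proof -
  assume x: "x + hp i \<notin> Lat"
  have "wp (- x + hp i) = wp (x - hp i)" using wp_minus[of "x - hp i"] by simp
  also have "\<dots> = wp (x - hp i + 2 * hp i)"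
    by (rule wp_periodic[symmetric])
       (use x Lat_diff_cancel[OF two_hp_Lat[of i], of "x + hp i"] in \<open>auto simp: algebra_simps\<close>)
  finally show ?thesis by (simp add: algebra_simps)
qed

lemma ell_wp:
  assumes "i \<le> 3" "l i > 0" shows "ell 1 (\<lambda>x. wp (x + hp i))"
  unfolding ell_def
proof (intro conjI ballI allI impI)
  have "(\<lambda>x. wp (x + hp i)) analytic_on {x}" if "x \<in> D" for x
    using wp_shift_analytic[of x "- hp i"] D_I[OF that assms] by simp
  thus "(\<lambda>x. wp (x + hp i)) holomorphic_on D"
    by (metis analytic_imp_holomorphic analytic_on_analytic_at)
  show "wp (- x + hp i) = 1 * wp (x + hp i)" if "x \<in> D" for x
    using wp_shift_even[OF D_I[OF that assms]] by simp
  show "wp (x + p + hp i) = wp (x + hp i)" if "x \<in> D" "p \<in> Lat" for x p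
    using wp_periodic[OF that(2) D_I[OF that(1) assms]] by (simp add: algebra_simps)
next
  fix k assume k: "k \<le> 3" "0 < l k"
  show "\<exists>N. ord_ge (\<lambda>x. wp (x + hp i)) (- hp k) N"
  proof (cases "- hp k + hp i \<in> Lat")
    case True
    hence "- hp k - (- hp i) \<in> Lat" by simp
    then obtain F where "local_form (\<lambda>x. wp (x - - hp i)) (- hp k) (- 2) F"
      by (rule wp_local_form)
    thus ?thesis by (auto simp: ord_ge_def)
  next
    case False
    have "(\<lambda>x. wp (x + hp i)) analytic_on {- hp k}"
      using wp_shift_analytic[of "- hp k" "- hp i"] False by simp
    thus ?thesis using ord_ge_analytic by blast
  qed
qed

lemma wp_pole_form:
  obtains F where "local_form (\<lambda>x. wp (x + hp i)) (- hp i) (- 2) F" "F (- hp i) = 1"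
proof -
  have "- hp i - - hp i \<in> Lat" by simp
  then obtain F where F: "local_form (\<lambda>x. wp (x - - hp i)) (- hp i) (- 2) F" "F (- hp i) = 1"
    by (rule wp_local_form)
  show ?thesis by (rule that[of F]) (use F in simp_all)
qed

lemma wp_regular:
  assumes "i \<le> 3" "k \<le> 3" "i \<noteq> k" shows "(\<lambda>x. wp (x + hp i)) analytic_on {- hp k}"
  using wp_shift_analytic[of "- hp k" "- hp i"] hp_diff_notin_Lat[OF assms] by simp

lemma ell_V: "ell 1 V"
proof -
  have "ell 1 (\<lambda>x. of_nat (l i * (l i + 1)) * wp (x + hp i))" if "i \<in> {0..3}" for i
  proof (cases "l i = 0")
    case True
    thus ?thesis using ell_const[of 0] by simp
  next
    case False
    thus ?thesis using that by (intro ell_cmult ell_wp) auto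
  qed
  hence "ell 1 (\<lambda>x. \<Sum>i=0..3. of_nat (l i * (l i + 1)) * wp (x + hp i))" by (intro ell_sum) auto
  thus ?thesis unfolding heun_potential_def[abs_def] .
qed

lemma V_local_form:
  assumes "i \<le> 3"
  obtains v where "local_form V (- hp i) (- 2) v" "v (- hp i) = of_nat (l i * (l i + 1))"
proof -
  obtain F where F: "local_form (\<lambda>x. wp (x + hp i)) (- hp i) (- 2) F" "F (- hp i) = 1"
    by (rule wp_pole_form)
  define G where "G = (\<lambda>x. \<Sum>k\<in>{0..3} - {i}. of_nat (l k * (l k + 1)) * wp (x + hp k))"
  have G: "G analytic_on {- hp i}"
    unfolding G_def using wp_regular assms by (intro analytic_on_sum analytic_intros) auto
  define v where "v = (\<lambda>x. of_nat (l i * (l i + 1)) * F x + (x - (- hp i)) ^ 2 * G x)"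
  have "\<forall>\<^sub>F x in at (- hp i). V x = (x - (- hp i)) powi (- 2) * v x"
    using local_formD(2)[OF F(1)] eventually_at_neq
  proof eventually_elim
    case (elim x)
    have "V x = of_nat (l i * (l i + 1)) * wp (x + hp i) + G x"
      unfolding heun_potential_def G_def using assms by (subst sum.remove[of _ i]) auto
    also have "G x = (x - (- hp i)) powi (- 2) * ((x - (- hp i)) ^ 2 * G x)"
      using elim(2) by (simp add: power_int_minus eq_neg_iff_add_eq_0)
    finally show ?case unfolding elim(1) v_def by (simp add: algebra_simps)
  qed
  moreover have "v analytic_on {- hp i}"
    unfolding v_def using local_formD(1)[OF F(1)] G by (intro analytic_intros) auto
  ultimately show ?thesis using that[of v] F(2) by (simp add: local_form_def v_def)
qed

text \<open>Reflection about a half-period differs from x \<mapsto> -x by a period. Hence parity at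
  0 is parity at every half-period, and orders there are even for even functions and odd for odd
  ones.\<close>

lemma ell_reflect:
  assumes "ell \<epsilon> F" shows "\<forall>\<^sub>F s in at (- hp i). F (2 * (- hp i) - s) = \<epsilon> * F s"
  using eventually_D
proof eventually_elim
  case (elim s)
  have "F (2 * (- hp i) - s) = F (- s + (- (2 * hp i)))" by (rule arg_cong[of _ _ F]) simp
  also have "\<dots> = F (- s)" using elim D_minus by (intro ellD(3)[OF assms]) (auto simp del: mult_minus_right)
  also have "\<dots> = \<epsilon> * F s" by (rule ellD(2)[OF assms elim])
  finally show ?case .
qed

lemma even_ell_improve:
  assumes "ell 1 F" "ord_ge F (- hp i) N" "odd N" shows "ord_ge F (- hp i) (N + 1)"
  using ord_ge_parity_improve[OF assms(2) ell_reflect[OF assms(1)]] assms(3) by simp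

lemma odd_ell_improve:
  assumes "ell (- 1) F" "ord_ge F (- hp i) N" "even N" shows "ord_ge F (- hp i) (N + 1)"
  using ord_ge_parity_improve[OF assms(2) ell_reflect[OF assms(1)]] assms(3) by simp

lemma ell_ord_ge_translate:
  assumes "ell \<epsilon> F" "ord_ge F z N" "p \<in> Lat" shows "ord_ge F (z + p) N"
proof -
  have "\<forall>\<^sub>F s in at z. F (s + p) = F s"
    using eventually_D by eventually_elim (use ellD(3)[OF assms(1)] assms(3) in auto)
  from ord_ge_cong[OF assms(2) this] show ?thesis by (simp add: ord_ge_shift)
qed

lemma ell_constant:
  assumes "ell 1 F" "\<And>i. i \<le> 3 \<Longrightarrow> l i > 0 \<Longrightarrow> ord_ge F (- hp i) 0"
  obtains c where "\<And>x. x \<in> D \<Longrightarrow> F x = c"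
proof -
  have ord: "ord_ge F z 0" for z
  proof (cases "z \<in> D")
    case True
    thus ?thesis using ell_analytic[OF assms(1)] ord_ge_analytic by blast
  next
    case False
    then obtain i where i: "i \<le> 3" "l i > 0" "z + hp i \<in> Lat" using not_D by blast
    from ell_ord_ge_translate[OF assms(1) assms(2)[OF i(1,2)] i(3)] show ?thesis by simp
  qed
  have "\<forall>\<^sub>F s in at z. F (s + p) = F s" if "p \<in> Lat" for z p
    using eventually_D by eventually_elim (use ellD(3)[OF assms(1)] that in auto)
  note per = this
  obtain c where "\<And>z. F analytic_on {z} \<Longrightarrow> F z = c"
    by (rule elliptic_constant[of F, OF ord per[OF Lat_2w1] per[OF Lat_2w3]]) blast
  thus ?thesis using that ell_analytic[OF assms(1)] by blast
qed

section \<open>The finite-dimensional space prescribed by the form of \<Xi>\<close>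

definition basis_index :: "(nat \<times> nat) option set" where
  "basis_index = insert None (Some ` (SIGMA i:{0..3}. {..<l i}))"

definition basis_fun :: "(nat \<times> nat) option \<Rightarrow> complex \<Rightarrow> complex" where
  "basis_fun \<kappa> x = (case \<kappa> of None \<Rightarrow> 1 | Some (i, j) \<Rightarrow> wp (x + hp i) ^ (l i - j))"

definition lin :: "((nat \<times> nat) option \<Rightarrow> complex) \<Rightarrow> complex \<Rightarrow> complex" where
  "lin u x = (\<Sum>\<kappa>\<in>basis_index. u \<kappa> * basis_fun \<kappa> x)"

lemma basis_fun_Some: "basis_fun (Some (i, j)) = (\<lambda>x. wp (x + hp i) ^ (l i - j))"
  by (simp add: basis_fun_def fun_eq_iff)

lemma finite_basis_index [simp]: "finite basis_index"
  by (simp add: basis_index_def)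

lemma ell_basis_fun: "\<kappa> \<in> basis_index \<Longrightarrow> ell 1 (basis_fun \<kappa>)"
  unfolding basis_index_def basis_fun_def[abs_def]
  by (auto intro!: ell_const ell_power ell_wp)

lemma ell_lin: "ell 1 (lin u)"
  unfolding lin_def[abs_def] by (intro ell_sum ell_cmult ell_basis_fun) auto

lemma ord_ge_basis_fun_other:
  assumes "i \<le> 3" "k \<le> 3" "i \<noteq> k" shows "ord_ge (basis_fun (Some (i, j))) (- hp k) 0"
  unfolding basis_fun_def[abs_def] using wp_regular[OF assms]
  by (auto intro!: ord_ge_analytic analytic_intros)

lemma basis_fun_local_form:
  obtains F where "local_form (basis_fun (Some (i, j))) (- hp i) (- 2 * int (l i - j)) F" "F (- hp i) = 1"
proof -
  obtain F where F: "local_form (\<lambda>x. wp (x + hp i)) (- hp i) (- 2) F" "F (- hp i) = 1"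
    by (rule wp_pole_form)
  have "local_form (\<lambda>x. wp (x + hp i) ^ n) (- hp i) (- 2 * int n) (\<lambda>x. F x ^ n)" for n
  proof (induction n)
    case (Suc n)
    from local_form_mult[OF F(1) Suc] show ?case by (simp add: algebra_simps)
  qed (simp add: local_form_def)
  from this[of "l i - j", folded basis_fun_Some] show ?thesis by (rule that) (simp add: F(2))
qed

lemma lin_ord_ge:
  assumes "i \<le> 3" "l i > 0" shows "ord_ge (lin u) (- hp i) (- 2 * int (l i))"
  unfolding lin_def[abs_def]
proof (intro ord_ge_sum ord_ge_cmult)
  fix \<kappa> assume \<kappa>: "\<kappa> \<in> basis_index"
  show "ord_ge (basis_fun \<kappa>) (- hp i) (- 2 * int (l i))"
  proof (cases \<kappa>)
    case None
    thus ?thesis by (simp add: basis_fun_def[abs_def] ord_ge_const)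
  next
    case (Some ij)
    then obtain k j where [simp]: "\<kappa> = Some (k, j)" by (cases ij) auto
    have k: "k \<le> 3" using \<kappa> by (auto simp: basis_index_def)
    show ?thesis
    proof (cases "k = i")
      case True
      obtain F where "local_form (basis_fun (Some (i, j))) (- hp i) (- 2 * int (l i - j)) F"
        by (rule basis_fun_local_form)
      hence "ord_ge (basis_fun \<kappa>) (- hp i) (- 2 * int (l i - j))"
        using True by (auto simp: ord_ge_def)
      thus ?thesis by (rule ord_ge_mono) auto
    next
      case False
      show ?thesis
        using ord_ge_mono[OF ord_ge_basis_fun_other[OF k assms(1) False, of j], of "- 2 * int (l i)"] by simp
    qed
  qed
qed

text \<open>Induction on the total pole order: a suitable multiple of a power of \<open>wp\<close>
  removes the leading coefficient at one half-period and leaves the poles at the others within their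
  bounds. A function without poles is constant.\<close>

lemma lin_span_aux:
  assumes "ell 1 F" "\<And>i. d i \<le> l i" "\<And>i. i \<le> 3 \<Longrightarrow> l i > 0 \<Longrightarrow> ord_ge F (- hp i) (- 2 * int (d i))"
    "(\<Sum>i=0..3. d i) = n"
  shows "\<exists>u. \<forall>x\<in>D. F x = lin u x"
  using assms
proof (induction n arbitrary: F d)
  case 0
  hence d0: "d i = 0" if "i \<le> 3" for i using that by auto
  obtain c where c: "\<And>x. x \<in> D \<Longrightarrow> F x = c"
    using ell_constant[OF 0(1)] 0(3) d0 by force
  have "lin (\<lambda>\<kappa>. if \<kappa> = None then c else 0) x = c" for x
    by (simp add: lin_def basis_fun_def basis_index_def if_distrib[of "\<lambda>a. a * _"] cong: if_cong)
  thus ?case using c by metis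
next
  case (Suc n)
  have "\<exists>i\<in>{0..3}. d i \<noteq> 0"
  proof (rule ccontr)
    assume "\<not> ?thesis"
    hence "(\<Sum>i=0..3. d i) = 0" by simp
    with Suc.prems(4) show False by simp
  qed
  then obtain i where i: "i \<le> 3" "d i > 0" by auto
  hence li: "l i > 0" using Suc.prems(2)[of i] by simp
  define j where "j = l i - d i"
  have j: "l i - j = d i" "j < l i" using Suc.prems(2)[of i] i by (auto simp: j_def)
  define \<kappa> where "\<kappa> = Some (i, j)"
  have \<kappa>: "\<kappa> \<in> basis_index" using i j by (auto simp: \<kappa>_def basis_index_def)
  obtain A where A: "local_form F (- hp i) (- 2 * int (d i)) A"
    using Suc.prems(3)[OF i(1) li] by (auto simp: ord_ge_def)
  obtain B where B: "local_form (basis_fun \<kappa>) (- hp i) (- 2 * int (d i)) B" "B (- hp i) = 1"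
    using basis_fun_local_form[of i j] j by (auto simp: \<kappa>_def)
  define a where "a = A (- hp i)"
  define G where "G = (\<lambda>x. F x - a * basis_fun \<kappa> x)"
  have ellG: "ell 1 G" unfolding G_def by (intro ell_diff ell_cmult ell_basis_fun \<kappa> Suc.prems)
  have "local_form (\<lambda>x. - a) (- hp i) 0 (\<lambda>x. - a)" by (rule local_form_analytic) simp
  from local_form_mult[OF this B(1)]
  have "local_form (\<lambda>x. - a * basis_fun \<kappa> x) (- hp i) (- 2 * int (d i)) (\<lambda>x. - a * B x)" by simp
  from local_form_add[OF A this]
  have "local_form (\<lambda>x. F x + - a * basis_fun \<kappa> x) (- hp i) (- 2 * int (d i)) (\<lambda>x. A x + - a * B x)" .
  from local_form_improve[OF this] have "ord_ge G (- hp i) (- 2 * int (d i) + 1)"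
    by (simp add: G_def a_def B(2))
  \<comment> \<open>Cancelling the leading coefficient gains one order and evenness a second one, so
    even powers of the pole suffice throughout.\<close>
  from even_ell_improve[OF ellG this] have ordi: "ord_ge G (- hp i) (- 2 * int (d i) + 2)" by simp
  have "\<exists>u. \<forall>x\<in>D. G x = lin u x"
  proof (rule Suc.IH[OF ellG, of "d(i := d i - 1)"])
    fix k assume k: "k \<le> 3" "l k > 0"
    show "ord_ge G (- hp k) (- 2 * int ((d(i := d i - 1)) k))"
    proof (cases "k = i")
      case True
      thus ?thesis using ordi i(2) by (simp add: of_nat_diff algebra_simps)
    next
      case False
      have "ord_ge (basis_fun \<kappa>) (- hp k) 0"
        unfolding \<kappa>_def using ord_ge_basis_fun_other i(1) k(1) False by metis
      hence "ord_ge (basis_fun \<kappa>) (- hp k) (- 2 * int (d k))" by (rule ord_ge_mono) simp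
      thus ?thesis unfolding G_def using Suc.prems(3)[OF k] False
        by (intro ord_ge_diff ord_ge_cmult) auto
    qed
  next
    have "(\<Sum>k=0..3. (d(i := d i - 1)) k) = d i - 1 + (\<Sum>k\<in>{0..3} - {i}. d k)"
      using i(1) by (subst sum.remove[of _ i]) auto
    moreover have "(\<Sum>k=0..3. d k) = d i + (\<Sum>k\<in>{0..3} - {i}. d k)"
      using i(1) by (subst sum.remove[of _ i]) auto
    ultimately show "(\<Sum>k=0..3. (d(i := d i - 1)) k) = n" using Suc.prems(4) i(2) by simp
  qed (use Suc.prems(2) in \<open>auto intro: le_trans[OF diff_le_self]\<close>)
  then obtain u where u: "\<And>x. x \<in> D \<Longrightarrow> G x = lin u x" by blast
  have "F x = lin (u(\<kappa> := u \<kappa> + a)) x" if "x \<in> D" for x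
  proof -
    have "lin (u(\<kappa> := u \<kappa> + a)) x = (u \<kappa> + a) * basis_fun \<kappa> x + (\<Sum>k\<in>basis_index - {\<kappa>}. u k * basis_fun k x)"
      unfolding lin_def using \<kappa> by (subst sum.remove[of _ \<kappa>]) auto
    also have "\<dots> = lin u x + a * basis_fun \<kappa> x"
      unfolding lin_def using \<kappa> by (subst (2) sum.remove[of _ \<kappa>]) (auto simp: algebra_simps)
    finally show ?thesis using u[OF that, unfolded G_def] by (simp only: diff_eq_eq)
  qed
  thus ?case by blast
qed

lemma lin_span:
  assumes "ell 1 F" "\<And>i. i \<le> 3 \<Longrightarrow> l i > 0 \<Longrightarrow> ord_ge F (- hp i) (- 2 * int (l i))"
  obtains u where "\<And>x. x \<in> D \<Longrightarrow> F x = lin u x"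
  using lin_span_aux[of F l] assms by auto

text \<open>At a fixed half-period the function with index j has a pole of exact order 2 (l_i - j),
  and those of the other half-periods are regular. Leading coefficients are compared from j = 0
  upwards; the constant is left for last.\<close>

lemma lin_independent:
  assumes "\<And>x. x \<in> D \<Longrightarrow> lin u x = 0" "\<kappa> \<in> basis_index"
  shows "u \<kappa> = 0"
proof -
  have Some0: "u (Some (i, j)) = 0" if ij: "i \<le> 3" "j < l i" for i j
    using ij(2)
  proof (induction j rule: less_induct)
    case (less j)
    define \<kappa> where "\<kappa> = Some (i, j)"
    define N where "N = - 2 * int (l i - j)"
    have \<kappa>: "\<kappa> \<in> basis_index" using ij(1) less.prems by (auto simp: \<kappa>_def basis_index_def)
    obtain B where B: "local_form (basis_fun \<kappa>) (- hp i) N B" "B (- hp i) = 1"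
      using basis_fun_local_form[of i j] by (auto simp: \<kappa>_def N_def)
    have "local_form (\<lambda>x. u \<kappa>) (- hp i) 0 (\<lambda>x. u \<kappa>)" by (rule local_form_analytic) simp
    from local_form_mult[OF this B(1)]
    have lf: "local_form (\<lambda>x. u \<kappa> * basis_fun \<kappa> x) (- hp i) N (\<lambda>x. u \<kappa> * B x)" by simp
    have "ord_ge (\<lambda>x. - (\<Sum>k\<in>basis_index - {\<kappa>}. u k * basis_fun k x)) (- hp i) (N + 1)"
    proof (intro ord_ge_uminus ord_ge_sum)
      fix k assume k: "k \<in> basis_index - {\<kappa>}"
      show "ord_ge (\<lambda>x. u k * basis_fun k x) (- hp i) (N + 1)"
      proof (cases k)
        case None
        thus ?thesis using less.prems
          by (auto simp: basis_fun_def[abs_def] N_def intro!: ord_ge_const)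
      next
        case (Some ij')
        then obtain i' j' where [simp]: "k = Some (i', j')" by (cases ij') auto
        have i'j': "i' \<le> 3" "j' < l i'" "(i', j') \<noteq> (i, j)" using k by (auto simp: basis_index_def \<kappa>_def)
        consider "i' \<noteq> i" | "i' = i" "j' < j" | "i' = i" "j' > j" using i'j' by fastforce
        thus ?thesis
        proof cases
          case 1
          from ord_ge_basis_fun_other[OF i'j'(1) ij(1) 1, of j'] have "ord_ge (basis_fun k) (- hp i) 0" by simp
          thus ?thesis using less.prems by (intro ord_ge_cmult) (auto simp: N_def intro: ord_ge_mono)
        next
          case 2
          hence "u k = 0" using less i'j' by auto
          thus ?thesis by (simp add: ord_ge_0)
        next
          case 3
          obtain C where "local_form (basis_fun (Some (i, j'))) (- hp i) (- 2 * int (l i - j')) C"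
            by (rule basis_fun_local_form)
          hence "ord_ge (basis_fun k) (- hp i) (- 2 * int (l i - j'))" using 3 by (auto simp: ord_ge_def)
          moreover have "N + 1 \<le> - 2 * int (l i - j')" using 3 less.prems i'j' by (auto simp: N_def)
          ultimately show ?thesis by (intro ord_ge_cmult) (rule ord_ge_mono)
        qed
      qed
    qed
    moreover have "\<forall>\<^sub>F x in at (- hp i). u \<kappa> * basis_fun \<kappa> x = - (\<Sum>k\<in>basis_index - {\<kappa>}. u k * basis_fun k x)"
      using eventually_D
    proof eventually_elim
      case (elim x)
      from assms(1)[OF elim] show ?case
        unfolding lin_def using \<kappa> by (subst (asm) sum.remove[of _ \<kappa>]) (auto simp: add_eq_0_iff)
    qed
    ultimately have "ord_ge (\<lambda>x. u \<kappa> * basis_fun \<kappa> x) (- hp i) (N + 1)" by (rule ord_ge_cong)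
    from local_form_order_unique[OF lf this] B(2) show ?case by (simp add: \<kappa>_def)
  qed
  show ?thesis
  proof (cases \<kappa>)
    case None
    obtain x where x: "x \<in> D" by (rule D_nonempty)
    have "u k * basis_fun k x = 0" if "k \<in> Some ` (SIGMA i:{0..3}. {..<l i})" for k
      using that Some0 by auto
    hence "(\<Sum>k\<in>Some ` (SIGMA i:{0..3}. {..<l i}). u k * basis_fun k x) = 0" by (intro sum.neutral) blast
    hence "lin u x = u None"
      unfolding lin_def basis_index_def by (subst sum.insert) (auto simp: basis_fun_def)
    thus ?thesis using assms(1)[OF x] None by simp
  next
    case (Some ij)
    thus ?thesis using Some0 assms(2) by (auto simp: basis_index_def)
  qed
qed

end


section \<open>The formal solution of the third order equation\<close>


text \<open>Obtained by inserting \<Sum> h_n E^(-n) with h_0 = 1 into the expression for Q and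
  setting Q = E. In the product of the series with itself h_(n+1) occurs twice, at the two ends of
  the convolution; hence the inner sum from 1 to n and the division by 2. No integration is
  involved.\<close>

fun hseq :: "(complex \<Rightarrow> complex) \<Rightarrow> nat \<Rightarrow> complex \<Rightarrow> complex" where
  "hseq v 0 = (\<lambda>_. 1)"
| "hseq v (Suc n) = (\<lambda>x.
     (v x * (\<Sum>i\<le>n. hseq v i x * hseq v (n - i) x)
      - 1 / 2 * (\<Sum>i\<le>n. hseq v i x * deriv (deriv (hseq v (n - i))) x)
      + 1 / 4 * (\<Sum>i\<le>n. deriv (hseq v i) x * deriv (hseq v (n - i)) x)
      - (\<Sum>i\<in>{1..n}. hseq v i x * hseq v (Suc n - i) x)) / 2)"

lemma fps_mult_nth_deriv:
  assumes "\<And>n. (f n has_field_derivative f' n) (at x)" "\<And>n. (g n has_field_derivative g' n) (at x)"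
  shows "((\<lambda>y. fps_nth (Abs_fps (\<lambda>n. f n y) * Abs_fps (\<lambda>n. g n y)) k) has_field_derivative
      fps_nth (Abs_fps f' * Abs_fps (\<lambda>n. g n x) + Abs_fps (\<lambda>n. f n x) * Abs_fps g') k) (at (x :: complex))"
proof -
  have "((\<lambda>y. \<Sum>i=0..k. f i y * g (k - i) y) has_field_derivative
      (\<Sum>i=0..k. f i x * g' (k - i) + f' i * g (k - i) x)) (at x)"
    by (intro DERIV_sum DERIV_mult' assms)
  thus ?thesis by (simp add: fps_mult_nth sum.distrib add.commute)
qed

lemma sum_0_Suc_ends:
  fixes f :: "nat \<Rightarrow> 'a :: comm_monoid_add"
  shows "(\<Sum>i=0..Suc n. f i) = f 0 + f (Suc n) + (\<Sum>i\<in>{1..n}. f i)"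
proof -
  have "{0..Suc n} = insert 0 (insert (Suc n) {1..n})" by auto
  thus ?thesis by (simp add: add.assoc)
qed

text \<open>A sequence in a finite-dimensional space has a member that depends on its predecessors.
  Coordinates are eliminated one at a time: only members after a pivot m are reduced, so the top
  coefficient 1 survives.\<close>

lemma monic_linear_relation:
  fixes v :: "nat \<Rightarrow> 'k \<Rightarrow> complex"
  assumes "finite J"
  obtains n \<delta> where "\<delta> n = 1" "\<And>\<kappa>. \<kappa> \<in> J \<Longrightarrow> (\<Sum>k\<le>n. \<delta> k * v k \<kappa>) = 0"
proof -
  have "\<exists>n \<delta>. \<delta> n = 1 \<and> (\<forall>\<kappa>\<in>J. (\<Sum>k\<le>n. \<delta> k * v k \<kappa>) = 0)"
    using assms
  proof (induction J arbitrary: v rule: finite_induct)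
    case empty
    show ?case by (intro exI[of _ 0] exI[of _ "\<lambda>_. 1"]) simp
  next
    case (insert \<kappa> J)
    show ?case
    proof (cases "\<forall>k. v k \<kappa> = 0")
      case True
      then show ?thesis using insert.IH[of v] by auto
    next
      case False
      then obtain m where m: "v m \<kappa> \<noteq> 0" by blast
      define r where "r k = v (Suc m + k) \<kappa> / v m \<kappa>" for k
      define w where "w k = (\<lambda>\<iota>. v (Suc m + k) \<iota> - r k * v m \<iota>)" for k
      obtain n \<delta> where \<delta>: "\<delta> n = 1" "\<forall>\<iota>\<in>J. (\<Sum>k\<le>n. \<delta> k * w k \<iota>) = 0"
        using insert.IH[of w] by blast
      have w0: "w k \<kappa> = 0" for k using m by (simp add: w_def r_def)
      define s where "s = (\<Sum>k\<le>n. \<delta> k * r k)"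
      \<comment> \<open>The coefficient of the pivot gathers all multiples of it that were
        subtracted in forming \<open>w\<close>.\<close>
      define \<epsilon> where "\<epsilon> k = (if k < m then 0 else if k = m then - s else \<delta> (k - Suc m))" for k
      have sum: "(\<Sum>k\<le>Suc m + n. \<epsilon> k * v k \<iota>) = (\<Sum>k\<le>n. \<delta> k * w k \<iota>)" for \<iota>
      proof -
        have "{..Suc m + n} = {..<m} \<union> {m} \<union> (\<lambda>k. Suc m + k) ` {..n}"
        proof (intro set_eqI iffI)
          fix x assume "x \<in> {..Suc m + n}"
          then consider "x < m" | "x = m" | "x > m" "x \<le> Suc m + n" by fastforce
          thus "x \<in> {..<m} \<union> {m} \<union> (\<lambda>k. Suc m + k) ` {..n}"
          proof cases
            case 3
            hence "x = Suc m + (x - Suc m)" "x - Suc m \<le> n" by auto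
            thus ?thesis by blast
          qed auto
        qed auto
        hence "(\<Sum>k\<le>Suc m + n. \<epsilon> k * v k \<iota>) = (\<Sum>k<m. \<epsilon> k * v k \<iota>) + \<epsilon> m * v m \<iota>
            + (\<Sum>k\<in>(\<lambda>k. Suc m + k) ` {..n}. \<epsilon> k * v k \<iota>)"
          by (simp only:) (subst sum.union_disjoint, auto)+
        also have "(\<Sum>k\<in>(\<lambda>k. Suc m + k) ` {..n}. \<epsilon> k * v k \<iota>) = (\<Sum>k\<le>n. \<delta> k * v (Suc m + k) \<iota>)"
          by (subst sum.reindex) (auto simp: \<epsilon>_def)
        also have "(\<Sum>k<m. \<epsilon> k * v k \<iota>) = 0" by (simp add: \<epsilon>_def)
        also have "\<epsilon> m * v m \<iota> = - (\<Sum>k\<le>n. \<delta> k * (r k * v m \<iota>))"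
          by (simp add: \<epsilon>_def s_def sum_distrib_right mult.assoc)
        finally show ?thesis by (simp add: w_def right_diff_distrib sum_subtractf)
      qed
      have "\<epsilon> (Suc m + n) = 1" using \<delta>(1) by (simp add: \<epsilon>_def)
      moreover have "\<forall>\<iota>\<in>insert \<kappa> J. (\<Sum>k\<le>Suc m + n. \<epsilon> k * v k \<iota>) = 0"
        unfolding sum using \<delta>(2) w0 by simp
      ultimately show ?thesis by blast
    qed
  qed
  thus ?thesis using that by blast
qed

context heun
begin

text \<open>The third order operator at E = 0, so that the equation for \<Xi> reads
  \<open>Lop f + 4 * E * deriv f = 0\<close>. It is the equation satisfied by products of two
  solutions of the second order equation.\<close>

definition Lop :: "(complex \<Rightarrow> complex) \<Rightarrow> complex \<Rightarrow> complex" where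
  "Lop f x = deriv (deriv (deriv f)) x - 4 * V x * deriv f x - 2 * deriv V x * f x"

lemma ell_Lop: "ell 1 a \<Longrightarrow> ell (- 1) (Lop a)"
proof -
  assume a: "ell 1 a"
  have 1: "ell (- 1) (deriv a)" using ell_deriv[OF a] .
  have 2: "ell (- 1) (deriv (deriv (deriv a)))" using ell_deriv[OF ell_deriv[OF 1]] by simp
  have 3: "ell (- 1) (\<lambda>x. V x * deriv a x)" using ell_mult[OF ell_V 1] by simp
  have 4: "ell (- 1) (\<lambda>x. deriv V x * a x)" using ell_mult[OF ell_deriv[OF ell_V] a] by simp
  have "ell (- 1) (\<lambda>x. deriv (deriv (deriv a)) x - 4 * (V x * deriv a x) - 2 * (deriv V x * a x))"
    by (intro ell_diff ell_cmult 2 3 4)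
  thus ?thesis by (simp add: Lop_def[abs_def] mult.assoc)
qed

lemma local_form_cmult: "local_form f z N F \<Longrightarrow> local_form (\<lambda>x. c * f x) z N (\<lambda>x. c * F x)"
  using local_form_mult[OF local_form_analytic[of "\<lambda>_. c" z]] by fastforce

text \<open>
  At \<open>-\<omega>\<^sub>i\<close> the indicial polynomial of the third order equation is
  \<open>(N - 1) (N + 2 l\<^sub>i) (N - 2 l\<^sub>i - 2)\<close>.
\<close>

lemma Lop_order:
  assumes "ell 1 a" "ord_ge a (- hp i) (- 2 * int (l i))" "i \<le> 3"
  shows "ord_ge (Lop a) (- hp i) (- 2 * int (l i) - 1)"
proof -
  define z where "z = - hp i"
  define N where "N = - 2 * int (l i)"
  obtain A where A: "local_form a z N A" using assms(2) by (auto simp: ord_ge_def z_def N_def)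
  obtain v where v: "local_form V z (- 2) v" "v z = of_nat (l i * (l i + 1))"
    using V_local_form[OF assms(3)] by (auto simp: z_def)
  define A1 where "A1 = (\<lambda>s. of_int N * A s + (s - z) * deriv A s)"
  define A2 where "A2 = (\<lambda>s. of_int (N - 1) * A1 s + (s - z) * deriv A1 s)"
  define A3 where "A3 = (\<lambda>s. of_int (N - 1 - 1) * A2 s + (s - z) * deriv A2 s)"
  define v1 where "v1 = (\<lambda>s. of_int (- 2) * v s + (s - z) * deriv v s)"
  have A1: "local_form (deriv a) z (N - 1) A1" using local_form_deriv[OF A] by (simp add: A1_def)
  have A2: "local_form (deriv (deriv a)) z (N - 1 - 1) A2" using local_form_deriv[OF A1] by (simp add: A2_def)
  have A3: "local_form (deriv (deriv (deriv a))) z (N - 3) A3"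
    using local_form_deriv[OF A2] by (simp add: A3_def)
  have v1: "local_form (deriv V) z (- 3) v1" using local_form_deriv[OF v(1)] by (simp add: v1_def)
  have N3: "- 2 + (N - 1) = N - 3" "- 3 + N = N - 3" by simp_all
  have 1: "local_form (\<lambda>x. - 4 * (V x * deriv a x)) z (N - 3) (\<lambda>x. - 4 * (v x * A1 x))"
    using local_form_cmult[OF local_form_mult[OF v(1) A1], of "- 4", unfolded N3(1)] .
  have 2: "local_form (\<lambda>x. - 2 * (deriv V x * a x)) z (N - 3) (\<lambda>x. - 2 * (v1 x * A x))"
    using local_form_cmult[OF local_form_mult[OF v1 A], of "- 2", unfolded N3(2)] .
  have "local_form (\<lambda>x. deriv (deriv (deriv a)) x + - 4 * (V x * deriv a x) + - 2 * (deriv V x * a x)) z (N - 3)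
      (\<lambda>x. A3 x + - 4 * (v x * A1 x) + - 2 * (v1 x * A x))"
    by (intro local_form_add A3 1 2)
  hence lf: "local_form (Lop a) z (N - 3) (\<lambda>x. A3 x + - 4 * (v x * A1 x) + - 2 * (v1 x * A x))"
    by (rule local_form_cong) (simp add: Lop_def mult.assoc)
  \<comment> \<open>The value -2 l_i is an indicial root. The generic order N - 3 thus rises to N -
    2, which is even, and the oddness of \<open>Lop a\<close> adds one more.\<close>
  have "A3 z + - 4 * (v z * A1 z) + - 2 * (v1 z * A z) = 0"
    by (simp add: A3_def A2_def A1_def v1_def v(2) N_def algebra_simps)
  from local_form_improve[OF lf this] have "ord_ge (Lop a) z (N - 2)" by (simp add: algebra_simps)
  from odd_ell_improve[OF ell_Lop[OF assms(1)] this[unfolded z_def]]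
  have "ord_ge (Lop a) (- hp i) (N - 2 + 1)" by (simp add: N_def)
  moreover have "N - 2 + 1 = - 2 * int (l i) - 1" by (simp add: N_def)
  ultimately show ?thesis by (simp only:)
qed

abbreviation h where "h \<equiv> hseq V"

lemma ell_h: "ell 1 (h n)"
proof (induction n rule: less_induct)
  case (less n)
  show ?case
  proof (cases n)
    case 0
    thus ?thesis using ell_const[of 1] by simp
  next
    case (Suc m)
    have e: "ell 1 (h i)" if "i \<le> m" for i using less that Suc by simp
    have e1: "ell (- 1) (deriv (h i))" if "i \<le> m" for i using ell_deriv[OF e[OF that]] .
    have e2: "ell 1 (deriv (deriv (h i)))" if "i \<le> m" for i using ell_deriv[OF e1[OF that]] by simp
    have "ell 1 (\<lambda>x. V x * (\<Sum>i\<le>m. h i x * h (m - i) x))"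
      using ell_mult[OF ell_V ell_sum[of "{..m}" "\<lambda>i x. h i x * h (m - i) x"]] ell_mult[OF e e] by simp
    moreover have "ell 1 (\<lambda>x. \<Sum>i\<le>m. h i x * deriv (deriv (h (m - i))) x)"
      by (intro ell_sum) (use ell_mult[OF e e2] in auto)
    moreover have "ell 1 (\<lambda>x. \<Sum>i\<le>m. deriv (h i) x * deriv (h (m - i)) x)"
      by (intro ell_sum) (use ell_mult[OF e1 e1] in auto)
    moreover have "ell 1 (\<lambda>x. \<Sum>i\<in>{1..m}. h i x * h (Suc m - i) x)"
      by (intro ell_sum) (use ell_mult[OF e e] in auto)
    ultimately have "ell 1 (\<lambda>x. 1 / 2 * (V x * (\<Sum>i\<le>m. h i x * h (m - i) x)
      - 1 / 2 * (\<Sum>i\<le>m. h i x * deriv (deriv (h (m - i))) x)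
      + 1 / 4 * (\<Sum>i\<le>m. deriv (h i) x * deriv (h (m - i)) x)
      - (\<Sum>i\<in>{1..m}. h i x * h (Suc m - i) x)))"
      by (intro ell_cmult ell_diff ell_add)
    thus ?thesis using Suc by (simp add: mult.commute)
  qed
qed

lemma ell_DERIV: "ell \<epsilon> F \<Longrightarrow> x \<in> D \<Longrightarrow> (F has_field_derivative deriv F x) (at x)"
  using ell_analytic analytic_derivI by blast

text \<open>
  With \<open>Z = 1/E\<close> the generating function \<open>A = \<Sum> h\<^sub>n Z\<^sup>n\<close> solves
  \<open>4 A\<^sup>2 = 4 + Z (4 V A\<^sup>2 - 2 A A'' + A'\<^sup>2)\<close>. Differentiating in \<open>x\<close> and cancelling \<open>A\<close> turns this
  quadratic relation into the linear third order recursion.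
\<close>

lemma h_recursion:
  assumes x: "x \<in> D" shows "deriv (h (Suc n)) x = - (1 / 4) * Lop (h n) x"
proof -
  define A where "A y = Abs_fps (\<lambda>n. h n y)" for y
  define A1 where "A1 y = Abs_fps (\<lambda>n. deriv (h n) y)" for y
  define A2 where "A2 y = Abs_fps (\<lambda>n. deriv (deriv (h n)) y)" for y
  define A3 where "A3 y = Abs_fps (\<lambda>n. deriv (deriv (deriv (h n))) y)" for y
  define R where "R y = fps_const 4 * (fps_const (V y) * (A y * A y)) - fps_const 2 * (A y * A2 y) + A1 y * A1 y" for y
  have quad: "fps_const 4 * (A y * A y) = fps_const 4 + fps_X * R y" for y
  proof (rule fps_ext)
    fix k
    show "fps_nth (fps_const 4 * (A y * A y)) k = fps_nth (fps_const 4 + fps_X * R y) k"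
    proof (cases k)
      case 0
      thus ?thesis by (simp add: A_def fps_mult_nth)
    next
      case (Suc m)
      have "fps_nth (A y * A y) (Suc m) = 2 * h (Suc m) y + (\<Sum>i\<in>{1..m}. h i y * h (Suc m - i) y)"
        unfolding fps_mult_nth sum_0_Suc_ends by (simp add: A_def del: hseq.simps(2))
      also have "\<dots> = V y * fps_nth (A y * A y) m - 1 / 2 * fps_nth (A y * A2 y) m
          + 1 / 4 * fps_nth (A1 y * A1 y) m"
        by (simp add: fps_mult_nth A_def A1_def A2_def atLeast0AtMost diff_divide_distrib add_divide_distrib)
      finally show ?thesis unfolding Suc by (simp add: R_def right_diff_distrib distrib_left)
    qed
  qed
  have d0: "(h n has_field_derivative deriv (h n) x) (at x)" for n by (rule ell_DERIV[OF ell_h x])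
  have d1: "(deriv (h n) has_field_derivative deriv (deriv (h n)) x) (at x)" for n
    by (rule ell_DERIV[OF ell_deriv[OF ell_h] x])
  have d2: "(deriv (deriv (h n)) has_field_derivative deriv (deriv (deriv (h n))) x) (at x)" for n
    by (rule ell_DERIV[OF ell_deriv[OF ell_deriv[OF ell_h]] x])
  have dAA: "((\<lambda>y. fps_nth (A y * A y) k) has_field_derivative fps_nth (A1 x * A x + A x * A1 x) k) (at x)" for k
    unfolding A_def A1_def by (rule fps_mult_nth_deriv[OF d0 d0])
  have dAA2: "((\<lambda>y. fps_nth (A y * A2 y) k) has_field_derivative fps_nth (A1 x * A2 x + A x * A3 x) k) (at x)" for k
    unfolding A_def A1_def A2_def A3_def by (rule fps_mult_nth_deriv[OF d0 d2])
  have dA1: "((\<lambda>y. fps_nth (A1 y * A1 y) k) has_field_derivative fps_nth (A2 x * A1 x + A1 x * A2 x) k) (at x)" for k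
    unfolding A1_def A2_def by (rule fps_mult_nth_deriv[OF d1 d1])
  define R' where "R' = fps_const 4 * (fps_const (deriv V x) * (A x * A x)) + fps_const 4 * (fps_const (V x) * (A1 x * A x + A x * A1 x))
      - fps_const 2 * (A1 x * A2 x + A x * A3 x) + (A2 x * A1 x + A1 x * A2 x)"
  have dR: "((\<lambda>y. fps_nth (R y) k) has_field_derivative fps_nth R' k) (at x)" for k
  proof -
    have "((\<lambda>y. 4 * (V y * fps_nth (A y * A y) k) - 2 * fps_nth (A y * A2 y) k + fps_nth (A1 y * A1 y) k) has_field_derivative
        4 * (V x * fps_nth (A1 x * A x + A x * A1 x) k + deriv V x * fps_nth (A x * A x) k)
        - 2 * fps_nth (A1 x * A2 x + A x * A3 x) k + fps_nth (A2 x * A1 x + A1 x * A2 x) k) (at x)"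
      by (intro DERIV_add DERIV_diff DERIV_cmult DERIV_mult' ell_DERIV[OF ell_V x] dAA dAA2 dA1)
    thus ?thesis by (simp add: R_def R'_def distrib_left add.commute)
  qed
  have "fps_const 4 * (A1 x * A x + A x * A1 x) = fps_X * R'"
  proof (rule fps_ext)
    fix k
    have 1: "((\<lambda>y. 4 * fps_nth (A y * A y) k) has_field_derivative 4 * fps_nth (A1 x * A x + A x * A1 x) k) (at x)"
      by (intro DERIV_cmult dAA)
    have eq: "4 * fps_nth (A y * A y) k = fps_nth (fps_const 4) k + (if k = 0 then 0 else fps_nth (R y) (k - 1))" for y
      using arg_cong[OF quad[of y], of "\<lambda>F. fps_nth F k"] by simp
    have 2: "((\<lambda>y. 4 * fps_nth (A y * A y) k) has_field_derivative (if k = 0 then 0 else fps_nth R' (k - 1))) (at x)"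
      unfolding eq using dR[of "k - 1"] by (cases "k = 0") (auto intro!: derivative_eq_intros)
    from DERIV_unique[OF 1 2] show "fps_nth (fps_const 4 * (A1 x * A x + A x * A1 x)) k = fps_nth (fps_X * R') k"
      by simp
  qed
  hence "A x * (fps_const 8 * A1 x - fps_X * (fps_const 4 * (fps_const (deriv V x) * A x)
      + fps_const 8 * (fps_const (V x) * A1 x) - fps_const 2 * A3 x)) = 0"
    unfolding R'_def fps_numeral_fps_const[symmetric] by algebra
  \<comment> \<open>The constant coefficient is h_0 = 1, so the series is nonzero and may be
    cancelled in the integral domain of formal power series.\<close>
  moreover have "fps_nth (A x) 0 = 1" by (simp add: A_def)
  hence "A x \<noteq> 0" by auto
  ultimately have "fps_const 8 * A1 x = fps_X * (fps_const 4 * (fps_const (deriv V x) * A x)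
      + fps_const 8 * (fps_const (V x) * A1 x) - fps_const 2 * A3 x)"
    by simp
  from arg_cong[OF this, of "\<lambda>F. fps_nth F (Suc n)"]
  have "8 * deriv (h (Suc n)) x = 4 * (deriv V x * h n x) + 8 * (V x * deriv (h n) x) - 2 * deriv (deriv (deriv (h n))) x"
    by (simp add: A_def A1_def A3_def del: hseq.simps(2))
  hence "2 * (4 * deriv (h (Suc n)) x + Lop (h n) x) = 0" unfolding Lop_def by algebra
  hence "4 * deriv (h (Suc n)) x + Lop (h n) x = 0"
    by (simp only: mult_eq_0_iff) simp
  hence "4 * deriv (h (Suc n)) x = - Lop (h n) x" by (simp only: eq_neg_iff_add_eq_0)
  thus ?thesis by (simp add: field_simps del: hseq.simps(2))
qed

text \<open>The linear recursion bounds only the derivative; meromorphy of the coefficient itself is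
  known from the quadratic definition. Integration at negative order then restores the bound, so the
  poles do not grow with n.\<close>

lemma h_order:
  assumes "i \<le> 3" "l i > 0" shows "ord_ge (h n) (- hp i) (- 2 * int (l i))"
proof (induction n)
  case 0
  show ?case by (simp add: ord_ge_const)
next
  case (Suc n)
  have "\<forall>\<^sub>F x in at (- hp i). deriv (h (Suc n)) x = - (1 / 4) * Lop (h n) x"
    using eventually_D by eventually_elim (rule h_recursion)
  from ord_ge_cong[OF ord_ge_cmult[OF Lop_order[OF ell_h Suc assms(1)]] this]
  have "ord_ge (deriv (h (Suc n))) (- hp i) (- 2 * int (l i) - 1)" .
  moreover obtain M where "ord_ge (h (Suc n)) (- hp i) M" using ellD(4)[OF ell_h assms] by blast
  ultimately show ?case using ord_ge_antideriv[of "h (Suc n)"] by simp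
qed

lemma h_lin: "\<exists>u. \<forall>x\<in>D. h n x = lin u x"
  using lin_span[OF ell_h h_order] by metis

end


section \<open>The polynomial solution\<close>


context heun
begin

section \<open>Solution families with coefficients polynomial in E\<close>

lemma lin_DERIV:
  assumes "x \<in> D" shows "(lin u has_field_derivative (\<Sum>\<kappa>\<in>basis_index. u \<kappa> * deriv (basis_fun \<kappa>) x)) (at x)"
  unfolding lin_def[abs_def]
  by (intro DERIV_sum DERIV_cmult ell_DERIV[OF ell_basis_fun assms])

lemma deriv_sum_D:
  assumes "finite I" "\<And>i. i \<in> I \<Longrightarrow> ell \<epsilon> (F i)" "\<And>x. x \<in> D \<Longrightarrow> G x = (\<Sum>i\<in>I. c i * F i x)" "x \<in> D"
  shows "deriv G x = (\<Sum>i\<in>I. c i * deriv (F i) x)"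
proof -
  have "deriv G x = deriv (\<lambda>x. \<Sum>i\<in>I. c i * F i x) x"
    by (rule deriv_cong_ev[OF eventually_mono[OF eventually_nhds_in_open[OF open_heun_domain assms(4)]]])
       (use assms(3) in auto)
  also have "((\<lambda>x. \<Sum>i\<in>I. c i * F i x) has_field_derivative (\<Sum>i\<in>I. c i * deriv (F i) x)) (at x)"
    by (intro DERIV_sum DERIV_cmult ell_DERIV[OF assms(2) assms(4)])
  hence "deriv (\<lambda>x. \<Sum>i\<in>I. c i * F i x) x = (\<Sum>i\<in>I. c i * deriv (F i) x)" by (rule DERIV_imp_deriv)
  finally show ?thesis .
qed

lemma linear_combination_derivs:
  assumes "finite I" "\<And>i. i \<in> I \<Longrightarrow> ell 1 (F i)" "\<And>x. x \<in> D \<Longrightarrow> G x = (\<Sum>i\<in>I. c i * F i x)" "x \<in> D"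
  shows "deriv G x = (\<Sum>i\<in>I. c i * deriv (F i) x)" "Lop G x = (\<Sum>i\<in>I. c i * Lop (F i) x)"
proof -
  have 1: "deriv G y = (\<Sum>i\<in>I. c i * deriv (F i) y)" if "y \<in> D" for y
    by (rule deriv_sum_D[OF assms(1) _ assms(3) that]) (use assms(2) in auto)
  have 2: "deriv (deriv G) y = (\<Sum>i\<in>I. c i * deriv (deriv (F i)) y)" if "y \<in> D" for y
    by (rule deriv_sum_D[OF assms(1) _ 1 that]) (use assms(2) ell_deriv in auto)
  have 3: "deriv (deriv (deriv G)) y = (\<Sum>i\<in>I. c i * deriv (deriv (deriv (F i))) y)" if "y \<in> D" for y
    by (rule deriv_sum_D[OF assms(1) _ 2 that]) (use assms(2) ell_deriv[OF ell_deriv] in auto)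
  show "deriv G x = (\<Sum>i\<in>I. c i * deriv (F i) x)" by (rule 1[OF assms(4)])
  show "Lop G x = (\<Sum>i\<in>I. c i * Lop (F i) x)"
    unfolding Lop_def 1[OF assms(4)] 3[OF assms(4)] assms(3)[OF assms(4)]
    by (simp add: sum_distrib_left sum_subtractf[symmetric] algebra_simps)
qed

definition family :: "((nat \<times> nat) option \<Rightarrow> complex poly) \<Rightarrow> complex \<Rightarrow> complex \<Rightarrow> complex" where
  "family u E = lin (\<lambda>\<kappa>. poly (u \<kappa>) E)"

definition is_solution :: "((nat \<times> nat) option \<Rightarrow> complex poly) \<Rightarrow> bool" where
  "is_solution u \<longleftrightarrow> (\<forall>E. \<forall>x\<in>D. Lop (family u E) x + 4 * E * deriv (family u E) x = 0)"

text \<open>The left side of the third order equation at a fixed x, as a polynomial in E. Common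
  factors and remainders can then be treated by polynomial algebra, linearly in
  \<open>u\<close>.\<close>

definition residual :: "((nat \<times> nat) option \<Rightarrow> complex poly) \<Rightarrow> complex \<Rightarrow> complex poly" where
  "residual u x = (\<Sum>\<kappa>\<in>basis_index. u \<kappa> * [:Lop (basis_fun \<kappa>) x, 4 * deriv (basis_fun \<kappa>) x:])"

lemma family_derivs:
  assumes "x \<in> D"
  shows "deriv (family u E) x = (\<Sum>\<kappa>\<in>basis_index. poly (u \<kappa>) E * deriv (basis_fun \<kappa>) x)"
    "Lop (family u E) x = (\<Sum>\<kappa>\<in>basis_index. poly (u \<kappa>) E * Lop (basis_fun \<kappa>) x)"
  by (rule linear_combination_derivs[OF finite_basis_index ell_basis_fun _ assms];
      simp add: family_def lin_def)+

lemma poly_residual: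
  assumes "x \<in> D" shows "poly (residual u x) E = Lop (family u E) x + 4 * E * deriv (family u E) x"
  unfolding family_derivs[OF assms] residual_def
  by (simp add: poly_sum sum_distrib_left sum.distrib[symmetric] algebra_simps)

lemma is_solution_iff: "is_solution u \<longleftrightarrow> (\<forall>x\<in>D. residual u x = 0)"
  unfolding is_solution_def using poly_residual poly_all_0_iff_0 by metis

lemma is_solution_diff_mult:
  "is_solution u \<Longrightarrow> is_solution v \<Longrightarrow> is_solution (\<lambda>\<kappa>. u \<kappa> - q * v \<kappa>)"
proof -
  have "residual (\<lambda>\<kappa>. u \<kappa> - q * v \<kappa>) x = residual u x - q * residual v x" for x
    by (simp add: residual_def sum_subtractf[symmetric] sum_distrib_left left_diff_distrib mult.assoc
        del: mult_pCons_right)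
  thus "is_solution u \<Longrightarrow> is_solution v \<Longrightarrow> is_solution (\<lambda>\<kappa>. u \<kappa> - q * v \<kappa>)"
    by (simp add: is_solution_iff)
qed

lemma residual_mult: "residual (\<lambda>\<kappa>. q * u \<kappa>) x = q * residual u x"
  by (simp add: residual_def sum_distrib_left mult.assoc del: mult_pCons_right)

lemma residual_cong: "(\<And>\<kappa>. \<kappa> \<in> basis_index \<Longrightarrow> u \<kappa> = v \<kappa>) \<Longrightarrow> residual u x = residual v x"
  by (simp add: residual_def)

lemma is_solution_cancel:
  assumes "is_solution v" "\<And>\<kappa>. \<kappa> \<in> basis_index \<Longrightarrow> v \<kappa> = q * u \<kappa>" "q \<noteq> 0"
  shows "is_solution u"
  using assms(1) residual_cong[of v "\<lambda>\<kappa>. q * u \<kappa>"] assms(2,3) residual_mult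
  by (simp add: is_solution_iff)

lemma None_in_basis_index [simp]: "None \<in> basis_index"
  by (simp add: basis_index_def)

lemma lin_update_None: "lin (u(None := u None - c)) x = lin u x - c"
proof -
  have "(\<Sum>\<kappa>\<in>basis_index - {None}. (u(None := u None - c)) \<kappa> * basis_fun \<kappa> x)
      = (\<Sum>\<kappa>\<in>basis_index - {None}. u \<kappa> * basis_fun \<kappa> x)"
    by (intro sum.cong) auto
  moreover have "basis_fun None x = 1" by (simp add: basis_fun_def)
  ultimately show ?thesis
    using sum.remove[OF finite_basis_index None_in_basis_index, of "\<lambda>\<kappa>. u \<kappa> * basis_fun \<kappa> x"]
      sum.remove[OF finite_basis_index None_in_basis_index, of "\<lambda>\<kappa>. (u(None := u None - c)) \<kappa> * basis_fun \<kappa> x"]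
    by (simp add: lin_def)
qed

text \<open>
  The leading coefficient in \<open>E\<close> of a solution has vanishing derivative, so a solution without constant
  term vanishes.
\<close>

lemma is_solution_zero:
  assumes "is_solution u" "u None = 0" "\<kappa> \<in> basis_index" shows "u \<kappa> = 0"
proof -
  obtain x0 where x0: "x0 \<in> D" by (rule D_nonempty)
  define Q where "Q m \<longleftrightarrow> (\<forall>\<kappa>\<in>basis_index. coeff (u \<kappa>) m = 0)" for m
  define M where "M = Suc (Max ((\<lambda>\<kappa>. degree (u \<kappa>)) ` basis_index))"
  have big: "Q m" if "m \<ge> M" for m
    unfolding Q_def
  proof
    fix \<kappa> assume "\<kappa> \<in> basis_index"
    hence "degree (u \<kappa>) \<le> Max ((\<lambda>\<kappa>. degree (u \<kappa>)) ` basis_index)" by (intro Max_ge) auto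
    thus "coeff (u \<kappa>) m = 0" using that by (intro coeff_eq_0) (simp add: M_def)
  qed
  \<comment> \<open>In the coefficient of E^(m+1) of the residual, the coefficients of index m + 1
    enter through \<open>Lop\<close> and those of index m through the derivative. Once the former
    vanish, the latter combine to a constant function.\<close>
  have step: "Q m" if "Q (Suc m)" for m
  proof -
    define c where "c \<kappa> = coeff (u \<kappa>) m" for \<kappa>
    have "(\<Sum>\<kappa>\<in>basis_index. c \<kappa> * deriv (basis_fun \<kappa>) x) = 0" if x: "x \<in> D" for x
    proof -
      have cf: "coeff (p * [:a, b:]) (Suc m) = coeff p (Suc m) * a + coeff p m * b" for p :: "complex poly" and a b
        by (simp add: mult.commute)
      have "0 = coeff (residual u x) (Suc m)" using assms(1) x by (simp add: is_solution_iff)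
      also have "\<dots> = (\<Sum>\<kappa>\<in>basis_index. c \<kappa> * (4 * deriv (basis_fun \<kappa>) x))"
        unfolding residual_def coeff_sum cf c_def
        by (intro sum.cong refl) (use \<open>Q (Suc m)\<close> in \<open>simp add: Q_def\<close>)
      also have "\<dots> = 4 * (\<Sum>\<kappa>\<in>basis_index. c \<kappa> * deriv (basis_fun \<kappa>) x)"
        by (simp add: sum_distrib_left mult_ac)
      finally show ?thesis by simp
    qed
    hence "(lin c has_field_derivative 0) (at x)" if "x \<in> D" for x
      using lin_DERIV[OF that, of c] that by simp
    hence const: "lin c x = lin c x0" if "x \<in> D" for x using constant_on_D[of "lin c"] that x0 by blast
    \<comment> \<open>Absorbing that constant into the \<open>None\<close> coordinate gives a
      vanishing combination; the coordinate itself is 0 by assumption.\<close>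
    define c' where "c' = c(None := c None - lin c x0)"
    have "lin c' x = 0" if "x \<in> D" for x
      unfolding c'_def lin_update_None using const[OF that] by simp
    hence "c' \<kappa> = 0" if "\<kappa> \<in> basis_index" for \<kappa> using lin_independent that by blast
    hence "c \<kappa> = 0" if "\<kappa> \<in> basis_index" for \<kappa>
    proof (cases "\<kappa> = None")
      case True
      thus ?thesis using assms(2) by (simp add: c_def)
    next
      case False
      thus ?thesis using \<open>\<And>\<kappa>. \<kappa> \<in> basis_index \<Longrightarrow> c' \<kappa> = 0\<close>[OF that] False by (auto simp: c'_def)
    qed
    thus "Q m" by (simp add: Q_def c_def)
  qed
  have "Q m" for m
  proof (cases "m \<ge> M")
    case False
    hence "m \<le> M" by simp
    thus ?thesis by (induction rule: inc_induct) (use big step in auto)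
  qed (use big in auto)
  thus ?thesis using assms(3) by (intro poly_eqI) (simp add: Q_def)
qed

text \<open>Summation by parts, with Horner's recursion for the tails p_j of a polynomial with
  coefficients \<delta>_k. For g_j = h_j' the right side becomes the derivative of the relation
  between the h_k, since p_(n-1) = \<delta>_n.\<close>

lemma telescope:
  fixes p \<delta> g :: "nat \<Rightarrow> complex"
  assumes "\<And>j. E * p (Suc j) = p j - \<delta> (Suc j)" "g 0 = 0"
  shows "(\<Sum>j<m. p j * (E * g j - g (Suc j))) = - (\<Sum>j<m. \<delta> j * g j) - (if m = 0 then 0 else p (m - 1) * g m)"
proof (induction m)
  case (Suc m)
  show ?case
  proof (cases m)
    case 0
    thus ?thesis using assms(2) by simp
  next
    case (Suc k)
    have "p m * (E * g m) = (p k - \<delta> m) * g m" using assms(1)[of k] Suc by (simp add: mult_ac)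
    moreover have "(\<Sum>j<m. p j * (E * g j - g (Suc j))) = - (\<Sum>j<m. \<delta> j * g j) - p k * g m"
      using Suc.IH unfolding Suc by simp
    ultimately have "(\<Sum>j<Suc m. p j * (E * g j - g (Suc j))) = - (\<Sum>j<Suc m. \<delta> j * g j) - p m * g (Suc m)"
      unfolding sum.lessThan_Suc by algebra
    thus ?thesis by simp
  qed
qed simp

text \<open>
  A monic relation \<open>\<Sum> \<delta>\<^sub>k h\<^sub>k = 0\<close> truncates the formal series: multiplying it by \<open>\<Sum> \<delta>\<^sub>k E\<^sup>k\<close>
  leaves the polynomial part \<open>\<Sum> h\<^sub>j P\<^sub>j(E)\<close>.
\<close>

lemma solution_exists:
  obtains u where "is_solution u" "lead_coeff (u None) = 1"
proof -
  obtain v where v: "\<And>n x. x \<in> D \<Longrightarrow> h n x = lin (v n) x" using h_lin by metis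
  obtain n \<delta> where \<delta>: "\<delta> n = 1" "\<And>\<kappa>. \<kappa> \<in> basis_index \<Longrightarrow> (\<Sum>k\<le>n. \<delta> k * v k \<kappa>) = 0"
    by (rule monic_linear_relation[OF finite_basis_index, of v]) blast
  note None = None_in_basis_index
  have v0: "v 0 None = 1"
  proof -
    define w where "w = (v 0)(None := v 0 None - 1)"
    have "lin w x = 0" if "x \<in> D" for x
      unfolding w_def lin_update_None using v[OF that, of 0] by simp
    from lin_independent[OF this None] show ?thesis by (simp add: w_def)
  qed
  \<comment> \<open>For n = 0 the relation would say h_0 = 0, whereas h_0 = 1.\<close>
  have n: "n \<noteq> 0"
  proof
    assume "n = 0"
    thus False using \<delta>(1) \<delta>(2)[OF None] v0 by simp
  qed
  \<comment> \<open>The term of degree 0 in the polynomial part is the relation \<Sum> \<delta>_k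
    h_k = 0 itself. So a factor E splits off, which accounts for the exponent k - j - 1.\<close>
  define P where "P j = (\<Sum>k\<in>{Suc j..n}. monom (\<delta> k) (k - Suc j))" for j
  define p where "p E j = (\<Sum>k\<in>{Suc j..n}. \<delta> k * E ^ (k - Suc j))" for E j
  have P: "poly (P j) E = p E j" for j E by (simp add: P_def p_def poly_sum poly_monom)
  have p_step: "E * p E (Suc j) = p E j - (if Suc j \<le> n then \<delta> (Suc j) else 0)" for E j
  proof (cases "Suc j \<le> n")
    case True
    have "{Suc j..n} = insert (Suc j) {Suc (Suc j)..n}" using True by auto
    hence "p E j = \<delta> (Suc j) + (\<Sum>k\<in>{Suc (Suc j)..n}. \<delta> k * E ^ (k - Suc j))"
      unfolding p_def by simp
    also have "(\<Sum>k\<in>{Suc (Suc j)..n}. \<delta> k * E ^ (k - Suc j)) = E * p E (Suc j)"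
      unfolding p_def sum_distrib_left
    proof (intro sum.cong refl)
      fix k assume "k \<in> {Suc (Suc j)..n}"
      hence "k - Suc j = Suc (k - Suc (Suc j))" by auto
      thus "\<delta> k * E ^ (k - Suc j) = E * (\<delta> k * E ^ (k - Suc (Suc j)))" by simp
    qed
    finally show ?thesis using True by simp
  qed (simp add: p_def)
  define u where "u \<kappa> = (\<Sum>j<n. smult (v j \<kappa>) (P j))" for \<kappa>
  have fam: "family u E x = (\<Sum>j<n. p E j * h j x)" if "x \<in> D" for E x
  proof -
    have "family u E x = (\<Sum>\<kappa>\<in>basis_index. \<Sum>j<n. p E j * (v j \<kappa> * basis_fun \<kappa> x))"
      by (simp add: family_def lin_def u_def poly_sum P sum_distrib_left sum_distrib_right mult_ac)
    also have "\<dots> = (\<Sum>j<n. \<Sum>\<kappa>\<in>basis_index. p E j * (v j \<kappa> * basis_fun \<kappa> x))" by (rule sum.swap)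
    also have "\<dots> = (\<Sum>j<n. p E j * h j x)" using v[OF that] by (simp add: lin_def sum_distrib_left)
    finally show ?thesis .
  qed
  have rel: "(\<Sum>k\<le>n. \<delta> k * h k x) = 0" if "x \<in> D" for x
  proof -
    have "(\<Sum>k\<le>n. \<delta> k * h k x) = (\<Sum>k\<le>n. \<Sum>\<kappa>\<in>basis_index. \<delta> k * v k \<kappa> * basis_fun \<kappa> x)"
      using v[OF that] by (simp add: lin_def sum_distrib_left mult.assoc)
    also have "\<dots> = (\<Sum>\<kappa>\<in>basis_index. (\<Sum>k\<le>n. \<delta> k * v k \<kappa>) * basis_fun \<kappa> x)"
      by (subst sum.swap) (simp add: sum_distrib_right)
    also have "\<dots> = 0" using \<delta>(2) by simp
    finally show ?thesis .
  qed
  have rel': "(\<Sum>k\<le>n. \<delta> k * deriv (h k) x) = 0" if x: "x \<in> D" for x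
  proof -
    have "deriv (\<lambda>_. 0) x = (\<Sum>k\<le>n. \<delta> k * deriv (h k) x)"
      by (rule linear_combination_derivs(1)[OF _ ell_h _ x]) (use rel in auto)
    thus ?thesis by simp
  qed
  have "is_solution u"
    unfolding is_solution_def
  proof (intro allI ballI)
    fix E x assume x: "x \<in> D"
    define g where "g j = deriv (h j) x" for j
    have g0: "g 0 = 0" by (simp add: g_def)
    have "deriv (family u E) x = (\<Sum>j<n. p E j * g j)"
      unfolding g_def by (rule linear_combination_derivs(1)[OF _ ell_h _ x]) (use fam in auto)
    moreover have "Lop (family u E) x = (\<Sum>j<n. p E j * Lop (h j) x)"
      by (rule linear_combination_derivs(2)[OF _ ell_h _ x]) (use fam in auto)
    moreover have "Lop (h j) x = - 4 * g (Suc j)" for j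
      using h_recursion[OF x, of j] by (simp add: g_def del: hseq.simps(2))
    ultimately have "Lop (family u E) x + 4 * E * deriv (family u E) x = 4 * (\<Sum>j<n. p E j * (E * g j - g (Suc j)))"
      by (simp add: sum_distrib_left sum.distrib[symmetric] algebra_simps)
    also have "(\<Sum>j<n. p E j * (E * g j - g (Suc j))) =
        - (\<Sum>j<n. (if j \<le> n then \<delta> j else 0) * g j) - (if n = 0 then 0 else p E (n - 1) * g n)"
      by (rule telescope[where \<delta> = "\<lambda>j. if j \<le> n then \<delta> j else 0"]) (use p_step g0 in auto)
    also have "(\<Sum>j<n. (if j \<le> n then \<delta> j else 0) * g j) = (\<Sum>j<n. \<delta> j * g j)" by (intro sum.cong) auto
    also have "p E (n - 1) = \<delta> n" using n by (simp add: p_def)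
    also have "- (\<Sum>j<n. \<delta> j * g j) - (if n = 0 then 0 else \<delta> n * g n) = - (\<Sum>k\<le>n. \<delta> k * g k)"
      using n by (simp add: lessThan_Suc_atMost[symmetric])
    also have "\<dots> = 0" using rel'[OF x] by (simp add: g_def)
    finally show "Lop (family u E) x + 4 * E * deriv (family u E) x = 0" by simp
  qed
  moreover have "lead_coeff (u None) = 1"
  proof -
    have cP: "coeff (P j) m = (if Suc j + m \<le> n then \<delta> (Suc j + m) else 0)" for j m
    proof -
      have "coeff (P j) m = (\<Sum>k\<in>{Suc j..n}. if k = Suc j + m then \<delta> k else 0)"
        unfolding P_def coeff_sum by (intro sum.cong refl) auto
      thus ?thesis by simp
    qed
    have c: "coeff (u None) m = (\<Sum>j<n. v j None * (if Suc j + m \<le> n then \<delta> (Suc j + m) else 0))" for m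
      by (simp add: u_def coeff_sum cP)
    \<comment> \<open>In degree n - 1 only j = 0 contributes, through \<delta>_n = 1 and the
      constant function h_0 = 1.\<close>
    have top: "coeff (u None) (n - 1) = 1"
    proof -
      have "coeff (u None) (n - 1) = (\<Sum>j<n. if j = 0 then 1 else 0)"
        unfolding c using n v0 \<delta>(1) by (intro sum.cong) auto
      thus ?thesis using n by simp
    qed
    have "degree (u None) \<le> n - 1"
      by (rule degree_le) (auto simp: c intro!: sum.neutral)
    moreover have "degree (u None) \<ge> n - 1" by (rule le_degree) (use top in simp)
    ultimately show ?thesis using top by simp
  qed
  ultimately show ?thesis using that by blast
qed

text \<open>Take a monic solution whose constant term has least degree. Dividing the constant term
  of another solution by it leaves a solution with a constant term of smaller degree, hence 0, and
  \<open>is_solution_zero\<close> makes this remainder vanish altogether.\<close>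

lemma minimal_solution:
  obtains u where "is_solution u" "lead_coeff (u None) = 1"
    "\<And>v. is_solution v \<Longrightarrow> \<exists>q. \<forall>\<kappa>\<in>basis_index. v \<kappa> = q * u \<kappa>"
    "\<And>v. is_solution v \<Longrightarrow> v None \<noteq> 0 \<Longrightarrow> degree (u None) \<le> degree (v None)"
proof -
  obtain u where u: "is_solution u" "lead_coeff (u None) = 1"
    and min: "\<And>v. is_solution v \<and> lead_coeff (v None) = 1 \<Longrightarrow> degree (u None) \<le> degree (v None)"
    using ex_has_least_nat[of "\<lambda>u. is_solution u \<and> lead_coeff (u None) = 1" _ "\<lambda>u. degree (u None)"]
      solution_exists by metis
  have min': "degree (u None) \<le> degree (v None)" if v: "is_solution v" "v None \<noteq> 0" for v
  proof -
    define a where "a = lead_coeff (v None)"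
    have a: "a \<noteq> 0" using v(2) by (simp add: a_def)
    have "is_solution (\<lambda>\<kappa>. smult (inverse a) (v \<kappa>))"
      by (rule is_solution_cancel[OF v(1), of "[:a:]"]) (use a in auto)
    from min[of "\<lambda>\<kappa>. smult (inverse a) (v \<kappa>)"] this a show ?thesis by (simp add: a_def)
  qed
  have mult: "\<exists>q. \<forall>\<kappa>\<in>basis_index. v \<kappa> = q * u \<kappa>" if v: "is_solution v" for v
  proof -
    define q where "q = v None div u None"
    define w where "w \<kappa> = v \<kappa> - q * u \<kappa>" for \<kappa>
    have w: "is_solution w" unfolding w_def by (rule is_solution_diff_mult[OF v u(1)])
    have w0: "w None = v None mod u None"
      by (simp add: w_def q_def minus_div_mult_eq_mod)
    have "u None \<noteq> 0" using u(2) by auto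
    have "w None = 0"
    proof (rule ccontr)
      assume *: "w None \<noteq> 0"
      from min'[OF w *] degree_mod_less[OF \<open>u None \<noteq> 0\<close>, of "v None"] * show False
        unfolding w0 by auto
    qed
    from is_solution_zero[OF w this] show ?thesis by (intro exI[of _ q]) (simp add: w_def)
  qed
  show ?thesis by (rule that[of u]) (use u mult min' in blast)+
qed

section \<open>Existence, uniqueness and properties of \<Xi>\<close>

lemma heun_Xi_of_eq:
  "heun_Xi_of w1 w3 l c0 b x E = family (\<lambda>\<kappa>. case \<kappa> of None \<Rightarrow> c0 | Some (i, j) \<Rightarrow> b i j) E x"
proof -
  have "(\<Sum>i=0..3. \<Sum>j<l i. poly (b i j) E * wp (x + hp i) ^ (l i - j))
      = (\<Sum>(i, j)\<in>(SIGMA i:{0..3}. {..<l i}). poly (b i j) E * wp (x + hp i) ^ (l i - j))"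
    by (rule sum.Sigma) auto
  also have "\<dots> = (\<Sum>\<kappa>\<in>Some ` (SIGMA i:{0..3}. {..<l i}). poly (case \<kappa> of None \<Rightarrow> c0 | Some (i, j) \<Rightarrow> b i j) E * basis_fun \<kappa> x)"
    by (subst sum.reindex) (auto simp: basis_fun_def intro!: sum.cong)
  finally show ?thesis
    unfolding heun_Xi_of_def family_def lin_def basis_index_def
    by (subst sum.insert) (auto simp: basis_fun_def)
qed

lemma deriv_V:
  assumes "x \<in> D"
  shows "deriv V x = (\<Sum>i=0..3. of_nat (l i * (l i + 1)) * deriv wp (x + hp i))"
proof -
  have "((\<lambda>x. of_nat (l i * (l i + 1)) * wp (x + hp i)) has_field_derivative
      of_nat (l i * (l i + 1)) * deriv wp (x + hp i)) (at x)" if "i \<in> {0..3}" for i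
  proof (cases "l i = 0")
    case False
    hence "x + hp i \<notin> Lat" using D_I[OF assms] that by simp
    hence "(wp has_field_derivative deriv wp (x + hp i)) (at (x + hp i))"
      using wp_deriv DERIV_imp_deriv by metis
    thus ?thesis by (intro DERIV_cmult DERIV_shift[THEN iffD1])
  qed simp
  hence "((\<lambda>x. \<Sum>i=0..3. of_nat (l i * (l i + 1)) * wp (x + hp i)) has_field_derivative
      (\<Sum>i=0..3. of_nat (l i * (l i + 1)) * deriv wp (x + hp i))) (at x)" by (intro DERIV_sum) auto
  thus ?thesis unfolding heun_potential_def[abs_def] by (rule DERIV_imp_deriv)
qed

lemma is_heun_Xi_iff:
  "is_heun_Xi w1 w3 l X \<longleftrightarrow> (\<exists>u. X = (\<lambda>x E. family u E x) \<and> lead_coeff (u None) = 1 \<and>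
     (\<forall>d. (\<forall>\<kappa>\<in>basis_index. d dvd u \<kappa>) \<longrightarrow> is_unit d) \<and> is_solution u)"
proof -
  have ode: "(deriv ^^ 3) f x - 4 * (V x - E) * deriv f x
        - 2 * (\<Sum>i=0..3. of_nat (l i * (l i + 1)) * deriv wp (x + hp i)) * f x
      = Lop f x + 4 * E * deriv f x" if "x \<in> D" for f E x
    unfolding deriv_V[OF that, symmetric] by (simp add: Lop_def numeral_3_eq_3 algebra_simps)
  have dvd: "(\<forall>\<kappa>\<in>basis_index. d dvd (case \<kappa> of None \<Rightarrow> c0 | Some (i, j) \<Rightarrow> b i j)) \<longleftrightarrow>
      d dvd c0 \<and> (\<forall>i\<le>3. \<forall>j<l i. d dvd b i j)" for d c0 :: "complex poly" and b
    by (auto simp: basis_index_def)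
  show ?thesis
  proof
    assume X: "is_heun_Xi w1 w3 l X"
    then obtain c0 b where cb: "X = heun_Xi_of w1 w3 l c0 b" "lead_coeff c0 = 1"
      "\<And>d. d dvd c0 \<and> (\<forall>i\<le>3. \<forall>j<l i. d dvd b i j) \<Longrightarrow> is_unit d"
      unfolding is_heun_Xi_def by blast
    define u where "u = (\<lambda>\<kappa>. case \<kappa> of None \<Rightarrow> c0 | Some (i, j) \<Rightarrow> b i j)"
    have Xu: "X = (\<lambda>x E. family u E x)" unfolding cb(1) u_def by (intro ext) (rule heun_Xi_of_eq)
    have "is_solution u"
      unfolding is_solution_def
    proof (intro allI ballI)
      fix E x assume x: "x \<in> D"
      have "(deriv ^^ 3) (family u E) x - 4 * (V x - E) * deriv (family u E) x
        - 2 * (\<Sum>i=0..3. of_nat (l i * (l i + 1)) * deriv wp (x + hp i)) * family u E x = 0"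
        using X x unfolding is_heun_Xi_def Xu by blast
      thus "Lop (family u E) x + 4 * E * deriv (family u E) x = 0" unfolding ode[OF x] .
    qed
    thus "\<exists>u. X = (\<lambda>x E. family u E x) \<and> lead_coeff (u None) = 1 \<and>
     (\<forall>d. (\<forall>\<kappa>\<in>basis_index. d dvd u \<kappa>) \<longrightarrow> is_unit d) \<and> is_solution u"
      using Xu cb(2,3) dvd[of _ c0 b] by (intro exI[of _ u]) (auto simp: u_def)
  next
    assume "\<exists>u. X = (\<lambda>x E. family u E x) \<and> lead_coeff (u None) = 1 \<and>
     (\<forall>d. (\<forall>\<kappa>\<in>basis_index. d dvd u \<kappa>) \<longrightarrow> is_unit d) \<and> is_solution u"
    then obtain u where u: "X = (\<lambda>x E. family u E x)" "lead_coeff (u None) = 1"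
     "\<And>d. (\<forall>\<kappa>\<in>basis_index. d dvd u \<kappa>) \<Longrightarrow> is_unit d" "is_solution u" by blast
    define b where "b i j = u (Some (i, j))" for i j
    have ub: "(\<lambda>\<kappa>. case \<kappa> of None \<Rightarrow> u None | Some (i, j) \<Rightarrow> b i j) = u"
      by (auto simp: b_def fun_eq_iff split: option.splits)
    have "X = heun_Xi_of w1 w3 l (u None) b"
      unfolding u(1) by (intro ext) (simp add: heun_Xi_of_eq ub)
    moreover have "\<forall>d. d dvd u None \<and> (\<forall>i\<le>3. \<forall>j<l i. d dvd b i j) \<longrightarrow> is_unit d"
      using u(3) dvd[of _ "u None" b] unfolding ub by blast
    moreover have "\<forall>E. \<forall>x\<in>D. (deriv ^^ 3) (\<lambda>y. X y E) x - 4 * (V x - E) * deriv (\<lambda>y. X y E) x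
        - 2 * (\<Sum>i=0..3. of_nat (l i * (l i + 1)) * deriv wp (x + hp i)) * X x E = 0"
      using u(4) ode unfolding is_solution_def u(1) by simp
    ultimately show "is_heun_Xi w1 w3 l X" unfolding is_heun_Xi_def using u(2) by blast
  qed
qed

text \<open>The minimal solution has no common divisor, because cancelling one would lower the
  degree of its constant term. Any other candidate is q times it; then q is a common divisor, hence
  a constant, and both leading coefficients being 1 forces q = 1.\<close>

lemma is_heun_Xi_heun_Xi: "is_heun_Xi w1 w3 l (heun_Xi w1 w3 l)"
  unfolding heun_Xi_def
proof (rule theI'[of "is_heun_Xi w1 w3 l"])
  obtain u where u: "is_solution u" "lead_coeff (u None) = 1"
    "\<And>v. is_solution v \<Longrightarrow> \<exists>q. \<forall>\<kappa>\<in>basis_index. v \<kappa> = q * u \<kappa>"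
    "\<And>v. is_solution v \<Longrightarrow> v None \<noteq> 0 \<Longrightarrow> degree (u None) \<le> degree (v None)"
    by (rule minimal_solution) blast
  note None = None_in_basis_index
  have uN: "u None \<noteq> 0" using u(2) by auto
  have prim: "is_unit d" if d: "\<forall>\<kappa>\<in>basis_index. d dvd u \<kappa>" for d
  proof -
    have "\<forall>\<kappa>\<in>basis_index. \<exists>a. u \<kappa> = d * a" using d by (auto simp: dvd_def)
    then obtain v where v: "\<And>\<kappa>. \<kappa> \<in> basis_index \<Longrightarrow> u \<kappa> = d * v \<kappa>" by metis
    have d0: "d \<noteq> 0" "v None \<noteq> 0" using v[OF None] uN by auto
    have "is_solution v" by (rule is_solution_cancel[OF u(1) v d0(1)])
    from u(4)[OF this d0(2)] have "degree d = 0" using v[OF None] d0 by (simp add: degree_mult_eq)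
    thus ?thesis using d0(1) by (simp add: is_unit_iff_degree)
  qed
  show "\<exists>!X. is_heun_Xi w1 w3 l X"
  proof (rule ex1I[of _ "\<lambda>x E. family u E x"])
    show "is_heun_Xi w1 w3 l (\<lambda>x E. family u E x)"
      unfolding is_heun_Xi_iff using u prim by blast
    fix X assume "is_heun_Xi w1 w3 l X"
    then obtain v where v: "X = (\<lambda>x E. family v E x)" "lead_coeff (v None) = 1"
     "\<And>d. (\<forall>\<kappa>\<in>basis_index. d dvd v \<kappa>) \<Longrightarrow> is_unit d" "is_solution v"
      unfolding is_heun_Xi_iff by blast
    obtain q where q: "\<And>\<kappa>. \<kappa> \<in> basis_index \<Longrightarrow> v \<kappa> = q * u \<kappa>" using u(3)[OF v(4)] by blast
    have "is_unit q" using v(3)[of q] q by simp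
    moreover have "q \<noteq> 0" using q[OF None] v(2) by auto
    ultimately obtain a where a: "q = [:a:]" using is_unit_iff_degree degree_eq_zeroE by blast
    have "lead_coeff (v None) = a * lead_coeff (u None)"
      unfolding q[OF None] a by (simp add: lead_coeff_mult[of "[:a:]", simplified])
    hence "q = 1" using v(2) u(2) a by simp
    hence "family v E x = family u E x" for E x using q by (simp add: family_def lin_def)
    thus "X = (\<lambda>x E. family u E x)" by (simp add: v(1))
  qed
qed

lemma heun_Xi_properties:
  shows "ell 1 (\<lambda>x. heun_Xi w1 w3 l x E)"
    "\<And>i. i \<le> 3 \<Longrightarrow> l i > 0 \<Longrightarrow> ord_ge (\<lambda>x. heun_Xi w1 w3 l x E) (- hp i) (- 2 * int (l i))"
    "\<And>x. x \<in> D \<Longrightarrow> Lop (\<lambda>x. heun_Xi w1 w3 l x E) x + 4 * E * deriv (\<lambda>x. heun_Xi w1 w3 l x E) x = 0"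
    "\<exists>x\<in>D. heun_Xi w1 w3 l x E \<noteq> 0"
proof -
  obtain u where u: "heun_Xi w1 w3 l = (\<lambda>x E. family u E x)" "lead_coeff (u None) = 1"
     "\<And>d. (\<forall>\<kappa>\<in>basis_index. d dvd u \<kappa>) \<Longrightarrow> is_unit d" "is_solution u"
    using is_heun_Xi_heun_Xi unfolding is_heun_Xi_iff by blast
  show "ell 1 (\<lambda>x. heun_Xi w1 w3 l x E)"
    using ell_lin by (simp add: u(1) family_def)
  show "ord_ge (\<lambda>x. heun_Xi w1 w3 l x E) (- hp i) (- 2 * int (l i))" if "i \<le> 3" "l i > 0" for i
    using lin_ord_ge[OF that] by (simp add: u(1) family_def)
  show "Lop (\<lambda>x. heun_Xi w1 w3 l x E) x + 4 * E * deriv (\<lambda>x. heun_Xi w1 w3 l x E) x = 0" if "x \<in> D" for x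
    using u(4) that unfolding is_solution_def u(1) by simp
  show "\<exists>x\<in>D. heun_Xi w1 w3 l x E \<noteq> 0"
  proof (rule ccontr)
    assume "\<not> ?thesis"
    hence "lin (\<lambda>\<kappa>. poly (u \<kappa>) E) x = 0" if "x \<in> D" for x using that by (simp add: u(1) family_def)
    hence "poly (u \<kappa>) E = 0" if "\<kappa> \<in> basis_index" for \<kappa> using lin_independent that by blast
    \<comment> \<open>If \<Xi> vanished identically at this E, all its coefficients would share the
      root E, against the absence of a common divisor.\<close>
    hence "\<forall>\<kappa>\<in>basis_index. [:- E, 1:] dvd u \<kappa>" by (simp add: poly_eq_0_iff_dvd)
    from u(3)[OF this] show False by (simp add: is_unit_iff_degree)
  qed
qed

end


section \<open>Solutions at a regular eigenvalue\<close>


lemma local_form_shift: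
  assumes "local_form f (z + p) N F" shows "local_form (\<lambda>s. f (s + p)) z N (\<lambda>s. F (s + p))"
  using local_formD[OF assms] unfolding local_form_def eventually_at_shift
  by (auto intro: analytic_at_shift)

lemma local_form_eventually_nonzero:
  assumes "local_form f z N F" "F z \<noteq> 0" shows "\<forall>\<^sub>F s in at z. f s \<noteq> 0"
  using local_formD(2)[OF assms(1)] analytic_at_neq_imp_eventually_neq[OF local_formD(1)[OF assms(1)] assms(2)]
    eventually_at_neq
  by eventually_elim auto

context heun
begin

text \<open>The x-derivative of the expression is \<Xi> / 2 times the left side of the third order
  equation, so it is constant on the connected domain.\<close>

lemma heun_Q_eq:
  fixes E defines "X \<equiv> \<lambda>x. heun_Xi w1 w3 l x E"
  assumes x: "x \<in> D"
  shows "heun_Q w1 w3 l E = X x ^ 2 * (E - V x) + 1 / 2 * X x * deriv (deriv X) x - 1 / 4 * (deriv X x) ^ 2"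
proof -
  define q where "q x = X x ^ 2 * (E - V x) + 1 / 2 * X x * deriv (deriv X) x - 1 / 4 * (deriv X x) ^ 2" for x
  have X: "ell 1 X" unfolding X_def by (rule heun_Xi_properties)
  have aux: "a * a * (0 - v') + (a * b + b * a) * (E - v) + 1 / 2 * (a * d + b * c) - 1 / 4 * (b * c + c * b)
      = 1 / 2 * a * (d - 4 * v * b - 2 * v' * a + 4 * E * b)" for a b c d v v' :: complex
    by (simp add: field_simps)
  have "(q has_field_derivative 0) (at y)" if y: "y \<in> D" for y
  proof -
    have d: "(X has_field_derivative deriv X y) (at y)" "(deriv X has_field_derivative deriv (deriv X) y) (at y)"
      "(deriv (deriv X) has_field_derivative deriv (deriv (deriv X)) y) (at y)"
      "(V has_field_derivative deriv V y) (at y)"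
      using ell_DERIV[OF X y] ell_DERIV[OF ell_deriv[OF X] y] ell_DERIV[OF ell_deriv[OF ell_deriv[OF X]] y]
        ell_DERIV[OF ell_V y] .
    have q: "q = (\<lambda>x. X x * X x * (E - V x) + 1 / 2 * (X x * deriv (deriv X) x) - 1 / 4 * (deriv X x * deriv X x))"
      by (simp add: q_def fun_eq_iff power2_eq_square mult.assoc)
    have "(q has_field_derivative X y * X y * (0 - deriv V y) + (X y * deriv X y + deriv X y * X y) * (E - V y)
        + 1 / 2 * (X y * deriv (deriv (deriv X)) y + deriv X y * deriv (deriv X) y)
        - 1 / 4 * (deriv X y * deriv (deriv X) y + deriv (deriv X) y * deriv X y)) (at y)"
      unfolding q
      by (rule DERIV_diff[OF DERIV_add[OF DERIV_mult'[OF DERIV_mult'[OF d(1,1)] DERIV_diff[OF DERIV_const d(4)]]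
          DERIV_cmult[OF DERIV_mult'[OF d(1,3)]]] DERIV_cmult[OF DERIV_mult'[OF d(2,2)]]])
    also have "X y * X y * (0 - deriv V y) + (X y * deriv X y + deriv X y * X y) * (E - V y)
        + 1 / 2 * (X y * deriv (deriv (deriv X)) y + deriv X y * deriv (deriv X) y)
        - 1 / 4 * (deriv X y * deriv (deriv X) y + deriv (deriv X) y * deriv X y)
        = 1 / 2 * X y * (Lop X y + 4 * E * deriv X y)"
      unfolding Lop_def by (rule aux)
    also have "\<dots> = 0" using heun_Xi_properties(3)[OF y, of E] by (simp add: X_def)
    finally show ?thesis .
  qed
  hence const: "q y = q x" if "y \<in> D" for y using constant_on_D[of q] x that by blast
  have "(deriv ^^ 2) f = deriv (deriv f)" for f :: "complex \<Rightarrow> complex"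
    by (simp add: numeral_2_eq_2)
  hence "heun_Q w1 w3 l E = (THE c. \<forall>x\<in>D. c = q x)"
    unfolding heun_Q_def q_def X_def by (simp only:)
  also have "\<dots> = q x"
  proof (rule the_equality)
    show "\<forall>y\<in>D. q x = q y"
    proof
      fix y assume "y \<in> D"
      thus "q x = q y" by (rule const[symmetric])
    qed
    show "c = q x" if "\<forall>y\<in>D. c = q y" for c using that x by blast
  qed
  finally show ?thesis by (simp add: q_def)
qed

section \<open>Reflection and Wronskians of solutions\<close>

lemma heun_solutions_reflect:
  assumes "f \<in> heun_solutions w1 w3 l E D" shows "(\<lambda>x. f (- x)) \<in> heun_solutions w1 w3 l E D"
proof -
  have f: "f holomorphic_on D" and sol: "\<And>x. x \<in> D \<Longrightarrow> heun_H w1 w3 l f x - E * f x = 0"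
    using assms by (auto simp: heun_solutions_def)
  have f': "deriv f holomorphic_on D" by (rule holomorphic_deriv[OF f open_heun_domain])
  have refl: "((\<lambda>x. g (- x)) has_field_derivative - deriv g (- x)) (at x)"
    if g: "g holomorphic_on D" and x: "x \<in> D" for g x
  proof -
    have "(g has_field_derivative deriv g (- x)) (at (- x))"
      using holomorphic_derivI[OF g open_heun_domain] x D_minus by blast
    hence "((\<lambda>x. g (- x)) has_field_derivative deriv g (- x) * - 1) (at x)"
      by (rule DERIV_chain2) (auto intro!: derivative_eq_intros)
    thus ?thesis by simp
  qed
  have "(deriv ^^ 2) (\<lambda>x. f (- x)) x = (deriv ^^ 2) f (- x)" if x: "x \<in> D" for x
  proof (rule deriv2_eqI[OF open_heun_domain x refl[OF f]])
    from DERIV_minus[OF refl[OF f' x]]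
    show "((\<lambda>x. - deriv f (- x)) has_field_derivative (deriv ^^ 2) f (- x)) (at x)"
      by (simp add: numeral_2_eq_2)
  qed
  moreover have "V (- x) = V x" if "x \<in> D" for x using ellD(2)[OF ell_V that] by simp
  moreover have "(\<lambda>x. f (- x)) holomorphic_on D"
    using refl[OF f] open_heun_domain by (auto simp: holomorphic_on_open)
  ultimately show ?thesis using sol D_minus unfolding heun_solutions_def heun_H_def by simp metis
qed

lemma heun_solutions_subset:
  "f \<in> heun_solutions w1 w3 l E D \<Longrightarrow> U \<subseteq> D \<Longrightarrow> f \<in> heun_solutions w1 w3 l E U"
  unfolding heun_solutions_def using holomorphic_on_subset by blast

lemma wronskian_constant:
  assumes "f \<in> heun_solutions w1 w3 l E U" "g \<in> heun_solutions w1 w3 l E U"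
    "open U" "connected U" "x \<in> U" "y \<in> U"
  shows "f x * deriv g x - deriv f x * g x = f y * deriv g y - deriv f y * g y"
proof -
  have "((\<lambda>x. f x * deriv g x - deriv f x * g x) has_field_derivative 0) (at x)" if x: "x \<in> U" for x
  proof -
    have f: "f holomorphic_on U" and g: "g holomorphic_on U"
      using assms(1,2) by (auto simp: heun_solutions_def)
    have d: "(f has_field_derivative deriv f x) (at x)" "(g has_field_derivative deriv g x) (at x)"
      "(deriv f has_field_derivative (V x - E) * f x) (at x)" "(deriv g has_field_derivative (V x - E) * g x) (at x)"
    proof -
      show "(f has_field_derivative deriv f x) (at x)" "(g has_field_derivative deriv g x) (at x)"
        using holomorphic_derivI[OF f assms(3) x] holomorphic_derivI[OF g assms(3) x] .
      have "deriv (deriv f) x = (V x - E) * f x" "deriv (deriv g) x = (V x - E) * g x"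
        using assms(1,2) x by (auto simp: heun_solutions_def heun_H_def numeral_2_eq_2 algebra_simps)
      thus "(deriv f has_field_derivative (V x - E) * f x) (at x)" "(deriv g has_field_derivative (V x - E) * g x) (at x)"
        using holomorphic_derivI[OF holomorphic_deriv[OF f assms(3)] assms(3) x]
          holomorphic_derivI[OF holomorphic_deriv[OF g assms(3)] assms(3) x] by simp_all
    qed
    from DERIV_diff[OF DERIV_mult'[OF d(1,4)] DERIV_mult'[OF d(3,2)]]
    show ?thesis by (rule DERIV_cong) (simp add: algebra_simps)
  qed
  hence "(\<lambda>x. f x * deriv g x - deriv f x * g x) constant_on U"
    by (rule has_field_derivative_0_imp_constant_on) (use assms in auto)
  thus ?thesis using assms(5,6) by (auto simp: constant_on_def)
qed

lemma is_heun_solution_basisI: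
  assumes "f \<in> heun_solutions w1 w3 l E U" "g \<in> heun_solutions w1 w3 l E U"
    "open U" "connected U" "x0 \<in> U" "f x0 * deriv g x0 - deriv f x0 * g x0 \<noteq> 0"
  shows "is_heun_solution_basis w1 w3 l E U f g"
  unfolding is_heun_solution_basis_def
proof (intro conjI allI impI ballI)
  define W where "W = f x0 * deriv g x0 - deriv f x0 * g x0"
  have hol: "f holomorphic_on U" "g holomorphic_on U" using assms(1,2) by (auto simp: heun_solutions_def)
  {
    fix a b assume ab: "\<forall>x\<in>U. a * f x + b * g x = 0"
    have "((\<lambda>x. a * f x + b * g x) has_field_derivative a * deriv f x0 + b * deriv g x0) (at x0)"
      by (intro DERIV_add DERIV_cmult holomorphic_derivI[OF hol(1) assms(3,5)] holomorphic_derivI[OF hol(2) assms(3,5)])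
    moreover have "((\<lambda>x. a * f x + b * g x) has_field_derivative 0) (at x0)"
      by (rule has_field_derivative_transform_within_open[OF DERIV_const assms(3,5)]) (use ab in auto)
    ultimately have 1: "a * deriv f x0 + b * deriv g x0 = 0" using DERIV_unique by blast
    have 2: "a * f x0 + b * g x0 = 0" using ab assms(5) by blast
    have "a * W = 0" "b * W = 0" unfolding W_def using 1 2 by algebra+
    thus "a = 0" "b = 0" using assms(6) by (auto simp: W_def)
  }
  fix k assume k: "k \<in> heun_solutions w1 w3 l E U"
  \<comment> \<open>Cramer's rule at x0. The equation has no first order term, so all three
    Wronskians are constant on the connected set U and the same coefficients work
    everywhere.\<close>
  define a where "a = (k x0 * deriv g x0 - deriv k x0 * g x0) / W"
  define b where "b = (f x0 * deriv k x0 - deriv f x0 * k x0) / W"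
  have "k x = a * f x + b * g x" if x: "x \<in> U" for x
  proof -
    have "a * W = k x * deriv g x - deriv k x * g x" "b * W = f x * deriv k x - deriv f x * k x"
      "W = f x * deriv g x - deriv f x * g x"
      using wronskian_constant[OF k assms(2,3,4,5) x] wronskian_constant[OF assms(1) k assms(3,4,5) x]
        wronskian_constant[OF assms(1,2,3,4,5) x] assms(6)
      by (simp_all add: a_def b_def W_def)
    hence "W * k x = W * (a * f x + b * g x)" by algebra
    thus ?thesis using assms(6) by (simp add: W_def)
  qed
  thus "\<exists>a b. \<forall>x\<in>U. k x = a * f x + b * g x" by blast
qed (use assms in auto)

end

locale heun_regular = heun +
  fixes E :: complex
  assumes Q_nonzero: "heun_Q w1 w3 l E \<noteq> 0"
begin

definition X where "X x = heun_Xi w1 w3 l x E"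

definition q where "q = heun_Q w1 w3 l E"

text \<open>Where \<open>X\<close> vanishes on D, the formula for q reads X'^2 = -4 q; this is one
  of the two possible slopes there, and it will be the Wronskian.\<close>

definition wr where "wr = csqrt (- 4 * q)"

lemma wr: "wr ^ 2 = - 4 * q" "wr \<noteq> 0"
proof -
  show 1: "wr ^ 2 = - 4 * q" by (simp add: wr_def)
  show "wr \<noteq> 0" using 1 Q_nonzero by (auto simp: q_def)
qed

lemma ell_X: "ell 1 X"
  unfolding X_def[abs_def] by (rule heun_Xi_properties)

lemma q_eq: "x \<in> D \<Longrightarrow> X x ^ 2 * (E - V x) + 1 / 2 * X x * deriv (deriv X) x - 1 / 4 * (deriv X x) ^ 2 = q"
  using heun_Q_eq[of x E] by (simp add: q_def X_def[abs_def])

text \<open>Leading terms of the expression for q: -l_i (l_i + 1) + N (N - 1) / 2 - N^2 / 4 is one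
  quarter of (N + 2 l_i) (N - 2 l_i - 2).\<close>

lemma q_local_form:
  assumes "local_form X (- hp i) N F" "i \<le> 3"
  obtains G where "local_form (\<lambda>_. q) (- hp i) (2 * N - 2) G"
    "G (- hp i) = F (- hp i) ^ 2 * (of_int (N + 2 * int (l i)) * of_int (N - 2 * int (l i) - 2)) / 4"
proof -
  define z where "z = - hp i"
  have F: "local_form X z N F" using assms(1) by (simp add: z_def)
  obtain v where v: "local_form V z (- 2) v" "v z = of_nat (l i * (l i + 1))"
    using V_local_form[OF assms(2)] by (auto simp: z_def)
  define A1 where "A1 = (\<lambda>s. of_int N * F s + (s - z) * deriv F s)"
  define A2 where "A2 = (\<lambda>s. of_int (N - 1) * A1 s + (s - z) * deriv A1 s)"
  have A1: "local_form (deriv X) z (N - 1) A1" using local_form_deriv[OF F] by (simp add: A1_def)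
  have A2: "local_form (deriv (deriv X)) z (N - 2) A2" using local_form_deriv[OF A1] by (simp add: A2_def)
  \<comment> \<open>The constant is written with a formal double pole so that it can be added to the
    local form of the potential.\<close>
  have Em: "local_form (\<lambda>_. E) z (- 2) (\<lambda>s. (s - z) ^ 2 * E)"
    unfolding local_form_def
  proof
    show "\<forall>\<^sub>F s in at z. E = (s - z) powi - 2 * ((s - z)\<^sup>2 * E)"
      using eventually_at_neq by eventually_elim (simp add: power_int_minus)
  qed (intro analytic_intros)
  define G where "G = (\<lambda>s. F s * F s * ((s - z) ^ 2 * E + - 1 * v s) + 1 / 2 * (F s * A2 s) + - (1 / 4) * (A1 s * A1 s))"
  have N: "N + N + - 2 = 2 * N - 2" "N + (N - 2) = 2 * N - 2" "N - 1 + (N - 1) = 2 * N - 2" by simp_all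
  have 1: "local_form (\<lambda>s. X s * X s * (E + - 1 * V s)) z (2 * N - 2) (\<lambda>s. F s * F s * ((s - z) ^ 2 * E + - 1 * v s))"
    using local_form_mult[OF local_form_mult[OF F F] local_form_add[OF Em local_form_cmult[OF v(1), of "- 1"]], unfolded N] .
  have 2: "local_form (\<lambda>s. 1 / 2 * (X s * deriv (deriv X) s)) z (2 * N - 2) (\<lambda>s. 1 / 2 * (F s * A2 s))"
    using local_form_cmult[OF local_form_mult[OF F A2], of "1 / 2", unfolded N] .
  have 3: "local_form (\<lambda>s. - (1 / 4) * (deriv X s * deriv X s)) z (2 * N - 2) (\<lambda>s. - (1 / 4) * (A1 s * A1 s))"
    using local_form_cmult[OF local_form_mult[OF A1 A1], of "- (1 / 4)", unfolded N] .
  have "local_form (\<lambda>s. X s * X s * (E + - 1 * V s) + 1 / 2 * (X s * deriv (deriv X) s)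
      + - (1 / 4) * (deriv X s * deriv X s)) z (2 * N - 2) G"
    unfolding G_def by (intro local_form_add 1 2 3)
  moreover have "\<forall>\<^sub>F s in at z. q = X s * X s * (E + - 1 * V s) + 1 / 2 * (X s * deriv (deriv X) s)
      + - (1 / 4) * (deriv X s * deriv X s)"
    using eventually_D by eventually_elim (use q_eq in \<open>simp add: power2_eq_square mult.assoc\<close>)
  ultimately have "local_form (\<lambda>_. q) z (2 * N - 2) G" by (rule local_form_cong)
  moreover have "G z = F z ^ 2 * (of_int (N + 2 * int (l i)) * of_int (N - 2 * int (l i) - 2)) / 4"
    by (simp add: G_def A2_def A1_def v(2) field_simps power2_eq_square)
  ultimately show ?thesis using that by (simp add: z_def)
qed

text \<open>
  An order of \<open>X\<close> at \<open>-\<omega>\<^sub>i\<close> other than \<open>-2 l\<^sub>i\<close> would have to exceed \<open>1\<close>, and then \<open>Q\<close> would vanish.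
\<close>

lemma X_pole:
  assumes "i \<le> 3" "l i > 0"
  obtains F where "local_form X (- hp i) (- 2 * int (l i)) F" "F (- hp i) \<noteq> 0"
proof -
  have "ord_ge X (- hp i) (- 2 * int (l i))"
    using heun_Xi_properties(2)[OF assms] by (simp add: X_def[abs_def])
  then obtain F where F: "local_form X (- hp i) (- 2 * int (l i)) F" by (auto simp: ord_ge_def)
  have "F (- hp i) \<noteq> 0"
  proof
    assume "F (- hp i) = 0"
    from local_form_improve[OF F this] have base: "ord_ge X (- hp i) (1 - 2 * int (l i))" by simp
    have "ord_ge X (- hp i) (1 - 2 * int (l i) + int k)" if "k \<le> 2 * l i" for k
      using that
    proof (induction k)
      case (Suc k)
      define N where "N = 1 - 2 * int (l i) + int k"
      obtain F where F: "local_form X (- hp i) N F" using Suc by (auto simp: ord_ge_def N_def)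
      obtain G where G: "local_form (\<lambda>_. q) (- hp i) (2 * N - 2) G"
        "G (- hp i) = F (- hp i) ^ 2 * (of_int (N + 2 * int (l i)) * of_int (N - 2 * int (l i) - 2)) / 4"
        by (rule q_local_form[OF F assms(1)])
      have N: "N \<le> 0" "N + 2 * int (l i) \<noteq> 0" "N - 2 * int (l i) - 2 \<noteq> 0"
        using Suc.prems assms(2) by (auto simp: N_def)
      \<comment> \<open>The order 2 N - 2 is negative while q is a constant; between the two
        indicial roots this forces the leading coefficient of \<open>X\<close> to vanish.\<close>
      have "G (- hp i) = 0" by (rule local_form_order_unique[OF G(1) ord_ge_const[of 0 q]]) (use N in auto)
      moreover have "(of_int (N + 2 * int (l i)) :: complex) \<noteq> 0" "(of_int (N - 2 * int (l i) - 2) :: complex) \<noteq> 0"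
        using N(2,3) by (simp_all only: of_int_eq_0_iff not_False_eq_True)
      ultimately have "F (- hp i) = 0"
        unfolding G(2) by (simp del: of_int_add of_int_diff)
      from local_form_improve[OF F this] show ?case by (simp add: N_def algebra_simps)
    qed (use base in auto)
    from this[of "2 * l i"] have "ord_ge X (- hp i) 1" by simp
    from even_ell_improve[OF ell_X this] have "ord_ge X (- hp i) 2" by simp
    then obtain F where "local_form X (- hp i) 2 F" by (auto simp: ord_ge_def)
    then obtain G where "local_form (\<lambda>_. q) (- hp i) (2 * 2 - 2) G"
      using q_local_form assms(1) by metis
    hence "ord_ge (\<lambda>_. q) (- hp i) 2" by (auto simp: ord_ge_def)
    from local_form_order_unique[OF local_form_analytic this] have "q = 0" by simp
    thus False using Q_nonzero by (simp add: q_def)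
  qed
  with F show ?thesis using that by blast
qed

lemma X_pole':
  assumes "z \<notin> D"
  obtains i F where "i \<le> 3" "l i > 0" "z + hp i \<in> Lat" "local_form X z (- 2 * int (l i)) F" "F z \<noteq> 0"
proof -
  obtain i where i: "i \<le> 3" "l i > 0" "z + hp i \<in> Lat" using not_D[OF assms] by blast
  define p where "p = - (z + hp i)"
  have p: "p \<in> Lat" unfolding p_def using i(3) by (rule Lat_minus)
  obtain F where F: "local_form X (- hp i) (- 2 * int (l i)) F" "F (- hp i) \<noteq> 0"
    by (rule X_pole[OF i(1,2)])
  have zp: "z + p = - hp i" by (simp add: p_def)
  from local_form_shift[of X z p] F(1) zp
  have "local_form (\<lambda>s. X (s + p)) z (- 2 * int (l i)) (\<lambda>s. F (s + p))" by simp
  moreover have "\<forall>\<^sub>F s in at z. X s = X (s + p)"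
    using eventually_D by eventually_elim (use ellD(3)[OF ell_X _ p] in auto)
  ultimately have "local_form X z (- 2 * int (l i)) (\<lambda>s. F (s + p))" by (rule local_form_cong)
  thus ?thesis using that[OF i] F(2) zp by auto
qed

section \<open>Zeros of \<open>X\<close> and the logarithmic derivative\<close>

lemma X_zero_deriv:
  assumes "x \<in> D" "X x = 0" shows "deriv X x = wr \<or> deriv X x = - wr"
proof -
  have "- (deriv X x ^ 2 / 4) = q" using q_eq[OF assms(1)] assms(2) by simp
  moreover have "deriv X x ^ 2 = - 4 * - (deriv X x ^ 2 / 4)" by simp
  ultimately have "deriv X x ^ 2 = wr ^ 2" unfolding wr(1) by simp
  thus ?thesis by (simp add: power2_eq_iff)
qed

text \<open>The derivative of \<open>X\<close> is odd and periodic, so it vanishes at regular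
  half-periods, whereas the slope at a zero is nonzero. This is what will keep the t_j away from the
  \<omega>_i.\<close>

lemma X_half_period_nonzero:
  assumes "x \<in> D" "2 * x \<in> Lat" shows "X x \<noteq> 0"
proof
  assume "X x = 0"
  note X' = ell_deriv[OF ell_X]
  have "- x + 2 * x = x" by simp
  hence "deriv X x = deriv X (- x)"
    using ellD(3)[OF X' _ assms(2), of "- x"] assms(1) D_minus by metis
  also have "\<dots> = - deriv X x" using ellD(2)[OF X' assms(1)] by simp
  finally have "deriv X x = 0" by simp
  thus False using X_zero_deriv[OF assms(1) \<open>X x = 0\<close>] wr(2) by auto
qed

lemma X_zero_factor:
  assumes "z \<in> D" "X z = 0"
  obtains G where "G analytic_on {z}" "G z = deriv X z" "G z \<noteq> 0" "\<And>s. X s = (s - z) * G s"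
proof -
  obtain G where G: "G analytic_on {z}" "G z = deriv X z" "\<And>s. X s = (s - z) * G s"
    using analytic_zero_factor[OF ell_analytic[OF ell_X assms(1)] assms(2)] by blast
  have "G z \<noteq> 0" using G(2) X_zero_deriv[OF assms] wr(2) by auto
  thus ?thesis using that G by blast
qed

lemma eventually_X_nonzero: "\<forall>\<^sub>F s in at z. X s \<noteq> 0"
proof (cases "z \<in> D")
  case True
  show ?thesis
  proof (cases "X z = 0")
    case False
    thus ?thesis using analytic_at_neq_imp_eventually_neq[OF ell_analytic[OF ell_X True]] by blast
  next
    case zero: True
    obtain G where G: "G analytic_on {z}" "G z \<noteq> 0" "\<And>s. X s = (s - z) * G s"
      using X_zero_factor[OF True zero] by blast
    show ?thesis
      using analytic_at_neq_imp_eventually_neq[OF G(1,2)] eventually_at_neq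
      by eventually_elim (simp add: G(3))
  qed
next
  case False
  then obtain i F where "local_form X z (- 2 * int (l i)) F" "F z \<noteq> 0" by (rule X_pole')
  thus ?thesis by (rule local_form_eventually_nonzero)
qed

text \<open>At a zero of slope s the function \<open>phi\<close> has residue (s + wr) / (2 s), that
  is 1 for s = wr and 0 for s = -wr; this set collects the former.\<close>

definition pos_zeros where "pos_zeros = {x\<in>D. X x = 0 \<and> deriv X x = wr}"

definition zero_reps where "zero_reps = pos_zeros \<inter> fundamental_domain"

lemma pos_zeros_translate: "x \<in> pos_zeros \<Longrightarrow> p \<in> Lat \<Longrightarrow> x + p \<in> pos_zeros"
  using ellD(3)[OF ell_X] ellD(3)[OF ell_deriv[OF ell_X]] D_add_Lat by (auto simp: pos_zeros_def)

lemma finite_zero_reps: "finite zero_reps"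
proof -
  have "\<not> z islimpt {x. X x = 0}" for z
    using eventually_X_nonzero[of z] by (simp add: islimpt_iff_eventually)
  hence "finite (fundamental_cell \<inter> {x. X x = 0})"
    by (intro finite_not_islimpt_in_compact fundamental_cell)
  thus ?thesis
    by (rule finite_subset[rotated]) (use fundamental_cell(2) in \<open>auto simp: zero_reps_def pos_zeros_def\<close>)
qed

text \<open>Brings the residues of \<open>phi\<close> into the form in which they arise from a sum
  of zeta-functions over the representatives.\<close>

lemma zero_reps_count: "(\<Sum>t\<in>zero_reps. of_bool (z - t \<in> Lat)) = (of_bool (z \<in> pos_zeros) :: complex)"
proof (cases "z \<in> pos_zeros")
  case True
  obtain p where p: "p \<in> Lat" "z - p \<in> fundamental_domain" by (rule fundamental_domain_reduce)
  have zp: "z - p \<in> zero_reps"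
    using pos_zeros_translate[OF True Lat_minus[OF p(1)]] p(2) by (simp add: zero_reps_def)
  have "z - t \<in> Lat \<longleftrightarrow> t = z - p" if "t \<in> zero_reps" for t
  proof
    assume "z - t \<in> Lat"
    hence "(z - t) - p \<in> Lat" by (rule Lat_diff[OF _ p(1)])
    hence "(z - p) - t \<in> Lat" by (simp add: algebra_simps)
    thus "t = z - p" using fundamental_domain_unique[OF p(2)] that by (auto simp: zero_reps_def)
  qed (use p in simp)
  hence "(\<Sum>t\<in>zero_reps. of_bool (z - t \<in> Lat)) = (\<Sum>t\<in>zero_reps. if t = z - p then 1 else (0 :: complex))"
    by (intro sum.cong) auto
  thus ?thesis using True zp finite_zero_reps by simp
next
  case False
  have "z - t \<notin> Lat" if "t \<in> zero_reps" for t
    using pos_zeros_translate[of t "z - t"] that False by (auto simp: zero_reps_def)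
  thus ?thesis using False by simp
qed

text \<open>If X = f g with Wronskian f' g - f g' = wr, then this quotient is f' / f.\<close>

definition phi where "phi x = (deriv X x + wr) / (2 * X x)"

definition res where "res z = of_bool (z \<in> pos_zeros) - (\<Sum>i=0..3. of_nat (l i) * of_bool (z + hp i \<in> Lat) :: complex)"

lemma phi_simple_pole: "ord_ge (\<lambda>x. phi x - res z / (x - z)) z 0"
proof (cases "z \<in> D")
  case True
  have X': "deriv X analytic_on {z}" by (rule ell_analytic[OF ell_deriv[OF ell_X] True])
  have "of_nat (l i) * of_bool (z + hp i \<in> Lat) = (0 :: complex)" if "i \<in> {0..3}" for i
    using D_I[OF True] that by auto
  hence "(\<Sum>i=0..3. of_nat (l i) * of_bool (z + hp i \<in> Lat)) = (0 :: complex)"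
    by (intro sum.neutral) blast
  hence res: "res z = of_bool (z \<in> pos_zeros)" unfolding res_def by simp
  show ?thesis
  proof (cases "X z = 0")
    case False
    have "phi analytic_on {z}"
      unfolding phi_def[abs_def] using X' ell_analytic[OF ell_X True] False by (intro analytic_intros) auto
    moreover have "res z = 0" using False by (simp add: res pos_zeros_def)
    ultimately show ?thesis by (simp add: ord_ge_analytic)
  next
    case zero: True
    obtain G where G: "G analytic_on {z}" "G z = deriv X z" "G z \<noteq> 0" "\<And>s. X s = (s - z) * G s"
      by (rule X_zero_factor[OF True zero]) blast
    have aux: "d / (2 * (r * a)) - p / r = (d - 2 * p * a) / (2 * (r * a))" if "r \<noteq> 0" "a \<noteq> 0" for d r a p :: complex
      using that by (simp add: field_simps)
    \<comment> \<open>The numerator after subtracting the principal part. With G(z) = X'(z) it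
      vanishes at z for either slope: wr + wr - 2 wr with residue 1, and -wr + wr with residue
      0.\<close>
    define H0 where "H0 s = deriv X s + wr - 2 * res z * G s" for s
    have "H0 analytic_on {z}" unfolding H0_def[abs_def] by (intro analytic_intros X' G)
    moreover have "H0 z = 0"
      using X_zero_deriv[OF True zero] True zero wr(2) by (auto simp: H0_def res pos_zeros_def G(2))
    ultimately obtain H where H: "H analytic_on {z}" "\<And>s. H0 s = (s - z) * H s"
      using analytic_zero_factor by metis
    have "(\<lambda>s. H s / (2 * G s)) analytic_on {z}" by (intro analytic_intros H G) (use G in auto)
    moreover have "\<forall>\<^sub>F s in at z. phi s - res z / (s - z) = H s / (2 * G s)"
      using eventually_at_neq analytic_at_neq_imp_eventually_neq[OF G(1,3)]
    proof eventually_elim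
      case (elim s)
      have "phi s - res z / (s - z) = H0 s / (2 * ((s - z) * G s))"
        unfolding phi_def G(4) H0_def using aux elim by simp
      thus ?case using elim by (simp add: H(2))
    qed
    ultimately show ?thesis unfolding ord_ge_0_iff by blast
  qed
next
  case False
  obtain i F where i: "i \<le> 3" "l i > 0" "z + hp i \<in> Lat"
    and F: "local_form X z (- 2 * int (l i)) F" "F z \<noteq> 0"
    using X_pole'[OF False] by blast
  have other: "z + hp k \<notin> Lat" if "k \<le> 3" "k \<noteq> i" for k
  proof
    assume "z + hp k \<in> Lat"
    hence "(z + hp k) - (z + hp i) \<in> Lat" using i(3) by (rule Lat_diff)
    thus False using hp_diff_notin_Lat[OF that(1) i(1) that(2)] by simp
  qed
  have "(\<Sum>k=0..3. of_nat (l k) * of_bool (z + hp k \<in> Lat)) = (\<Sum>k=0..3. if k = i then of_nat (l i) else (0 :: complex))"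
    using other i(3) by (intro sum.cong) auto
  hence res: "res z = - of_nat (l i)" using False i(1) by (simp add: res_def pos_zeros_def)
  define N where "N = - 2 * int (l i)"
  note A = local_form_deriv[OF F(1), folded N_def]
  have Fan: "F analytic_on {z}" using local_formD(1)[OF F(1)] .
  \<comment> \<open>With X = F / (s - z)^(2 l_i), the quotient X' / (2 X) is -l_i / (s - z) + F' /
    (2 F), and wr / (2 X) is regular.\<close>
  have "(\<lambda>s. deriv F s / (2 * F s) + wr * (s - z) ^ (2 * l i) / (2 * F s)) analytic_on {z}"
    using Fan F(2) by (intro analytic_intros) auto
  moreover have "\<forall>\<^sub>F s in at z. phi s - res z / (s - z)
      = deriv F s / (2 * F s) + wr * (s - z) ^ (2 * l i) / (2 * F s)"
    using local_formD(2)[OF F(1)] local_formD(2)[OF A] eventually_at_neq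
      analytic_at_neq_imp_eventually_neq[OF Fan F(2)]
  proof eventually_elim
    case (elim s)
    define r where "r = s - z"
    define P where "P = r ^ (2 * l i)"
    have r: "r \<noteq> 0" "P \<noteq> 0" using elim by (auto simp: r_def P_def)
    have "r powi N = 1 / P" by (simp add: N_def P_def power_int_minus divide_inverse power_int_def nat_mult_distrib power_inverse)
    moreover have "r powi (N - 1) = 1 / (P * r)"
      using r calculation by (simp add: power_int_diff)
    ultimately have X: "X s = F s / P" and X': "deriv X s = (of_int N * F s + r * deriv F s) / (P * r)"
      using elim by (simp_all add: N_def r_def)
    have "phi s - res z / r = (deriv X s + wr) / (2 * X s) + of_nat (l i) / r"
      by (simp add: phi_def res)
    also have "\<dots> = deriv F s / (2 * F s) + wr * P / (2 * F s)"
      unfolding X X' using r elim(4) by (simp add: N_def field_simps)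
    finally show ?case by (simp add: r_def P_def)
  qed
  ultimately show ?thesis unfolding ord_ge_0_iff by blast
qed

section \<open>Reconstruction of \<open>phi\<close> from zeta-functions\<close>

definition zeta_part where
  "zeta_part x = (\<Sum>t\<in>zero_reps. wz (x - t)) - (\<Sum>i=0..3. of_nat (l i) * wz (x + hp i))"

lemma zeta_part_simple_pole: "ord_ge (\<lambda>x. zeta_part x - res z / (x - z)) z 0"
proof -
  have "ord_ge (\<lambda>x. (\<Sum>t\<in>zero_reps. wz (x - t) - of_bool (z - t \<in> Lat) / (x - z))
     - (\<Sum>i=0..3. of_nat (l i) * (wz (x - - hp i) - of_bool (z - - hp i \<in> Lat) / (x - z)))) z 0"
    by (intro ord_ge_diff ord_ge_sum ord_ge_cmult wz_simple_pole)
  moreover have "(\<Sum>t\<in>zero_reps. wz (x - t) - of_bool (z - t \<in> Lat) / (x - z))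
     - (\<Sum>i=0..3. of_nat (l i) * (wz (x - - hp i) - of_bool (z - - hp i \<in> Lat) / (x - z)))
     = zeta_part x - res z / (x - z)" for x
    unfolding zeta_part_def res_def zero_reps_count[symmetric]
    by (simp only: sum_subtractf sum_divide_distrib diff_divide_distrib right_diff_distrib
        times_divide_eq_right diff_minus_eq_add) algebra
  ultimately show ?thesis by (simp only:)
qed

lemma eventually_good:
  "\<forall>\<^sub>F s in at z. s \<in> D \<and> X s \<noteq> 0 \<and> (\<forall>t\<in>zero_reps. s - t \<notin> Lat) \<and> (\<forall>i\<in>{0..3}. s + hp i \<notin> Lat)"
  by (intro eventually_conj eventually_D eventually_X_nonzero eventually_ball_finite ballI
      eventually_not_Lat eventually_not_Lat' finite_zero_reps) simp

lemma phi_periodic: "s \<in> D \<Longrightarrow> p \<in> Lat \<Longrightarrow> phi (s + p) = phi s"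
  unfolding phi_def using ellD(3)[OF ell_X] ellD(3)[OF ell_deriv[OF ell_X]] by simp

lemma zeta_part_quasi:
  assumes "\<forall>t\<in>zero_reps. s - t \<notin> Lat" "\<forall>i\<in>{0..3}. s + hp i \<notin> Lat" "k \<le> 3"
  shows "zeta_part (s + 2 * hp k) = zeta_part s + 2 * (of_nat (card zero_reps) - of_nat (heun_size l)) * wz (hp k)"
proof -
  have 1: "wz (s + 2 * hp k - t) = wz (s - t) + 2 * wz (hp k)" if "t \<in> zero_reps" for t
    using wz_quasi[OF assms(3), of "s - t"] assms(1) that by (simp add: algebra_simps)
  have 2: "wz (s + 2 * hp k + hp i) = wz (s + hp i) + 2 * wz (hp k)" if "i \<in> {0..3}" for i
    using wz_quasi[OF assms(3), of "s + hp i"] assms(2) that by (simp add: algebra_simps)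
  have "(\<Sum>t\<in>zero_reps. wz (s + 2 * hp k - t)) = (\<Sum>t\<in>zero_reps. wz (s - t)) + of_nat (card zero_reps) * (2 * wz (hp k))"
    using 1 by (simp add: sum.distrib)
  moreover have "(\<Sum>i=0..3. of_nat (l i) * wz (s + 2 * hp k + hp i))
      = (\<Sum>i=0..3. of_nat (l i) * wz (s + hp i)) + of_nat (heun_size l) * (2 * wz (hp k))"
    using 2 by (simp add: distrib_left sum.distrib heun_size_def sum_distrib_right)
  ultimately show ?thesis by (simp add: zeta_part_def algebra_simps)
qed

text \<open>The difference g is entire and its derivative is elliptic, so g is affine with some
  slope a. Comparing its increments over both periods with the quasi-periods of
  \<open>zeta_part\<close> gives a \<omega>_k + n \<eta>_k = 0 for k = 1, 3, where n is the excess
  of zeros over l. By \<open>eta_independent\<close> both n and a are 0.\<close>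

lemma phi_decomposition:
  obtains \<beta> where "card zero_reps = heun_size l" "\<And>z. \<forall>\<^sub>F s in at z. phi s = zeta_part s + \<beta>"
proof -
  define n :: complex where "n = of_nat (card zero_reps) - of_nat (heun_size l)"
  have "ord_ge (\<lambda>x. phi x - zeta_part x) z 0" for z
    using ord_ge_diff[OF phi_simple_pole zeta_part_simple_pole] by simp
  then obtain g where g: "g holomorphic_on UNIV" "\<And>z. \<forall>\<^sub>F s in at z. phi s - zeta_part s = g s"
    using entire_extension[of "\<lambda>x. phi x - zeta_part x"] by blast
  have gd: "(g has_field_derivative deriv g z) (at z)" for z using holomorphic_derivI[OF g(1)] by simp
  have quasi: "g (z + 2 * hp k) = g z - 2 * n * wz (hp k)" if k: "k \<le> 3" for z k
  proof -
    have "(\<lambda>z. g (z + 2 * hp k)) holomorphic_on UNIV"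
      using holomorphic_on_compose_gen[of "\<lambda>z. z + 2 * hp k" UNIV g UNIV] g(1) by (simp add: o_def holomorphic_intros)
    moreover have "(\<lambda>z. g z - 2 * n * wz (hp k)) holomorphic_on UNIV" by (intro holomorphic_intros g)
    moreover have "\<forall>\<^sub>F s in at 0. g (s + 2 * hp k) = g s - 2 * n * wz (hp k)"
      using eventually_good[of 0] g(2)[of 0] g(2)[of "0 + 2 * hp k", unfolded eventually_at_shift]
    proof eventually_elim
      case (elim s)
      have 1: "phi (s + 2 * hp k) = phi s" using elim(1) by (intro phi_periodic) auto
      have 2: "zeta_part (s + 2 * hp k) = zeta_part s + 2 * n * wz (hp k)"
        unfolding n_def using elim(1) by (intro zeta_part_quasi k) auto
      show ?case unfolding elim(2)[symmetric] elim(3)[symmetric] 1 2 by simp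
    qed
    ultimately show ?thesis by (rule entire_ev_eq)
  qed
  have "deriv g (z + 2 * hp k) = deriv g z" if k: "k \<le> 3" for z k
  proof -
    have "((\<lambda>z. g (z + 2 * hp k)) has_field_derivative deriv g (z + 2 * hp k)) (at z)"
      by (intro DERIV_shift[THEN iffD1] gd)
    hence "((\<lambda>z. g z - 2 * n * wz (hp k)) has_field_derivative deriv g (z + 2 * hp k)) (at z)"
      by (simp add: quasi[OF k])
    from DERIV_unique[OF this DERIV_diff[OF gd DERIV_const]] show ?thesis by simp
  qed
  from this[of 1] this[of 3] have "\<And>z. deriv g (z + 2 * w1) = deriv g z" "\<And>z. deriv g (z + 2 * w3) = deriv g z"
    by simp_all
  then obtain a where a: "\<And>z. deriv g z = a"
    using entire_periodic_constant[of "deriv g"] holomorphic_deriv[OF g(1)] by auto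
  have lin: "g z = a * z + g 0" for z
  proof -
    have "((\<lambda>z. g z - a * z) has_field_derivative 0) (at z)" for z
      using DERIV_diff[OF gd[of z] DERIV_cmult_Id[of a]] a by simp
    hence "(\<lambda>z. g z - a * z) constant_on UNIV"
      by (intro has_field_derivative_0_imp_constant_on) auto
    then obtain c where "\<And>z. g z - a * z = c" by (auto simp: constant_on_def)
    from this[of z] this[of 0] show ?thesis by (simp add: algebra_simps)
  qed
  have A: "g (2 * w1) = g 0 - 2 * n * wz w1" "g (2 * w3) = g 0 - 2 * n * wz w3"
    using quasi[of 1 0] quasi[of 3 0] by simp_all
  have "2 * (a * w1 + n * wz w1) = 0" "2 * (a * w3 + n * wz w3) = 0"
    using A(1) lin[of "2 * w1"] A(2) lin[of "2 * w3"] by algebra+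
  hence aw: "a * w1 + n * wz w1 = 0" "a * w3 + n * wz w3 = 0" by (simp_all only: mult_eq_0_iff) simp_all
  hence "n * (wz w1 * w3 - wz w3 * w1) = 0" by algebra
  hence n0: "n = 0" using eta_independent by simp
  hence "a * w1 = 0" using aw(1) by simp
  hence a0: "a = 0" by simp
  have "card zero_reps = heun_size l" using n0 by (simp add: n_def)
  moreover have "\<forall>\<^sub>F s in at z. phi s = zeta_part s + g 0" for z
    using g(2)[of z]
  proof eventually_elim
    case (elim s)
    moreover have "g s = g 0" using lin[of s] a0 by simp
    ultimately show ?case by (simp add: algebra_simps)
  qed
  ultimately show ?thesis by (rule that)
qed

text \<open>The choice wr^2 = -4 q is exactly what turns the formula for q into this Riccati
  equation, which is the second order equation for a function with logarithmic derivative
  \<open>phi\<close>.\<close>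

lemma phi_riccati:
  assumes "s \<in> D" "X s \<noteq> 0" shows "deriv phi s + phi s ^ 2 = V s - E"
proof -
  have "(phi has_field_derivative (deriv (deriv X) s * (2 * X s) - (deriv X s + wr) * (2 * deriv X s)) / (2 * X s * (2 * X s))) (at s)"
    unfolding phi_def[abs_def] using assms(2)
    by (intro DERIV_divide) (auto intro!: derivative_eq_intros ell_DERIV[OF ell_X assms(1)] ell_DERIV[OF ell_deriv[OF ell_X] assms(1)])
  hence "deriv phi s = (deriv (deriv X) s * (2 * X s) - (deriv X s + wr) * (2 * deriv X s)) / (2 * X s * (2 * X s))"
    by (rule DERIV_imp_deriv)
  moreover have "(c * (2 * a) - (b + w) * (2 * b)) / (2 * a * (2 * a)) + ((b + w) / (2 * a)) ^ 2
      = (2 * a * c - b ^ 2 + w ^ 2) / (4 * a ^ 2)" if "a \<noteq> 0" for a b c w :: complex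
    using that by (simp add: field_simps power2_eq_square)
  ultimately have "deriv phi s + phi s ^ 2 = (2 * X s * deriv (deriv X) s - deriv X s ^ 2 + wr ^ 2) / (4 * X s ^ 2)"
    using assms(2) by (simp only: phi_def)
  also have "2 * X s * deriv (deriv X) s - deriv X s ^ 2 + wr ^ 2 = (V s - E) * (4 * X s ^ 2)"
    unfolding wr(1) q_eq[OF assms(1), symmetric] by (simp add: field_simps power2_eq_square)
  finally show ?thesis using assms(2) by simp
qed

text \<open>As \<open>X\<close> is even and its derivative odd, the derivative cancels in the sum.
  The nonzero remainder later yields linear independence.\<close>

lemma phi_reflect:
  assumes "s \<in> D" "X s \<noteq> 0" shows "phi s + phi (- s) = wr / X s"
  using ellD(2)[OF ell_X assms(1)] ellD(2)[OF ell_deriv[OF ell_X] assms(1)] assms(2)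
  by (simp add: phi_def field_simps)

text \<open>The t_j are the negatives of the representatives of the zeros with slope
  \<open>wr\<close>. The resulting function has \<open>phi\<close> as its logarithmic derivative and
  solves the equation by \<open>phi_riccati\<close>.\<close>

lemma bethe_solution:
  obtains c t where "heun_admissible w1 w3 l t"
    "heun_Lambda w1 w3 l c t \<in> heun_solutions w1 w3 l E D"
    "\<And>z. \<forall>\<^sub>F s in at z. bethe_phi l c t s = phi s"
proof -
  obtain \<beta> where \<beta>: "card zero_reps = heun_size l" "\<And>z. \<forall>\<^sub>F s in at z. phi s = zeta_part s + \<beta>"
    by (rule phi_decomposition) blast
  obtain e where e: "bij_betw e {1..heun_size l} zero_reps"
    using ex_bij_betw_nat_finite_1[OF finite_zero_reps] \<beta>(1) by auto
  define t where "t j = - e j" for j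
  \<comment> \<open>Compensates the \<eta>-terms of the co-sigma functions, so that
    \<open>bethe_const l c\<close> is \<beta>.\<close>
  define c where "c = \<beta> - (\<Sum>i=1..3. of_nat (l i) * wz (hp i))"
  have bphi: "bethe_phi l c t s = zeta_part s + \<beta>" for s
  proof -
    have "(\<Sum>u\<in>zero_reps. wz (s - u)) = (\<Sum>j=1..heun_size l. wz (s - e j))"
      by (rule sum.reindex_bij_betw[OF e, symmetric])
    thus ?thesis
      by (simp add: bethe_phi_def bethe_const_def c_def bethe_sum bethe_residue_def bethe_point_def t_def
          zeta_part_def sum_negf)
  qed
  have ev: "\<forall>\<^sub>F s in at z. bethe_phi l c t s = phi s" for z
    using \<beta>(2)[of z] by eventually_elim (simp add: bphi)
  have er: "e j \<in> zero_reps" if "j \<in> {1..heun_size l}" for j using e that by (auto simp: bij_betw_def)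
  have adm: "heun_admissible w1 w3 l t"
    unfolding heun_admissible_def
  proof (intro conjI ballI allI impI)
    fix j k assume jk: "j \<in> {1..heun_size l}" "k \<in> {1..heun_size l}" "j \<noteq> k"
    have "e k \<noteq> e j" using inj_onD[OF bij_betw_imp_inj_on[OF e] _ jk(2,1)] jk(3) by metis
    moreover have "e k \<in> fundamental_domain" "e j \<in> fundamental_domain"
      using er[OF jk(1)] er[OF jk(2)] unfolding zero_reps_def by blast+
    ultimately have "e k - e j \<notin> Lat" using fundamental_domain_unique by blast
    thus "t j - t k \<notin> Lat" by (simp add: t_def)
  next
    fix j i :: nat assume j: "j \<in> {1..heun_size l}" and i: "i \<le> 3"
    show "t j - hp i \<notin> Lat"
    proof
      assume *: "t j - hp i \<in> Lat"
      \<comment> \<open>A coincidence of t_j with a half-period would make twice the zero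
        \<open>e j\<close> a period, placing a zero of \<open>X\<close> at a regular
        half-period.\<close>
      have "- ((t j - hp i) + (t j - hp i)) - 2 * hp i \<in> Lat"
        by (rule Lat_diff[OF Lat_minus[OF Lat_add[OF * *]] two_hp_Lat])
      moreover have "- ((t j - hp i) + (t j - hp i)) - 2 * hp i = 2 * e j" by (simp add: t_def)
      ultimately have "2 * e j \<in> Lat" by (simp only:)
      moreover have "e j \<in> D" "X (e j) = 0"
        using er[OF j] unfolding zero_reps_def pos_zeros_def by blast+
      ultimately show False using X_half_period_nonzero by blast
    qed
  qed
  moreover have "heun_Lambda w1 w3 l c t \<in> heun_solutions w1 w3 l E D"
  proof (rule heun_solutionI[OF heun_Lambda_holomorphic])
    fix z
    show "\<forall>\<^sub>F s in at z. heun_H w1 w3 l (heun_Lambda w1 w3 l c t) s - E * heun_Lambda w1 w3 l c t s = 0"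
      using eventually_bethe_domain[where z = z and l = l and t = t] eventually_good[of z]
        eventually_at_imp_nhds[OF ev[of z]]
    proof eventually_elim
      case (elim s)
      have "deriv phi s = deriv (bethe_phi l c t) s"
        by (rule deriv_cong_ev[OF eventually_mono[OF elim(3)] refl]) simp
      also have "\<dots> = - (\<Sum>a\<in>bethe_index l. bethe_residue l a * wp (s - bethe_point t a))"
        by (rule DERIV_imp_deriv[OF bethe_phi_deriv[OF elim(1)]])
      finally have *: "deriv phi s = - (\<Sum>a\<in>bethe_index l. bethe_residue l a * wp (s - bethe_point t a))" .
      have "bethe_phi l c t s = phi s" using eventually_nhds_x_imp_x[OF elim(3)] .
      moreover have "deriv phi s + phi s ^ 2 = V s - E" using elim(2) by (intro phi_riccati) auto
      ultimately have "bethe_phi l c t s ^ 2 - (\<Sum>a\<in>bethe_index l. bethe_residue l a * wp (s - bethe_point t a)) = V s - E"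
        unfolding * by (simp only: uminus_add_conv_diff)
      thus ?case unfolding heun_H_def heun_Lambda_deriv2[OF elim(1)]
        by (simp only:) (simp add: algebra_simps)
    qed
  qed
  ultimately show ?thesis using ev by (rule that)
qed

text \<open>One pair c, t serves every U. Since U may be asymmetric, the reflected solution is
  formed on the symmetric set D and then restricted. The Wronskian of f(x) and f(-x) at s is -f(s)
  f(-s) wr / X(s), which is nonzero.\<close>

lemma bethe_basis:
  obtains c t where "heun_admissible w1 w3 l t"
    "\<And>U. open U \<Longrightarrow> connected U \<Longrightarrow> U \<noteq> {} \<Longrightarrow> U \<subseteq> D \<Longrightarrow>
       is_heun_solution_basis w1 w3 l E U (\<lambda>x. heun_Lambda w1 w3 l c t x) (\<lambda>x. heun_Lambda w1 w3 l c t (- x))"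
proof -
  obtain c t where adm: "heun_admissible w1 w3 l t"
    and sol: "heun_Lambda w1 w3 l c t \<in> heun_solutions w1 w3 l E D"
    and ev: "\<And>z. \<forall>\<^sub>F s in at z. bethe_phi l c t s = phi s"
    by (rule bethe_solution) blast
  define f where "f = heun_Lambda w1 w3 l c t"
  show ?thesis
  proof (rule that[OF adm])
    fix U assume U: "open U" "connected U" "U \<noteq> {}" "U \<subseteq> D"
    then obtain z where z: "z \<in> U" by blast
    have "\<forall>\<^sub>F s in at z. s \<in> U" using U z by (simp add: eventually_at_in_open')
    \<comment> \<open>The Wronskian is evaluated at one point s of U that is generic together with
      -s, where the logarithmic derivative is \<open>phi\<close> at both points.\<close>
    hence "\<forall>\<^sub>F s in at z. s \<in> U \<and> X s \<noteq> 0 \<and> s \<in> bethe_domain l t \<and> - s \<in> bethe_domain l t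
        \<and> bethe_phi l c t s = phi s \<and> bethe_phi l c t (- s) = phi (- s)"
      using eventually_X_nonzero[of z] eventually_bethe_domain[where z = z and l = l and t = t]
        eventually_bethe_domain[where z = "- z" and l = l and t = t, unfolded eventually_at_minus]
        ev[of z] ev[of "- z", unfolded eventually_at_minus]
      by eventually_elim simp
    then obtain s where s: "s \<in> U" "X s \<noteq> 0" "s \<in> bethe_domain l t" "- s \<in> bethe_domain l t"
      "bethe_phi l c t s = phi s" "bethe_phi l c t (- s) = phi (- s)"
      using eventually_happens[of _ "at z"] by fastforce
    have 1: "f s \<noteq> 0" "(f has_field_derivative f s * phi s) (at s)"
      using heun_Lambda_log_deriv[OF s(3), of c] s(5) by (auto simp: log_deriv_at_def f_def)
    have 2: "f (- s) \<noteq> 0" "(f has_field_derivative f (- s) * phi (- s)) (at (- s))"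
      using heun_Lambda_log_deriv[OF s(4), of c] s(6) by (auto simp: log_deriv_at_def f_def)
    have "((\<lambda>x. f (- x)) has_field_derivative f (- s) * phi (- s) * - 1) (at s)"
      by (rule DERIV_chain2[where f = f and g = "\<lambda>x. - x", OF 2(2)]) (auto intro!: derivative_eq_intros)
    from DERIV_imp_deriv[OF this] DERIV_imp_deriv[OF 1(2)]
    have "f s * deriv (\<lambda>x. f (- x)) s - deriv f s * f (- s) = - (f s * f (- s) * (phi s + phi (- s)))"
      by (simp add: algebra_simps)
    also have "phi s + phi (- s) = wr / X s" using phi_reflect s(1,2) U(4) by blast
    finally have "f s * deriv (\<lambda>x. f (- x)) s - deriv f s * f (- s) \<noteq> 0"
      using 1(1) 2(1) wr(2) s(2) by simp
    moreover have "f \<in> heun_solutions w1 w3 l E U" "(\<lambda>x. f (- x)) \<in> heun_solutions w1 w3 l E U"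
      using heun_solutions_subset[OF sol U(4)] heun_solutions_subset[OF heun_solutions_reflect[OF sol] U(4)]
      by (simp_all only: f_def)
    ultimately have "is_heun_solution_basis w1 w3 l E U f (\<lambda>x. f (- x))"
      using U(1,2) s(1) by (intro is_heun_solution_basisI[of _ _ _ _ s])
    thus "is_heun_solution_basis w1 w3 l E U (\<lambda>x. heun_Lambda w1 w3 l c t x) (\<lambda>x. heun_Lambda w1 w3 l c t (- x))"
      by (simp add: f_def)
  qed
qed

end

theorem theorem3p12:
  fixes w1 w3 :: complex and l :: "nat \<Rightarrow> nat"
  defines "\<omega> \<equiv> half_period w1 w3"
    and "wp \<equiv> weierstrass_p w1 w3"
    and "\<zeta> \<equiv> weierstrass_zeta w1 w3"
    and "e \<equiv> half_period_e w1 w3"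
    and "\<eta> \<equiv> half_period_eta w1 w3"
    and "L \<equiv> heun_size l"
  assumes upper: "Im (w3 / w1) > 0"
  shows
    "(\<forall>c t. heun_admissible w1 w3 l t \<longrightarrow>
        ((\<exists>E. heun_Lambda w1 w3 l c t \<in> heun_solutions w1 w3 l E (heun_domain w1 w3 l)) \<longleftrightarrow>
           (\<forall>j\<in>{1..L}. (\<Sum>k\<in>{1..L} - {j}. \<zeta> (- t j + t k)) - of_nat (l 0) * \<zeta> (- t j)
              - (\<Sum>i=1..3. of_nat (l i) * (\<zeta> (- t j + \<omega> i) - \<zeta> (\<omega> i))) = - c) \<and>
           (1 - of_bool (l 0 = 0)) * (c + (\<Sum>j=1..L. \<zeta> (t j))) = 0 \<and>
           (\<forall>i\<in>{1..3}. (1 - of_bool (l i = 0)) *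
              (c + of_nat L * \<zeta> (\<omega> i) + (\<Sum>j=1..L. \<zeta> (- \<omega> i + t j))) = 0)) \<and>
        (\<forall>E. heun_Lambda w1 w3 l c t \<in> heun_solutions w1 w3 l E (heun_domain w1 w3 l) \<longrightarrow>
           E = - (c ^ 2)
             + of_nat (l 0 * l 1 + l 2 * l 3) * e 1
             + of_nat (l 0 * l 2 + l 1 * l 3) * e 2
             + of_nat (l 0 * l 3 + l 1 * l 2) * e 3
             - (\<Sum>i=1..3. of_nat (l i) * \<eta> i * (2 * c + of_nat L * \<eta> i))
             - (\<Sum>j=1..L. \<Sum>i=0..3. of_nat (l i) * (wp (t j - \<omega> i) - \<zeta> (t j - \<omega> i) ^ 2))
             + (\<Sum>k=1..L. \<Sum>j=1..<k. wp (t j - t k) - \<zeta> (t j - t k) ^ 2)))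
     \<and>
     (\<forall>E. heun_Q w1 w3 l E \<noteq> 0 \<longrightarrow>
        (\<exists>c t. heun_admissible w1 w3 l t \<and>
           (\<forall>U. open U \<and> connected U \<and> U \<noteq> {} \<and> U \<subseteq> heun_domain w1 w3 l \<longrightarrow>
              is_heun_solution_basis w1 w3 l E U
                (\<lambda>x. heun_Lambda w1 w3 l c t x) (\<lambda>x. heun_Lambda w1 w3 l c t (- x)))))"
proof -
  interpret half_period_basis w1 w3 by standard (rule upper)
  interpret heun w1 w3 l by standard
  show ?thesis
    unfolding \<omega>_def wp_def \<zeta>_def e_def \<eta>_def L_def
  proof (intro conjI allI impI)
    fix c t assume adm: "heun_admissible w1 w3 l t"
    show "(\<exists>E. heun_Lambda w1 w3 l c t \<in> heun_solutions w1 w3 l E (heun_domain w1 w3 l)) \<longleftrightarrow>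
           (\<forall>j\<in>{1..heun_size l}. (\<Sum>k\<in>{1..heun_size l} - {j}. wz (- t j + t k)) - of_nat (l 0) * wz (- t j)
              - (\<Sum>i=1..3. of_nat (l i) * (wz (- t j + hp i) - wz (hp i))) = - c) \<and>
           (1 - of_bool (l 0 = 0)) * (c + (\<Sum>j=1..heun_size l. wz (t j))) = 0 \<and>
           (\<forall>i\<in>{1..3}. (1 - of_bool (l i = 0)) *
              (c + of_nat (heun_size l) * wz (hp i) + (\<Sum>j=1..heun_size l. wz (- hp i + t j))) = 0)"
      unfolding heun_Lambda_solution_iff[OF adm] bethe_conditions[symmetric] by blast
  next
    fix c t E assume adm: "heun_admissible w1 w3 l t"
      and "heun_Lambda w1 w3 l c t \<in> heun_solutions w1 w3 l E (heun_domain w1 w3 l)"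
    hence "E = bethe_energy l c t" using heun_Lambda_solution_iff by blast
    thus "E = - (c ^ 2)
             + of_nat (l 0 * l 1 + l 2 * l 3) * half_period_e w1 w3 1
             + of_nat (l 0 * l 2 + l 1 * l 3) * half_period_e w1 w3 2
             + of_nat (l 0 * l 3 + l 1 * l 2) * half_period_e w1 w3 3
             - (\<Sum>i=1..3. of_nat (l i) * half_period_eta w1 w3 i * (2 * c + of_nat (heun_size l) * half_period_eta w1 w3 i))
             - (\<Sum>j=1..heun_size l. \<Sum>i=0..3. of_nat (l i) * (weierstrass_p w1 w3 (t j - hp i) - wz (t j - hp i) ^ 2))
             + (\<Sum>k=1..heun_size l. \<Sum>j=1..<k. weierstrass_p w1 w3 (t j - t k) - wz (t j - t k) ^ 2)"
      unfolding bethe_energy_eq .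
  next
    fix E assume "heun_Q w1 w3 l E \<noteq> 0"
    then interpret heun_regular w1 w3 l E by unfold_locales
    show "\<exists>c t. heun_admissible w1 w3 l t \<and>
           (\<forall>U. open U \<and> connected U \<and> U \<noteq> {} \<and> U \<subseteq> heun_domain w1 w3 l \<longrightarrow>
              is_heun_solution_basis w1 w3 l E U
                (\<lambda>x. heun_Lambda w1 w3 l c t x) (\<lambda>x. heun_Lambda w1 w3 l c t (- x)))"
      using bethe_basis by metis
  qed
qed


end
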